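(* Let $\Gamma$ be a cyclic group of order $3$, let $(\tilde G,\tilde p)$ be a $\mathcal{C}_3$-generic framework in $\mathbb{R}^2$ (where $\mathcal{C}_3$ is generated by the counterclockwise rotation by $2\pi/3$ about the origin), with $\Gamma$-gain framework $(G,\psi,p)$ and $|V_0(G)|\le 1$. Then $(\tilde G,\tilde p)$ is infinitesimally rigid if and only if both of the following hold: (a) there is a spanning subgraph $(H,\psi|_{E(H)})$ of $(G,\psi)$ which is $(2,0,3,1)$-gain-tight; and (b) there is a spanning subgraph $(H,\psi|_{E(H)})$ of $(G,\psi)$ which is $(2,1,3,1)$-gain-tight.
   Context: **Frameworks.** A framework in $\mathbb{R}^2$ is a pair $(\tilde G,\tilde p)$ with $\tilde G$ a finite simple graph and $\tilde p:V(\tilde G)\to\mathbb{R}^2$ injective; it is assumed that $\tilde p(V(\tilde G))$ affinely spans $\mathbb{R}^2$. An infinitesimal motion is $m:V(\tilde G)\to\mathbb{R}^2$ with $(\tilde p(u)-\tilde p(v))^T(m(u)-m(v))=0$ for all edges $\{u,v\}$; it is trivial if $m(u)=M\tilde p(u)+t$ for a fixed skew-symmetric $M$ and vector $t$. $(\tilde G,\tilde p)$ is infinitesimally rigid if all its infinitesimal motions are trivial. The rigidity matrix $R(\tilde G,\tilde p)$ has one row per edge, the row of $\{u,v\}$ having $(\tilde p(u)-\tilde p(v))^T$ in the two columns of $u$, $(\tilde p(v)-\tilde p(u))^T$ in the two columns of $v$, and zeros elsewhere. **Symmetry.** $\Gamma=\langle\gamma\rangle$ acts on $\tilde G$ by graph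 automorphisms, and $\tau:\Gamma\to O(\mathbb{R}^2)$ is the faithful representation sending $\gamma$ to the counterclockwise rotation by $2\pi/3$. $(\tilde G,\tilde p)$ is $\mathcal{C}_3$-symmetric if $\tau(g)\tilde p(v)=\tilde p(gv)$ for all $g\in\Gamma$, $v\in V(\tilde G)$. It is $\mathcal{C}_3$-generic if it is $\mathcal{C}_3$-symmetric and $\operatorname{rank}R(\tilde G,\tilde p)\ge\operatorname{rank}R(\tilde G,\tilde q)$ for all $\mathcal{C}_3$-symmetric realisations $(\tilde G,\tilde q)$ (same action on $\tilde G$). A vertex is fixed if it is fixed by all of $\Gamma$, free if its stabiliser is trivial. **Quotient gain graph.** $G=\tilde G/\Gamma$ is the multigraph whose vertices and edges are the vertex orbits and edge orbits of $\tilde G$; $V_0(G)$ is the set of orbits of fixed vertices (fixed vertices of $G$) and $\overline{V(G)}$ the set of orbits of free vertices (free vertices of $G$). Choose a representative $v^\star$ of each vertex orbit $v$ and an orientation of each edge of $G$. The gain $\psi(e)\in\Gamma$ of an edge $e=(u,v)$ of $G$ is: the unique $g$ with $\{u^\star,gv^\star\}\in e$ if $u,v$ are both free (for a loop, up to inversion); an arbitrary element of $\Gamma$ if exactly one of $u,v$ is fixed. Put $p(v)=\tilde p(v^\star)$. Then $(G,\psi)$ is a quotient $\Gamma$-gain graph and $(G,\psi,p)$ the gain framework of $(\tilde G,\tilde p)$. **Sparsity.** For a subgraph $H$ of $G$, $V_0(H)=V(H)\cap V_0(G)$ and $\overline{V(H)}=V(H)\cap\overline{V(G)}$. The gain of a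 walk is the product of the $\psi(e)^{\pm1}$ along it, exponent $+1$ if $e$ is traversed along its orientation and $-1$ otherwise. $H$ is balanced if, after deleting all fixed vertices and their incident edges, every cycle (including loops and cycles formed by two parallel edges) has gain $\mathrm{id}$. $(G,\psi)$ is $(2,m,3,l)$-gain-sparse if (1) $|E(H)|\le 2|V(H)|-3$ for every balanced subgraph $H$ with $E(H)\ne\emptyset$, and (2) $|E(H)|\le 2|\overline{V(H)}|+m|V_0(H)|-l$ for every subgraph $H$ with $E(H)\neq\emptyset$. It is $(2,m,3,l)$-gain-tight if moreover $|E(G)|=2|\overline{V(G)}|+m|V_0(G)|-l$. A spanning subgraph has vertex set $V(G)$ and carries the restricted gains. *)

theory Defs
  imports
    "HOL-Algebra.Group_Action"
    "HOL-Algebra.Generated_Groups"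
    "HOL-Library.Function_Algebras"
    "Graph_Theory.Digraph_Component"
    "HOL-Analysis.Analysis"
begin

section \<open>Frameworks in the plane\<close>

definition simple_graph :: "'v set \<Rightarrow> 'v set set \<Rightarrow> bool" where
  "simple_graph V E \<longleftrightarrow> finite V \<and> (\<forall>e\<in>E. e \<subseteq> V \<and> card e = 2)"

definition framework :: "'v set \<Rightarrow> 'v set set \<Rightarrow> ('v \<Rightarrow> real^2) \<Rightarrow> bool" where
  "framework V E p \<longleftrightarrow>
     simple_graph V E \<and> inj_on p V \<and> affine hull (p ` V) = UNIV"

text \<open>Configurations and motions are total functions; only their values on \<open>V\<close> matter.\<close>

definition infinitesimal_motion ::
    "'v set set \<Rightarrow> ('v \<Rightarrow> real^2) \<Rightarrow> ('v \<Rightarrow> real^2) \<Rightarrow> bool" where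
  "infinitesimal_motion E p m \<longleftrightarrow>
     (\<forall>u v. {u, v} \<in> E \<longrightarrow> (p u - p v) \<bullet> (m u - m v) = 0)"

definition trivial_motion ::
    "'v set \<Rightarrow> ('v \<Rightarrow> real^2) \<Rightarrow> ('v \<Rightarrow> real^2) \<Rightarrow> bool" where
  "trivial_motion V p m \<longleftrightarrow>
     (\<exists>(M :: real^2^2) t. transpose M = - M \<and> (\<forall>u\<in>V. m u = M *v p u + t))"

definition infinitesimally_rigid ::
    "'v set \<Rightarrow> 'v set set \<Rightarrow> ('v \<Rightarrow> real^2) \<Rightarrow> bool" where
  "infinitesimally_rigid V E p \<longleftrightarrow>
     (\<forall>m. infinitesimal_motion E p m \<longrightarrow> trivial_motion V p m)"

text \<open>
  The rows of the rigidity matrix are indexed by edges and its columns by pairs of a vertex and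
  a coordinate; \<open>the_elem (e - {w})\<close> is the endpoint of \<open>e\<close> other than \<open>w\<close>. Since the vertex set
  is a set and not a type, a row is a function on all pairs, which vanishes outside \<open>V\<close>.
\<close>

definition rigidity_matrix :: "('v \<Rightarrow> real^2) \<Rightarrow> 'v set \<Rightarrow> 'v \<times> 2 \<Rightarrow> real" where
  "rigidity_matrix p e = (\<lambda>(w, i). if w \<in> e then (p w - p (the_elem (e - {w}))) $ i else 0)"

definition fun_scale :: "real \<Rightarrow> ('c \<Rightarrow> real) \<Rightarrow> 'c \<Rightarrow> real" where
  "fun_scale a f = (\<lambda>x. a * f x)"

lemma vector_space_fun_scale: "vector_space fun_scale"
  by unfold_locales (auto simp: fun_scale_def fun_eq_iff algebra_simps)

text \<open>The rank of a matrix with row index set \<open>R\<close>: the dimension of its row space.\<close>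

definition row_rank :: "'r set \<Rightarrow> ('r \<Rightarrow> 'c \<Rightarrow> real) \<Rightarrow> nat" where
  "row_rank R A = vector_space.dim fun_scale (A ` R)"

section \<open>Three-fold rotational symmetry\<close>

definition rotation2 :: "real \<Rightarrow> real^2^2" where
  "rotation2 \<theta> = vector [vector [cos \<theta>, - sin \<theta>], vector [sin \<theta>, cos \<theta>]]"

definition C3_representation :: "'g monoid \<Rightarrow> 'g \<Rightarrow> ('g \<Rightarrow> real^2^2) \<Rightarrow> bool" where
  "C3_representation \<Gamma> \<gamma> \<tau> \<longleftrightarrow>
     (\<forall>g\<in>carrier \<Gamma>. orthogonal_matrix (\<tau> g)) \<and>
     (\<forall>g\<in>carrier \<Gamma>. \<forall>h\<in>carrier \<Gamma>. \<tau> (g \<otimes>\<^bsub>\<Gamma>\<^esub> h) = \<tau> g ** \<tau> h) \<and>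
     inj_on \<tau> (carrier \<Gamma>) \<and>
     \<tau> \<gamma> = rotation2 (2 * pi / 3)"

definition graph_action ::
    "'g monoid \<Rightarrow> ('g \<Rightarrow> 'v \<Rightarrow> 'v) \<Rightarrow> 'v set \<Rightarrow> 'v set set \<Rightarrow> bool" where
  "graph_action \<Gamma> \<phi> V E \<longleftrightarrow>
     group_action \<Gamma> V \<phi> \<and> (\<forall>g\<in>carrier \<Gamma>. \<forall>e\<in>E. \<phi> g ` e \<in> E)"

definition C3_symmetric ::
    "'g monoid \<Rightarrow> ('g \<Rightarrow> real^2^2) \<Rightarrow> ('g \<Rightarrow> 'v \<Rightarrow> 'v) \<Rightarrow> 'v set \<Rightarrow> ('v \<Rightarrow> real^2) \<Rightarrow> bool" where
  "C3_symmetric \<Gamma> \<tau> \<phi> V p \<longleftrightarrow>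
     (\<forall>g\<in>carrier \<Gamma>. \<forall>v\<in>V. \<tau> g *v p v = p (\<phi> g v))"

definition C3_generic ::
    "'g monoid \<Rightarrow> ('g \<Rightarrow> real^2^2) \<Rightarrow> ('g \<Rightarrow> 'v \<Rightarrow> 'v) \<Rightarrow> 'v set \<Rightarrow> 'v set set
      \<Rightarrow> ('v \<Rightarrow> real^2) \<Rightarrow> bool" where
  "C3_generic \<Gamma> \<tau> \<phi> V E p \<longleftrightarrow>
     framework V E p \<and> C3_symmetric \<Gamma> \<tau> \<phi> V p \<and>
     (\<forall>q. framework V E q \<and> C3_symmetric \<Gamma> \<tau> \<phi> V q \<longrightarrow>
        row_rank E (rigidity_matrix p) \<ge> row_rank E (rigidity_matrix q))"

section \<open>Quotient gain graphs\<close>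

definition fixed_orbits :: "'g monoid \<Rightarrow> ('g \<Rightarrow> 'v \<Rightarrow> 'v) \<Rightarrow> 'v set \<Rightarrow> 'v set set" where
  "fixed_orbits \<Gamma> \<phi> V =
     {Group_Action.orbit \<Gamma> \<phi> v | v. v \<in> V \<and> stabilizer \<Gamma> \<phi> v = carrier \<Gamma>}"

definition free_orbits :: "'g monoid \<Rightarrow> ('g \<Rightarrow> 'v \<Rightarrow> 'v) \<Rightarrow> 'v set \<Rightarrow> 'v set set" where
  "free_orbits \<Gamma> \<phi> V =
     {Group_Action.orbit \<Gamma> \<phi> v | v. v \<in> V \<and> stabilizer \<Gamma> \<phi> v = {\<one>\<^bsub>\<Gamma>\<^esub>}}"

text \<open>
  A multigraph with an orientation of each edge is a digraph with possible loops and parallel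
  arcs. Below, \<open>rep\<close> chooses a representative of each vertex orbit, and the existence of an edge
  \<open>{u, v}\<close> in the orbit \<open>e\<close> says that \<open>tail G e\<close> and \<open>head G e\<close> are, in one of the two possible
  orders, the vertex orbits that \<open>e\<close> joins. If an end of \<open>e\<close> is fixed, its gain is an arbitrary
  group element; for a loop both \<open>g\<close> and its inverse are admissible.
\<close>

definition quotient_gain_graph ::
    "'g monoid \<Rightarrow> ('g \<Rightarrow> 'v \<Rightarrow> 'v) \<Rightarrow> 'v set \<Rightarrow> 'v set set \<Rightarrow> ('v set \<Rightarrow> 'v)
      \<Rightarrow> ('v set, 'v set set) pre_digraph \<Rightarrow> ('v set set \<Rightarrow> 'g) \<Rightarrow> bool" where
  "quotient_gain_graph \<Gamma> \<phi> V E rep G \<psi> \<longleftrightarrow>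
     verts G = orbits \<Gamma> V \<phi> \<and>
     arcs G = orbits \<Gamma> E (\<lambda>g e. \<phi> g ` e) \<and>
     (\<forall>e\<in>arcs G. \<exists>u v. {u, v} \<in> e \<and>
        tail G e = Group_Action.orbit \<Gamma> \<phi> u \<and> head G e = Group_Action.orbit \<Gamma> \<phi> v) \<and>
     (\<forall>x\<in>verts G. rep x \<in> x) \<and>
     (\<forall>e\<in>arcs G. \<psi> e \<in> carrier \<Gamma> \<and>
        (tail G e \<in> free_orbits \<Gamma> \<phi> V \<and> head G e \<in> free_orbits \<Gamma> \<phi> V \<longrightarrow>
           {rep (tail G e), \<phi> (\<psi> e) (rep (head G e))} \<in> e))"

definition gain_framework ::
    "'g monoid \<Rightarrow> ('g \<Rightarrow> 'v \<Rightarrow> 'v) \<Rightarrow> 'v set \<Rightarrow> 'v set set \<Rightarrow> ('v \<Rightarrow> real^2) \<Rightarrow> ('v set \<Rightarrow> 'v)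
      \<Rightarrow> ('v set, 'v set set) pre_digraph \<Rightarrow> ('v set set \<Rightarrow> 'g) \<Rightarrow> ('v set \<Rightarrow> real^2) \<Rightarrow> bool" where
  "gain_framework \<Gamma> \<phi> V E pt rep G \<psi> p \<longleftrightarrow>
     quotient_gain_graph \<Gamma> \<phi> V E rep G \<psi> \<and> (\<forall>x\<in>verts G. p x = pt (rep x))"

section \<open>Gain sparsity\<close>

text \<open>
  Walks ignore the orientation: a step \<open>(e, True)\<close> traverses \<open>e\<close> along its orientation,
  a step \<open>(e, False)\<close> against it.
\<close>

fun step_source :: "('a, 'b) pre_digraph \<Rightarrow> 'b \<times> bool \<Rightarrow> 'a" where
  "step_source G (e, d) = (if d then tail G e else head G e)"

fun step_target :: "('a, 'b) pre_digraph \<Rightarrow> 'b \<times> bool \<Rightarrow> 'a" where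
  "step_target G (e, d) = (if d then head G e else tail G e)"

fun undirected_walk :: "('a, 'b) pre_digraph \<Rightarrow> 'a \<Rightarrow> ('b \<times> bool) list \<Rightarrow> 'a \<Rightarrow> bool" where
  "undirected_walk G u [] v \<longleftrightarrow> u \<in> verts G \<and> u = v"
| "undirected_walk G u (s # w) v \<longleftrightarrow>
     fst s \<in> arcs G \<and> step_source G s = u \<and> undirected_walk G (step_target G s) w v"

text \<open>
  Distinctness of the edges excludes the closed walk that traverses a non-loop edge back and
  forth; loops and pairs of parallel edges are cycles of length one and two.
\<close>

definition undirected_cycle :: "('a, 'b) pre_digraph \<Rightarrow> ('b \<times> bool) list \<Rightarrow> bool" where
  "undirected_cycle G w \<longleftrightarrow>
     w \<noteq> [] \<and> (\<exists>u. undirected_walk G u w u) \<and>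
     distinct (map (step_source G) w) \<and> distinct (map fst w)"

fun walk_gain :: "'g monoid \<Rightarrow> ('b \<Rightarrow> 'g) \<Rightarrow> ('b \<times> bool) list \<Rightarrow> 'g" where
  "walk_gain \<Gamma> \<psi> [] = \<one>\<^bsub>\<Gamma>\<^esub>"
| "walk_gain \<Gamma> \<psi> ((e, d) # w) =
     (if d then \<psi> e else inv\<^bsub>\<Gamma>\<^esub> (\<psi> e)) \<otimes>\<^bsub>\<Gamma>\<^esub> walk_gain \<Gamma> \<psi> w"

definition balanced ::
    "'g monoid \<Rightarrow> 'a set \<Rightarrow> ('b \<Rightarrow> 'g) \<Rightarrow> ('a, 'b) pre_digraph \<Rightarrow> bool" where
  "balanced \<Gamma> V0 \<psi> H \<longleftrightarrow>
     (\<forall>w. undirected_cycle (H \<restriction> (verts H - V0)) w \<longrightarrow> walk_gain \<Gamma> \<psi> w = \<one>\<^bsub>\<Gamma>\<^esub>)"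

text \<open>
  \<open>(2, m, 3, l)\<close>-gain-sparsity and gain-tightness; \<open>V0\<close> and \<open>V1\<close> are the sets of fixed and of
  free vertices of the ambient gain graph. The counts are integers, so subtraction does not
  truncate.
\<close>

definition gain_sparse ::
    "'g monoid \<Rightarrow> 'a set \<Rightarrow> 'a set \<Rightarrow> int \<Rightarrow> int \<Rightarrow> ('a, 'b) pre_digraph \<Rightarrow> ('b \<Rightarrow> 'g) \<Rightarrow> bool" where
  "gain_sparse \<Gamma> V0 V1 m l G \<psi> \<longleftrightarrow>
     (\<forall>H. subgraph H G \<and> balanced \<Gamma> V0 \<psi> H \<and> arcs H \<noteq> {} \<longrightarrow>
        int (card (arcs H)) \<le> 2 * int (card (verts H)) - 3) \<and>
     (\<forall>H. subgraph H G \<and> arcs H \<noteq> {} \<longrightarrow>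
        int (card (arcs H)) \<le>
          2 * int (card (verts H \<inter> V1)) + m * int (card (verts H \<inter> V0)) - l)"

definition gain_tight ::
    "'g monoid \<Rightarrow> 'a set \<Rightarrow> 'a set \<Rightarrow> int \<Rightarrow> int \<Rightarrow> ('a, 'b) pre_digraph \<Rightarrow> ('b \<Rightarrow> 'g) \<Rightarrow> bool" where
  "gain_tight \<Gamma> V0 V1 m l G \<psi> \<longleftrightarrow>
     gain_sparse \<Gamma> V0 V1 m l G \<psi> \<and>
     int (card (arcs G)) =
       2 * int (card (verts G \<inter> V1)) + m * int (card (verts G \<inter> V0)) - l"

end

theory Submission
  imports Defs
begin

text \<open>
  In complex coordinates the rigidity matrix of a symmetric framework splits into one block for
  each character of \<open>\<Gamma>\<close>; the rows of a block are indexed by the edges of \<open>G\<close>. Each block has two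
  columns for a free vertex, and for a fixed vertex the blocks of the two nontrivial characters,
  which are conjugate, have one more column. The trivial motions contribute one dimension to the
  kernel of each block, a rotation to that of the trivial character and a translation to the other
  two, so the framework is rigid iff all blocks have corank 1.

  If a block has corank 1, then the edges of a row basis form a tight subgraph, because every
  subgraph, and with three dimensions every balanced one, has its own trivial motions. Conversely,
  the rows of a sparse gain graph are independent at generic positions. By induction one removes a
  vertex of degree at most three; at a vertex of degree three, one of the edges that join two of
  its neighbours can be added such that the rest remains sparse, since otherwise the three sets that
  obstruct these edges have a union that is too dense. Independence at one position
  implies independence at generic ones, because the determinants are polynomials along real lines;
  so the two blocks are treated simultaneously by one generic injective configuration.
\<close>

section \<open>Linear systems\<close>

text \<open>Rows contain both a position and its conjugate, so determinants are not holomorphic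
  polynomials; along a line with a real parameter conjugation again yields a polynomial, and
  finitely many conditions can be met at once. Independence is stated as solvability for all
  right-hand sides: a new vertex then only needs a suitable velocity, and upper bounds on the number
  of rows come from exhibiting kernel vectors. The hard point is the vertex of degree three.
  Obstructions are measured by \<open>2 * card U - card F\<close>, which is modular once common
  vertices on no common edge are counted too. A union of balanced sets need not be balanced; but
  then the potentials differ by a nonconstant factor on the overlap, whose excess is at least 4
  instead of 3, and this unit makes up for the loss. The degree-three argument is run only for the
  count with \<open>m = 1\<close>; for \<open>m = 0\<close> edges at the fixed vertex are first
  turned into loops. Finally, \<open>pt\<close> is only known to have maximal rank. Rigidity is
  proved at another configuration and carried over by the rank of the real rigidity matrix.\<close>

definition solvable_system :: "'y set \<Rightarrow> 'x set \<Rightarrow> ('y \<Rightarrow> 'x \<Rightarrow> 'k::field) \<Rightarrow> bool" where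
  "solvable_system Y X M \<longleftrightarrow> (\<forall>c. \<exists>x. \<forall>y\<in>Y. (\<Sum>i\<in>X. M y i * x i) = c y)"

text \<open>One equation with a nonzero coefficient is solved for one unknown, which lowers the
  number of equations and that of unknowns by one.\<close>

lemma homogeneous_solution:
  fixes M :: "'y \<Rightarrow> 'x \<Rightarrow> 'k::field"
  assumes "finite Y" "finite X" "card Y < card X"
  shows "\<exists>x. (\<exists>i\<in>X. x i \<noteq> 0) \<and> (\<forall>y\<in>Y. (\<Sum>i\<in>X. M y i * x i) = 0)"
  using assms
proof (induction Y arbitrary: X M rule: finite_induct)
  case empty
  then have "X \<noteq> {}" by auto
  then show ?case by (intro exI[of _ "\<lambda>_. 1"]) auto
next
  case (insert y Y)
  show ?case
  proof (cases "\<forall>i\<in>X. M y i = 0")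
    case True
    have "card Y < card X" using insert by simp
    from insert.IH[OF insert.prems(1) this, of M] True show ?thesis by auto
  next
    case False
    then obtain i0 where i0: "i0 \<in> X" "M y i0 \<noteq> 0" by auto
    let ?X = "X - {i0}"
    let ?M = "\<lambda>y' i. M y' i - M y' i0 * M y i / M y i0"
    have "finite ?X" "card Y < card ?X" using insert i0 by auto
    from insert.IH[OF this, of ?M] obtain x where x: "\<exists>i\<in>?X. x i \<noteq> 0"
      and sol: "\<forall>y'\<in>Y. (\<Sum>i\<in>?X. ?M y' i * x i) = 0" by blast
    define s where "s = (\<Sum>i\<in>?X. M y i * x i)"
    define x' where "x' = (\<lambda>i. if i = i0 then - s / M y i0 else x i)"
    have split: "(\<Sum>i\<in>X. M y' i * x' i) = M y' i0 * (- s / M y i0) + (\<Sum>i\<in>?X. M y' i * x i)" for y'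
    proof -
      have "(\<Sum>i\<in>X. M y' i * x' i) = M y' i0 * x' i0 + (\<Sum>i\<in>?X. M y' i * x' i)"
        using insert.prems i0 by (simp add: sum.remove)
      also have "(\<Sum>i\<in>?X. M y' i * x' i) = (\<Sum>i\<in>?X. M y' i * x i)"
        by (rule sum.cong) (auto simp: x'_def)
      finally show ?thesis by (simp add: x'_def)
    qed
    have "(\<Sum>i\<in>X. M y i * x' i) = 0"
      using i0 split[of y] by (simp add: s_def)
    moreover have "(\<Sum>i\<in>X. M y' i * x' i) = 0" if "y' \<in> Y" for y'
    proof -
      have "0 = (\<Sum>i\<in>?X. M y' i * x i - M y' i0 / M y i0 * (M y i * x i))"
        using sol that by (simp add: algebra_simps)
      also have "\<dots> = (\<Sum>i\<in>?X. M y' i * x i) - M y' i0 / M y i0 * s"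
        by (simp add: sum_subtractf s_def sum_distrib_left)
      finally show ?thesis by (simp add: split)
    qed
    moreover have "\<exists>i\<in>X. x' i \<noteq> 0" using x by (auto simp: x'_def)
    ultimately show ?thesis by blast
  qed
qed

text \<open>With more rows than columns, \<open>homogeneous_solution\<close> for the transposed
  matrix gives a linear relation \<open>l\<close> between the rows. It annihilates every attainable
  right-hand side, in particular a unit vector at some \<open>y0\<close> with
  \<open>l y0 \<noteq> 0\<close>.\<close>

lemma solvable_system_card_le:
  assumes "finite Y" "finite X" "solvable_system Y X M"
  shows "card Y \<le> card X"
proof (rule ccontr)
  assume "\<not> ?thesis"
  then obtain l where l: "\<exists>y\<in>Y. l y \<noteq> 0" "\<forall>i\<in>X. (\<Sum>y\<in>Y. M y i * l y) = 0"
    using homogeneous_solution[of X Y "\<lambda>i y. M y i"] assms by auto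
  then obtain y0 where y0: "y0 \<in> Y" "l y0 \<noteq> 0" by auto
  obtain x where x: "\<forall>y\<in>Y. (\<Sum>i\<in>X. M y i * x i) = (if y = y0 then 1 else 0)"
    using assms(3) unfolding solvable_system_def
    by (elim allE[of _ "\<lambda>y. if y = y0 then 1 else 0"]) auto
  have "l y0 = (\<Sum>y\<in>Y. l y * (\<Sum>i\<in>X. M y i * x i))"
  proof -
    have "(\<Sum>y\<in>Y. l y * (\<Sum>i\<in>X. M y i * x i)) = (\<Sum>y\<in>Y. if y = y0 then l y else 0)"
      by (rule sum.cong) (simp_all add: x)
    then show ?thesis using assms(1) y0 by simp
  qed
  also have "\<dots> = (\<Sum>i\<in>X. (\<Sum>y\<in>Y. M y i * l y) * x i)"
    unfolding sum_distrib_left sum_distrib_right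
    by (subst sum.swap) (simp add: mult_ac)
  also have "\<dots> = 0" using l by simp
  finally show False using y0 by simp
qed

text \<open>Elimination without division: row \<open>y'\<close> is multiplied by the pivot before
  the multiple of row \<open>y\<close> is subtracted, so the new entries are polynomial in the old
  ones. The genericity argument depends on this.\<close>

lemma solvable_system_reduce:
  fixes M :: "'y \<Rightarrow> 'x \<Rightarrow> 'k::field"
  assumes "finite X" "i0 \<in> X" "M y i0 \<noteq> 0" "y \<notin> Y"
  shows "solvable_system (insert y Y) X M \<longleftrightarrow>
    solvable_system Y (X - {i0}) (\<lambda>y' i. M y i0 * M y' i - M y' i0 * M y i)" (is "_ = ?R")
proof
  have split: "(\<Sum>i\<in>X. M y' i * x i) = M y' i0 * x i0 + (\<Sum>i\<in>X-{i0}. M y' i * x i)" for y' x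
    using assms by (simp add: sum.remove)
  have red: "(\<Sum>i\<in>X-{i0}. (M y i0 * M y' i - M y' i0 * M y i) * x i) =
      M y i0 * (\<Sum>i\<in>X-{i0}. M y' i * x i) - M y' i0 * (\<Sum>i\<in>X-{i0}. M y i * x i)" for y' x
    by (simp add: algebra_simps sum_subtractf sum_distrib_left)
  show ?R if S: "solvable_system (insert y Y) X M"
    unfolding solvable_system_def
  proof
    fix c :: "'y \<Rightarrow> 'k"
    \<comment> \<open>The reduced row is the pivot times the old one, so the target is divided by
      the pivot; with 0 on the right of row \<open>y\<close>, subtracting a multiple of that row
      does not change the target.\<close>
    obtain x where x: "\<forall>y'\<in>insert y Y. (\<Sum>i\<in>X. M y' i * x i) = (if y' = y then 0 else c y' / M y i0)"
      using S unfolding solvable_system_def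
      by (elim allE[of _ "\<lambda>y'. if y' = y then 0 else c y' / M y i0"]) auto
    have y: "M y i0 * x i0 + (\<Sum>i\<in>X-{i0}. M y i * x i) = 0" using x split[of y x] by simp
    have "(\<Sum>i\<in>X-{i0}. (M y i0 * M y' i - M y' i0 * M y i) * x i) = c y'" if "y' \<in> Y" for y'
    proof -
      have "M y' i0 * x i0 + (\<Sum>i\<in>X-{i0}. M y' i * x i) = c y' / M y i0"
        using x[rule_format, of y'] that assms(4) split[of y' x] by (cases "y' = y") simp_all
      then have "c y' = M y i0 * (M y' i0 * x i0 + (\<Sum>i\<in>X-{i0}. M y' i * x i))"
        using assms by simp
      also have "\<dots> = M y i0 * (\<Sum>i\<in>X-{i0}. M y' i * x i) + M y' i0 * (M y i0 * x i0)"
        by (simp add: algebra_simps)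
      also have "M y i0 * x i0 = - (\<Sum>i\<in>X-{i0}. M y i * x i)"
        using y by (simp add: eq_neg_iff_add_eq_0)
      finally show ?thesis unfolding red by simp
    qed
    then show "\<exists>x. \<forall>y'\<in>Y. (\<Sum>i\<in>X-{i0}. (M y i0 * M y' i - M y' i0 * M y i) * x i) = c y'" by blast
  qed
  show "solvable_system (insert y Y) X M" if S: ?R
    unfolding solvable_system_def
  proof
    fix c :: "'y \<Rightarrow> 'k"
    obtain x where x: "\<forall>y'\<in>Y. (\<Sum>i\<in>X-{i0}. (M y i0 * M y' i - M y' i0 * M y i) * x i) =
        M y i0 * c y' - M y' i0 * c y"
      using S unfolding solvable_system_def
      by (elim allE[of _ "\<lambda>y'. M y i0 * c y' - M y' i0 * c y"]) auto
    define s where "s = (\<Sum>i\<in>X-{i0}. M y i * x i)"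
    define x' where "x' = (\<lambda>i. if i = i0 then (c y - s) / M y i0 else x i)"
    have sp: "(\<Sum>i\<in>X. M y' i * x' i) = M y' i0 * ((c y - s) / M y i0) + (\<Sum>i\<in>X-{i0}. M y' i * x i)" for y'
    proof -
      have "(\<Sum>i\<in>X-{i0}. M y' i * x' i) = (\<Sum>i\<in>X-{i0}. M y' i * x i)"
        by (rule sum.cong) (auto simp: x'_def)
      then show ?thesis by (simp add: split x'_def)
    qed
    have "(\<Sum>i\<in>X. M y' i * x' i) = c y'" if "y' \<in> insert y Y" for y'
    proof (cases "y' = y")
      case True
      then show ?thesis using assms by (simp add: sp s_def)
    next
      case False
      with that have "M y i0 * (\<Sum>i\<in>X-{i0}. M y' i * x i) = M y i0 * c y' - M y' i0 * c y + M y' i0 * s"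
        using x unfolding red s_def by (auto simp: algebra_simps)
      then have "(\<Sum>i\<in>X-{i0}. M y' i * x i) = c y' - M y' i0 * (c y - s) / M y i0"
        using assms by (simp add: field_simps)
      then show ?thesis by (simp add: sp)
    qed
    then show "\<exists>x. \<forall>y\<in>insert y Y. (\<Sum>i\<in>X. M y i * x i) = c y" by blast
  qed
qed

section \<open>Genericity along real lines\<close>

text \<open>Because of the conjugates in the matrices, polynomials in the complex coordinates form
  too small a class. Restriction to lines with a real parameter gives a class closed under
  conjugation and avoids polynomials in several variables.\<close>

definition line_polynomial :: "(('a \<Rightarrow> complex) \<Rightarrow> complex) \<Rightarrow> bool" where
  "line_polynomial f \<longleftrightarrow>
     (\<forall>z0 z1. \<exists>q. \<forall>t::real. f (\<lambda>x. z0 x + of_real t * (z1 x - z0 x)) = poly q (of_real t))"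

lemma line_polynomialD:
  assumes "line_polynomial f"
  shows "\<exists>q. \<forall>t::real. f (\<lambda>x. z0 x + of_real t * (z1 x - z0 x)) = poly q (of_real t)"
  using assms by (simp add: line_polynomial_def)

lemma line_polynomial_const [intro, simp]: "line_polynomial (\<lambda>_. c)"
  unfolding line_polynomial_def by (intro allI exI[of _ "[:c:]"]) simp

lemma line_polynomial_coord [intro, simp]: "line_polynomial (\<lambda>z. z x)"
  unfolding line_polynomial_def
proof (intro allI)
  fix z0 z1 :: "'a \<Rightarrow> complex"
  show "\<exists>q. \<forall>t. z0 x + of_real t * (z1 x - z0 x) = poly q (of_real t)"
    by (intro exI[of _ "[:z0 x, z1 x - z0 x:]"]) simp
qed

lemma line_polynomial_mult [intro, simp]:
  assumes "line_polynomial f" "line_polynomial g"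
  shows "line_polynomial (\<lambda>z. f z * g z)"
  unfolding line_polynomial_def
proof (intro allI)
  fix z0 z1 :: "'a \<Rightarrow> complex"
  let ?L = "\<lambda>t::real. \<lambda>x. z0 x + of_real t * (z1 x - z0 x)"
  obtain p q where "\<forall>t. f (?L t) = poly p (of_real t)" "\<forall>t. g (?L t) = poly q (of_real t)"
    using line_polynomialD[OF assms(1), of z0 z1] line_polynomialD[OF assms(2), of z0 z1] by blast
  then show "\<exists>r. \<forall>t. f (?L t) * g (?L t) = poly r (of_real t)"
    by (intro exI[of _ "p * q"]) simp
qed

lemma line_polynomial_diff [intro, simp]:
  assumes "line_polynomial f" "line_polynomial g"
  shows "line_polynomial (\<lambda>z. f z - g z)"
  unfolding line_polynomial_def
proof (intro allI)
  fix z0 z1 :: "'a \<Rightarrow> complex"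
  let ?L = "\<lambda>t::real. \<lambda>x. z0 x + of_real t * (z1 x - z0 x)"
  obtain p q where "\<forall>t. f (?L t) = poly p (of_real t)" "\<forall>t. g (?L t) = poly q (of_real t)"
    using line_polynomialD[OF assms(1), of z0 z1] line_polynomialD[OF assms(2), of z0 z1] by blast
  then show "\<exists>r. \<forall>t. f (?L t) - g (?L t) = poly r (of_real t)"
    by (intro exI[of _ "p - q"]) simp
qed

text \<open>The parameter is real, so conjugating the coefficients conjugates the value.\<close>

lemma line_polynomial_cnj [intro, simp]:
  assumes "line_polynomial f" shows "line_polynomial (\<lambda>z. cnj (f z))"
  unfolding line_polynomial_def
proof (intro allI)
  fix z0 z1 :: "'a \<Rightarrow> complex"
  obtain q where q: "\<forall>t::real. f (\<lambda>x. z0 x + of_real t * (z1 x - z0 x)) = poly q (of_real t)"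
    using assms unfolding line_polynomial_def by blast
  have "cnj (poly q (of_real t)) = poly (map_poly cnj q) (of_real t)" for t :: real
    by (simp only: poly_cnj complex_cnj_complex_of_real)
  with q show "\<exists>q. \<forall>t. cnj (f (\<lambda>x. z0 x + of_real t * (z1 x - z0 x))) = poly q (of_real t)"
    by (intro exI[of _ "map_poly cnj q"]) simp
qed

text \<open>On the line from a point that is good for all of \<open>\<Phi>\<close> to a point that
  is good for \<open>f\<close>, none of the polynomials is zero, so all but finitely many parameters
  are good for all of them. The condition at \<open>o'\<close> is linear and survives on the line;
  it keeps the fixed vertex at the origin.\<close>

lemma line_polynomials_common_nonzero:
  assumes "finite \<Phi>" "\<And>f. f \<in> \<Phi> \<Longrightarrow> line_polynomial f"
    and "\<And>f. f \<in> \<Phi> \<Longrightarrow> \<exists>z. z o' = 0 \<and> f z \<noteq> 0"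
  shows "\<exists>z. z o' = 0 \<and> (\<forall>f\<in>\<Phi>. f z \<noteq> 0)"
  using assms
proof (induction \<Phi> rule: finite_induct)
  case empty
  then show ?case by (intro exI[of _ "\<lambda>_. 0"]) simp
next
  case (insert f \<Phi>)
  then obtain z0 where z0: "z0 o' = 0" "\<forall>f\<in>\<Phi>. f z0 \<noteq> 0" by auto
  obtain z1 where z1: "z1 o' = 0" "f z1 \<noteq> 0" using insert.prems(2) by blast
  let ?L = "\<lambda>t::real. \<lambda>x. z0 x + of_real t * (z1 x - z0 x)"
  have L0: "?L 0 = z0" and L1: "?L 1 = z1" by (simp_all add: fun_eq_iff)
  define S where "S = (\<lambda>h :: (_ \<Rightarrow> complex) \<Rightarrow> complex. {t. h (?L t) = 0})"
  have fin: "finite (S h)" if lp: "line_polynomial h" and nz: "h (?L t0) \<noteq> 0" for h and t0 :: real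
  proof -
    obtain q where q: "\<forall>t::real. h (?L t) = poly q (of_real t)"
      using line_polynomialD[OF lp] by blast
    then have "q \<noteq> 0" using nz by auto
    then have "finite {x. poly q x = 0}" by (rule poly_roots_finite)
    then have "finite ((of_real :: real \<Rightarrow> complex) -` {x. poly q x = 0})"
      by (rule finite_vimageI) (simp add: inj_def)
    moreover have "S h = (of_real :: real \<Rightarrow> complex) -` {x. poly q x = 0}"
      unfolding S_def vimage_def mem_Collect_eq by (rule Collect_cong) (simp only: q[rule_format])
    ultimately show ?thesis by (simp only:)
  qed
  have "finite (\<Union>h\<in>insert f \<Phi>. S h)"
  proof (rule finite_UN_I)
    show "finite (insert f \<Phi>)" using insert.hyps by simp
    fix h assume h: "h \<in> insert f \<Phi>"
    then consider "h = f" | "h \<in> \<Phi>" by auto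
    then show "finite (S h)"
    proof cases
      case 1
      have "h (?L 1) \<noteq> 0" unfolding L1 1 by (rule z1)
      then show ?thesis by (rule fin[rotated]) (use insert.prems h in auto)
    next
      case 2
      have "h (?L 0) \<noteq> 0" unfolding L0 using z0 2 by blast
      then show ?thesis by (rule fin[rotated]) (use insert.prems h in auto)
    qed
  qed
  then obtain t where t: "t \<notin> (\<Union>h\<in>insert f \<Phi>. S h)"
    using ex_new_if_finite[OF infinite_UNIV_char_0] by meson
  show ?case
  proof (intro exI conjI ballI)
    show "?L t o' = 0" using z0 z1 by simp
    show "h (?L t) \<noteq> 0" if "h \<in> insert f \<Phi>" for h
    proof -
      have "t \<notin> S h" using t that by blast
      then show ?thesis by (simp only: S_def mem_Collect_eq not_False_eq_True)
    qed
  qed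
qed

text \<open>Gaussian elimination with a pivot that does not vanish at \<open>z0\<close>.\<close>

lemma solvable_system_generic:
  assumes "finite Y" "finite X" "\<And>y i. line_polynomial (\<lambda>z. M z y i)"
    and "solvable_system Y X (M z0)"
  shows "\<exists>f. line_polynomial f \<and> f z0 \<noteq> 0 \<and> (\<forall>z. f z \<noteq> 0 \<longrightarrow> solvable_system Y X (M z))"
  using assms
proof (induction Y arbitrary: X M rule: finite_induct)
  case empty
  then show ?case by (intro exI[of _ "\<lambda>_. 1"]) (simp add: solvable_system_def)
next
  case (insert y Y)
  obtain x where "(\<Sum>i\<in>X. M z0 y i * x i) = 1"
    using insert.prems(3) unfolding solvable_system_def by (elim allE[of _ "\<lambda>_. 1"]) auto
  then obtain i0 where i0: "i0 \<in> X" "M z0 y i0 \<noteq> 0"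
    using sum.not_neutral_contains_not_neutral[of "\<lambda>i. M z0 y i * x i" X] by auto
  define M' where "M' = (\<lambda>z y' i. M z y i0 * M z y' i - M z y' i0 * M z y i)"
  have red: "solvable_system (insert y Y) X (M z) \<longleftrightarrow> solvable_system Y (X - {i0}) (M' z)"
    if "M z y i0 \<noteq> 0" for z
    unfolding M'_def by (rule solvable_system_reduce) (use insert i0 that in simp_all)
  have "line_polynomial (\<lambda>z. M' z y' i)" for y' i
    unfolding M'_def by (intro line_polynomial_diff line_polynomial_mult insert.prems(2))
  moreover have "solvable_system Y (X - {i0}) (M' z0)"
    using red[OF i0(2)] insert.prems(3) by simp
  ultimately obtain f where f: "line_polynomial f" "f z0 \<noteq> 0"
      "\<And>z. f z \<noteq> 0 \<Longrightarrow> solvable_system Y (X - {i0}) (M' z)"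
    using insert.IH[of "X - {i0}" M'] insert.prems(1) by (metis finite_Diff)
  let ?f = "\<lambda>z. M z y i0 * f z"
  have "solvable_system (insert y Y) X (M z)" if "?f z \<noteq> 0" for z
    using red[of z] f(3)[of z] that by simp
  moreover have "line_polynomial ?f" by (intro line_polynomial_mult insert.prems(2) f(1))
  moreover have "?f z0 \<noteq> 0" using f(2) i0 by simp
  ultimately show ?case by blast
qed

section \<open>Sparse gain graphs\<close>

text \<open>
  An edge \<open>(u, v, g)\<close> carries its gain as a complex cube root of unity. The vertex \<open>q0\<close> plays the
  role of the fixed vertex, so gains of edges at \<open>q0\<close> are ignored. A gain graph is balanced iff
  it has a potential.
\<close>

type_synonym 'a gain_edge = "'a \<times> 'a \<times> complex"

definition verts_of :: "'a gain_edge set \<Rightarrow> 'a set" where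
  "verts_of F = (\<Union>(u, v, g)\<in>F. {u, v})"

text \<open>A switching function: replacing each representative \<open>u\<close> by its copy rotated
  by \<open>inverse (\<theta> u)\<close> makes all gains away from \<open>q0\<close>
  trivial.\<close>

definition potential :: "'a \<Rightarrow> ('a \<Rightarrow> complex) \<Rightarrow> 'a gain_edge set \<Rightarrow> bool" where
  "potential q0 \<theta> F \<longleftrightarrow> (\<forall>x. \<theta> x ^ 3 = 1) \<and>
     (\<forall>(u, v, g)\<in>F. u \<noteq> q0 \<and> v \<noteq> q0 \<longrightarrow> \<theta> u = g * \<theta> v)"

text \<open>A loop comes from an edge between two different vertices of one orbit; hence its gain is
  nontrivial and it is not at \<open>q0\<close>.\<close>

definition valid_edge :: "'a \<Rightarrow> 'a gain_edge \<Rightarrow> bool" where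
  "valid_edge q0 = (\<lambda>(u, v, g). g ^ 3 = 1 \<and> (u = v \<longrightarrow> g \<noteq> 1 \<and> u \<noteq> q0))"

text \<open>\<open>U\<close> may contain vertices on no edge of \<open>F\<close>; this freedom is
  what makes the count modular in \<open>excess_union\<close>.\<close>

definition excess :: "'a set \<Rightarrow> 'a gain_edge set \<Rightarrow> int" where
  "excess U F = 2 * int (card U) - int (card F)"

text \<open>With \<open>q0\<close> counted in \<open>verts_of F\<close>, the second bound is the one
  for \<open>m = 1\<close>: twice the number of free vertices, plus 1 for \<open>q0\<close> if
  present, minus 1.\<close>

definition sparse_edges :: "'a \<Rightarrow> 'a gain_edge set \<Rightarrow> bool" where
  "sparse_edges q0 E \<longleftrightarrow> finite E \<and> (\<forall>e\<in>E. valid_edge q0 e) \<and>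
     (\<forall>F\<subseteq>E. F \<noteq> {} \<longrightarrow>
        ((\<exists>\<theta>. potential q0 \<theta> F) \<longrightarrow> 3 \<le> excess (verts_of F) F) \<and>
        1 + of_bool (q0 \<in> verts_of F) \<le> excess (verts_of F) F)"

lemma verts_of_simps [simp]:
  "verts_of {} = {}"
  "verts_of (insert e F) = {fst e, fst (snd e)} \<union> verts_of F"
  "verts_of (F \<union> F') = verts_of F \<union> verts_of F'"
  by (auto simp: verts_of_def)

lemma verts_of_mono: "F \<subseteq> F' \<Longrightarrow> verts_of F \<subseteq> verts_of F'"
  by (auto simp: verts_of_def)

lemma ends_subset_verts_of: "e \<in> F \<Longrightarrow> {fst e, fst (snd e)} \<subseteq> verts_of F"
  by (cases e) (auto simp: verts_of_def)

lemma finite_verts_of [simp]: "finite F \<Longrightarrow> finite (verts_of F)"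
  by (auto simp: verts_of_def)

lemma verts_of_eq_empty: "verts_of F = {} \<longleftrightarrow> F = {}"
  by (auto simp: verts_of_def)

lemma potential_subset: "potential q0 \<theta> F' \<Longrightarrow> F \<subseteq> F' \<Longrightarrow> potential q0 \<theta> F"
  by (auto simp: potential_def)

lemma potential_nonzero: "potential q0 \<theta> F \<Longrightarrow> \<theta> x \<noteq> 0"
  by (metis potential_def zero_neq_one power_zero_numeral)

lemma potential_scale:
  "potential q0 \<theta> F \<Longrightarrow> c ^ 3 = 1 \<Longrightarrow> potential q0 (\<lambda>x. c * \<theta> x) F"
  by (auto simp: potential_def power_mult_distrib)

lemma potential_merge:
  assumes "potential q0 \<theta> F" "potential q0 \<theta>' F'"
    and "\<And>x. x \<in> verts_of F \<Longrightarrow> x \<in> verts_of F' \<Longrightarrow> x \<noteq> q0 \<Longrightarrow> \<theta> x = \<theta>' x"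
  shows "potential q0 (\<lambda>x. if x \<in> verts_of F then \<theta> x else \<theta>' x) (F \<union> F')"
proof -
  have "(if u \<in> verts_of F then \<theta> u else \<theta>' u) = g * (if v \<in> verts_of F then \<theta> v else \<theta>' v)"
    if "(u, v, g) \<in> F \<union> F'" "u \<noteq> q0" "v \<noteq> q0" for u v g
  proof (cases "(u, v, g) \<in> F")
    case True
    then have "u \<in> verts_of F" "v \<in> verts_of F" by (auto simp: verts_of_def)
    then show ?thesis using assms(1) that True by (auto simp: potential_def)
  next
    case False
    then have F': "(u, v, g) \<in> F'" using that by auto
    then have "u \<in> verts_of F'" "v \<in> verts_of F'" by (auto simp: verts_of_def)
    moreover have "\<theta>' u = g * \<theta>' v" using assms(2) F' that by (auto simp: potential_def)
    ultimately show ?thesis using assms(3) that by auto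
  qed
  then show ?thesis using assms(1,2) by (auto simp: potential_def)
qed

lemma sparse_edges_subset: "sparse_edges q0 E \<Longrightarrow> F \<subseteq> E \<Longrightarrow> sparse_edges q0 F"
  unfolding sparse_edges_def by (meson finite_subset subset_iff subset_trans)

text \<open>This is an equality because the last term counts all common vertices, also those on no
  common edge. The blocks below are combined by this formula, and the work lies in lower bounds for
  its last term.\<close>

lemma excess_union:
  assumes "finite F" "finite F'"
  shows "excess (verts_of (F \<union> F')) (F \<union> F') =
    excess (verts_of F) F + excess (verts_of F') F' - excess (verts_of F \<inter> verts_of F') (F \<inter> F')"
  using card_Un_Int[OF assms] card_Un_Int[of "verts_of F" "verts_of F'"] assms
  by (simp add: excess_def)

lemma excess_superset:
  assumes "finite U" "verts_of I \<subseteq> U"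
  shows "excess U I = excess (verts_of I) I + 2 * int (card (U - verts_of I))"
  using assms card_Diff_subset[of "verts_of I" U] card_mono[OF assms] finite_subset[OF assms(2,1)]
  by (simp add: excess_def)

section \<open>Lower bounds for the excess inside a sparse gain graph\<close>

context
  fixes q0 :: 'a and E :: "'a gain_edge set"
  assumes sparse: "sparse_edges q0 E"
begin

lemma sparse_finite: "F \<subseteq> E \<Longrightarrow> finite F"
  using sparse by (auto simp: sparse_edges_def dest: finite_subset)

text \<open>Every additional vertex adds 2, enough to pay for the extra unit at \<open>q0\<close>; a
  single vertex without edges has excess 2 already.\<close>

lemma sparse_excess:
  assumes "I \<subseteq> E" "finite U" "verts_of I \<subseteq> U" "U \<noteq> {}"
  shows "1 + of_bool (q0 \<in> U) \<le> excess U I"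
proof (cases "I = {}")
  case True
  moreover have "1 \<le> card U" using assms by (simp add: card_gt_0_iff Suc_leI)
  ultimately show ?thesis by (simp add: excess_def)
next
  case False
  then have *: "1 + of_bool (q0 \<in> verts_of I) \<le> excess (verts_of I) I"
    using sparse assms unfolding sparse_edges_def by blast
  have "card (U - verts_of I) \<ge> 1" if "q0 \<in> U" "q0 \<notin> verts_of I"
    using that assms by (metis DiffI One_nat_def Suc_leI card_gt_0_iff empty_iff finite_Diff)
  then show ?thesis using * assms(3) unfolding excess_superset[OF assms(2,3)]
    by (cases "q0 \<in> U"; cases "q0 \<in> verts_of I") auto
qed

lemma balanced_excess_nonempty:
  assumes "I \<subseteq> E" "potential q0 \<theta> I" "finite U" "verts_of I \<subseteq> U" "I \<noteq> {}"
  shows "3 \<le> excess U I" "U \<noteq> verts_of I \<Longrightarrow> 5 \<le> excess U I"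
proof -
  have *: "3 \<le> excess (verts_of I) I"
    using sparse assms unfolding sparse_edges_def by blast
  then show "3 \<le> excess U I" unfolding excess_superset[OF assms(3,4)] by simp
  assume "U \<noteq> verts_of I"
  then have "card (U - verts_of I) \<ge> 1"
    using assms by (metis Diff_eq_empty_iff One_nat_def Suc_leI card_gt_0_iff finite_Diff subset_antisym)
  then show "5 \<le> excess U I" using * unfolding excess_superset[OF assms(3,4)] by simp
qed

lemma balanced_excess_ge2:
  assumes "I \<subseteq> E" "potential q0 \<theta> I" "finite U" "verts_of I \<subseteq> U" "U \<noteq> {}"
  shows "2 \<le> excess U I"
proof (cases "I = {}")
  case True
  then show ?thesis using assms by (auto simp: excess_def card_gt_0_iff Suc_leI)
next
  case False
  then show ?thesis using balanced_excess_nonempty(1)[OF assms(1-4)] by simp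
qed

text \<open>Two vertices without edges have excess 4, and a nonempty balanced set has excess at
  least 3 by sparsity.\<close>

lemma balanced_excess_ge3:
  assumes "I \<subseteq> E" "potential q0 \<theta> I" "finite U" "verts_of I \<subseteq> U" "x \<in> U" "y \<in> U" "x \<noteq> y"
  shows "3 \<le> excess U I" "I = {} \<Longrightarrow> 4 \<le> excess U I"
proof -
  have "card {x, y} \<le> card U" using assms by (intro card_mono) auto
  then show *: "I = {} \<Longrightarrow> 4 \<le> excess U I" using assms by (simp add: excess_def)
  then show "3 \<le> excess U I" using balanced_excess_nonempty(1)[OF assms(1-4)] by fastforce
qed

text \<open>A nonempty balanced set would need excess 3, but one vertex contributes only 2.\<close>

lemma balanced_single_vertex:
  assumes "I \<subseteq> E" "potential q0 \<theta> I" "verts_of I \<subseteq> {x}"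
  shows "I = {}"
proof (rule ccontr)
  assume "I \<noteq> {}"
  from balanced_excess_nonempty(1)[OF assms(1,2) _ assms(3) this] show False
    by (simp add: excess_def)
qed

text \<open>
  The quotient of two potentials is constant on the components of \<open>I\<close> minus \<open>q0\<close>, so \<open>I\<close>
  splits into two balanced parts that share at most \<open>q0\<close>.
\<close>

lemma excess_two_potentials:
  assumes I: "I \<subseteq> E" "potential q0 \<theta> I" "potential q0 \<theta>' I" and U: "finite U" "verts_of I \<subseteq> U"
    and xy: "x \<in> U" "y \<in> U" "x \<noteq> q0" "y \<noteq> q0" "\<theta> x / \<theta>' x \<noteq> \<theta> y / \<theta>' y"
  shows "4 \<le> excess U I" "q0 \<notin> U \<Longrightarrow> excess U I \<le> 4 \<Longrightarrow> I = {}"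
proof -
  define \<rho> where "\<rho> = (\<lambda>z. \<theta> z / \<theta>' z)"
  define U1 where "U1 = {z\<in>U. z \<noteq> q0 \<and> \<rho> z = \<rho> x}"
  define U2 where "U2 = {z\<in>U. z \<noteq> q0 \<and> \<rho> z \<noteq> \<rho> x}"
  \<comment> \<open>By \<open>same\<close> below no edge joins \<open>U1\<close> to
    \<open>U2\<close>. An edge at \<open>q0\<close> goes to the part of its other end, and
    \<open>q0\<close> itself, if in \<open>U\<close>, to both parts.\<close>
  define I1 where "I1 = {e\<in>I. verts_of {e} \<inter> U1 \<noteq> {}}"
  define I2 where "I2 = {e\<in>I. verts_of {e} \<inter> U1 = {}}"
  define C where "C = U \<inter> {q0}"
  have x: "x \<in> U1" and y: "y \<in> U2" using xy by (auto simp: U1_def U2_def \<rho>_def)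
  have fin: "finite U1" "finite U2" "finite C" "finite I1" "finite I2"
    using U sparse_finite[OF I(1)] by (auto simp: U1_def U2_def C_def I1_def I2_def)
  have Ueq: "U = U1 \<union> U2 \<union> C" "U1 \<inter> U2 = {}" "(U1 \<union> U2) \<inter> C = {}" "U1 \<inter> C = {}" "U2 \<inter> C = {}"
    by (auto simp: U1_def U2_def C_def)
  have Ieq: "I = I1 \<union> I2" "I1 \<inter> I2 = {}" by (auto simp: I1_def I2_def)
  have valid: "valid_edge q0 e" if "e \<in> I" for e
    using that I sparse by (auto simp: sparse_edges_def)
  have same: "\<rho> u = \<rho> v" if "(u, v, g) \<in> I" "u \<noteq> q0" "v \<noteq> q0" for u v g
  proof -
    have "g \<noteq> 0" using valid[OF that(1)] by (auto simp: valid_edge_def)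
    moreover have "\<theta> u = g * \<theta> v" "\<theta>' u = g * \<theta>' v" using that I by (auto simp: potential_def)
    ultimately show ?thesis by (simp add: \<rho>_def)
  qed
  have ends: "u \<in> U" "v \<in> U" "u = v \<longrightarrow> u \<noteq> q0" if "(u, v, g) \<in> I" for u v g
    using that U(2) valid[OF that] by (auto simp: verts_of_def valid_edge_def)
  have V1: "verts_of I1 \<subseteq> U1 \<union> C"
  proof
    fix z assume "z \<in> verts_of I1"
    then obtain u v g where e: "(u, v, g) \<in> I1" "z = u \<or> z = v" by (auto simp: verts_of_def)
    then have eI: "(u, v, g) \<in> I" "u \<in> U1 \<or> v \<in> U1" by (auto simp: I1_def)
    then show "z \<in> U1 \<union> C" using ends[OF eI(1)] same[OF eI(1)] e(2) by (auto simp: U1_def C_def)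
  qed
  have V2: "verts_of I2 \<subseteq> U2 \<union> C"
  proof
    fix z assume "z \<in> verts_of I2"
    then obtain u v g where e: "(u, v, g) \<in> I2" "z = u \<or> z = v" by (auto simp: verts_of_def)
    then have eI: "(u, v, g) \<in> I" "u \<notin> U1 \<and> v \<notin> U1" by (auto simp: I2_def)
    then show "z \<in> U2 \<union> C" using ends[OF eI(1)] e(2) by (auto simp: U1_def U2_def C_def)
  qed
  have sub: "I1 \<subseteq> E" "I2 \<subseteq> E" "potential q0 \<theta> I1" "potential q0 \<theta> I2"
    using I by (auto simp: I1_def I2_def intro: potential_subset)
  have fin': "finite (U1 \<union> C)" "finite (U2 \<union> C)" using fin by auto
  have cards: "card U = card U1 + card U2 + card C" "card (U1 \<union> C) = card U1 + card C"
      "card (U2 \<union> C) = card U2 + card C" "card I = card I1 + card I2"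
    using Ueq Ieq fin by (simp_all add: card_Un_disjoint)
  \<comment> \<open>If \<open>q0\<close> is present it is counted in both parts, and the bounds give
    \<open>3 + 3 - 2\<close>; if it is absent they give \<open>2 + 2\<close>. Both are 4.\<close>
  have sum: "excess U I = excess (U1 \<union> C) I1 + excess (U2 \<union> C) I2 - 2 * int (card C)"
    unfolding excess_def cards by simp
  show "4 \<le> excess U I"
  proof (cases "q0 \<in> U")
    case True
    then have C: "C = {q0}" by (auto simp: C_def)
    have "3 \<le> excess (U1 \<union> C) I1" "3 \<le> excess (U2 \<union> C) I2"
      using balanced_excess_ge3(1)[OF sub(1,3) fin'(1) V1, of x q0]
        balanced_excess_ge3(1)[OF sub(2,4) fin'(2) V2, of y q0] C x y xy by auto
    then show ?thesis using sum C by simp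
  next
    case False
    then have C: "C = {}" by (auto simp: C_def)
    have "2 \<le> excess (U1 \<union> C) I1" "2 \<le> excess (U2 \<union> C) I2"
      using balanced_excess_ge2[OF sub(1,3) fin'(1) V1]
        balanced_excess_ge2[OF sub(2,4) fin'(2) V2] x y by auto
    then show ?thesis using sum C by simp
  qed
  assume "q0 \<notin> U" and le: "excess U I \<le> 4"
  then have C: "C = {}" by (auto simp: C_def)
  have "2 \<le> excess (U1 \<union> C) I1" "2 \<le> excess (U2 \<union> C) I2"
    using balanced_excess_ge2[OF sub(1,3) fin'(1) V1]
      balanced_excess_ge2[OF sub(2,4) fin'(2) V2] x y by auto
  then have "excess (U1 \<union> C) I1 < 3" "excess (U2 \<union> C) I2 < 3" using le sum C by auto
  then have "I1 = {}" "I2 = {}"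
    using balanced_excess_nonempty(1)[OF sub(1,3) fin'(1) V1]
      balanced_excess_nonempty(1)[OF sub(2,4) fin'(2) V2] by force+
  then show "I = {}" using Ieq by simp
qed

end

section \<open>Reducing a vertex of degree three\<close>

text \<open>\<open>g\<close> is the gain as read from \<open>v\<close>, whichever orientation is
  stored.\<close>

definition joins :: "'a gain_edge \<Rightarrow> 'a \<Rightarrow> 'a \<Rightarrow> complex \<Rightarrow> bool" where
  "joins e v x g \<longleftrightarrow> e = (v, x, g) \<or> e = (x, v, inverse g)"

text \<open>Two edges with the same gain, or two edges at \<open>q0\<close>, have a potential and are too many.\<close>

lemma parallel_edges:
  assumes sparse: "sparse_edges q0 E" and e: "e \<in> E" "e' \<in> E" "e \<noteq> e'"
    and joins: "joins e v x g" "joins e' v x g'" and neq: "x \<noteq> v" "v \<noteq> q0"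
  shows "x \<noteq> q0" "g \<noteq> g'"
proof -
  have V: "verts_of {e, e'} = {v, x}" using joins by (auto simp: joins_def)
  have g3: "g ^ 3 = 1"
    using joins e sparse by (auto simp: joins_def sparse_edges_def valid_edge_def power_inverse)
  then have g0: "g \<noteq> 0" by auto
  \<comment> \<open>Two vertices and two edges leave excess 2, less than the 3 required of a
    balanced set.\<close>
  have no: "\<not> potential q0 \<theta> {e, e'}" for \<theta>
  proof
    assume "potential q0 \<theta> {e, e'}"
    then have "3 \<le> excess (verts_of {e, e'}) {e, e'}"
      using sparse e unfolding sparse_edges_def by (metis empty_subsetI insert_not_empty insert_subset)
    then show False using V e neq by (simp add: excess_def)
  qed
  show "x \<noteq> q0"
  proof
    assume "x = q0"
    then have "potential q0 (\<lambda>_. 1) {e, e'}"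
      using joins by (auto simp: joins_def potential_def)
    then show False using no by blast
  qed
  show "g \<noteq> g'"
  proof
    assume "g = g'"
    then have "potential q0 (\<lambda>y. if y = v then g else 1) {e, e'}"
      using joins g3 g0 neq by (auto simp: joins_def potential_def)
    then show False using no by blast
  qed
qed

text \<open>
  The vertex \<open>v\<close> is joined by the edges \<open>e 0\<close>, \<open>e 1\<close>, \<open>e 2\<close> to \<open>x 0\<close>, \<open>x 1\<close>, \<open>x 2\<close>. Adding the edge
  \<open>bridge i j\<close> to \<open>K\<close> amounts to fixing the distance between the lifts of \<open>x i\<close> and \<open>x j\<close> that
  are adjacent to the same lift of \<open>v\<close>.
\<close>

locale degree_three =
  fixes q0 :: 'a and E K :: "'a gain_edge set" and v :: 'a
    and e :: "nat \<Rightarrow> 'a gain_edge" and x :: "nat \<Rightarrow> 'a" and g :: "nat \<Rightarrow> complex"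
  assumes sparse: "sparse_edges q0 E" and v: "v \<noteq> q0" "v \<notin> verts_of K"
    and E_eq: "E = K \<union> {e 0, e 1, e 2}"
    and distinct: "e 0 \<noteq> e 1" "e 0 \<noteq> e 2" "e 1 \<noteq> e 2"
    and joins: "\<And>i. i < 3 \<Longrightarrow> joins (e i) v (x i) (g i)"
    and x_neq: "\<And>i. i < 3 \<Longrightarrow> x i \<noteq> v"
begin

definition bridge :: "nat \<Rightarrow> nat \<Rightarrow> 'a gain_edge" where
  "bridge i j = (x i, x j, inverse (g i) * g j)"

lemma K_subset: "K \<subseteq> E" using E_eq by auto

lemma e_distinct: "i < 3 \<Longrightarrow> j < 3 \<Longrightarrow> i \<noteq> j \<Longrightarrow> e i \<noteq> e j"
  using distinct by (auto simp: less_Suc_eq numeral_3_eq_3 numeral_2_eq_2)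

lemma e_in: "i < 3 \<Longrightarrow> e i \<in> E"
  using E_eq by (auto simp: less_Suc_eq numeral_3_eq_3 numeral_2_eq_2)

lemma e_ends: "i < 3 \<Longrightarrow> {fst (e i), fst (snd (e i))} = {v, x i}"
  using joins[of i] by (auto simp: joins_def)

lemma g_cube: "i < 3 \<Longrightarrow> g i ^ 3 = 1"
  using joins[of i] e_in[of i] sparse
  by (auto simp: joins_def sparse_edges_def valid_edge_def power_inverse)

lemma g_nonzero: "i < 3 \<Longrightarrow> g i \<noteq> 0"
  using g_cube[of i] by auto

lemma x_eq:
  assumes "i < 3" "j < 3" "i \<noteq> j" "x i = x j"
  shows "x i \<noteq> q0" "g i \<noteq> g j"
proof -
  have "joins (e j) v (x i) (g j)" using joins[of j] assms by simp
  note parallel_edges[OF sparse e_in e_in e_distinct joins this x_neq v(1), OF assms(1,2) assms(1-3) assms(1) assms(1)]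
  then show "x i \<noteq> q0" "g i \<noteq> g j" .
qed

text \<open>One new vertex and three new edges change the excess by \<open>2 - 3\<close>. So no set
  in \<open>K\<close> that meets its bound can contain all three neighbours; the next two lemmas
  state this for the two bounds.\<close>

lemma excess_add_vertex:
  assumes "F \<subseteq> K" "x 0 \<in> verts_of F" "x 1 \<in> verts_of F" "x 2 \<in> verts_of F"
  defines "F' \<equiv> F \<union> {e 0, e 1, e 2}"
  shows "F' \<subseteq> E" "F' \<noteq> {}" "verts_of F' = insert v (verts_of F)"
    "excess (verts_of F') F' = excess (verts_of F) F - 1"
proof -
  have "v \<notin> verts_of F" using v(2) verts_of_mono[OF assms(1)] by auto
  moreover from this have "e i \<notin> F" if "i < 3" for i
    using ends_subset_verts_of[of "e i" F] e_ends[OF that] by auto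
  then have "e 0 \<notin> F" "e 1 \<notin> F" "e 2 \<notin> F" by simp_all
  moreover have "finite F" using assms K_subset sparse_finite[OF sparse, of F] by blast
  moreover show V: "verts_of F' = insert v (verts_of F)"
    using e_ends[of 0] e_ends[of 1] e_ends[of 2] assms by auto
  ultimately show "excess (verts_of F') F' = excess (verts_of F) F - 1"
    using distinct unfolding V by (simp add: excess_def F'_def)
  show "F' \<subseteq> E" "F' \<noteq> {}" using assms E_eq by auto
qed

lemma tight_superset_false:
  assumes "F \<subseteq> K" "x 0 \<in> verts_of F" "x 1 \<in> verts_of F" "x 2 \<in> verts_of F"
    and "excess (verts_of F) F \<le> 1 + of_bool (q0 \<in> verts_of F)"
  shows False
proof -
  note * = excess_add_vertex[OF assms(1-4)]
  have "1 + of_bool (q0 \<in> insert v (verts_of F)) \<le> excess (verts_of F) F - 1"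
    using sparse *(1,2) unfolding sparse_edges_def *(3)[symmetric] *(4)[symmetric] by blast
  with assms(5) v show False by simp
qed

text \<open>The normalisation \<open>g i * \<theta> (x i) = 1\<close> means that the potential
  extends to \<open>v\<close> with value 1, so the enlarged set is balanced as well.\<close>

lemma balanced_superset_false:
  assumes "F \<subseteq> K" "x 0 \<in> verts_of F" "x 1 \<in> verts_of F" "x 2 \<in> verts_of F"
    and "excess (verts_of F) F \<le> 3" "potential q0 \<theta> F"
    and norm: "\<And>i. i < 3 \<Longrightarrow> x i \<noteq> q0 \<Longrightarrow> g i * \<theta> (x i) = 1"
  shows False
proof -
  note * = excess_add_vertex[OF assms(1-4)]
  have vF: "v \<notin> verts_of F" using v(2) verts_of_mono[OF assms(1)] by auto
  have "potential q0 (\<theta>(v := 1)) {e i}" if "i < 3" for i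
  proof -
    have "x i \<noteq> q0 \<Longrightarrow> \<theta> (x i) = inverse (g i)"
      using norm[OF that] g_nonzero[OF that] by (simp add: inverse_eq_divide eq_divide_eq mult.commute)
    then show ?thesis
      using joins[OF that] x_neq[OF that] assms(6) g_nonzero[OF that]
      by (auto simp: potential_def joins_def)
  qed
  from this[of 0] this[of 1] this[of 2]
  have "potential q0 (\<theta>(v := 1)) {e 0, e 1, e 2}" by (simp add: potential_def)
  moreover have "potential q0 (\<theta>(v := 1)) F"
    using assms(6) vF by (fastforce simp: potential_def verts_of_def)
  ultimately have "potential q0 (\<theta>(v := 1)) (F \<union> {e 0, e 1, e 2})"
    by (auto simp: potential_def)
  then have "3 \<le> excess (verts_of F) F - 1"
    using sparse *(1,2) unfolding sparse_edges_def *(4)[symmetric] by blast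
  with assms(5) show False by simp
qed

text \<open>The obstruction to \<open>bridge i j\<close> by the count for arbitrary sets: one more
  edge between \<open>x i\<close> and \<open>x j\<close> would violate it.\<close>

definition tight_block :: "nat \<Rightarrow> nat \<Rightarrow> 'a gain_edge set \<Rightarrow> bool" where
  "tight_block i j F \<longleftrightarrow> F \<subseteq> K \<and> x i \<in> verts_of F \<and> x j \<in> verts_of F \<and>
     excess (verts_of F) F = 1 + of_bool (q0 \<in> verts_of F)"

text \<open>The obstruction by the count for balanced sets. The potential is scaled so that it would
  take the value 1 at \<open>v\<close>, which also makes it compatible with the bridge; at
  \<open>q0\<close> nothing is required since gains there are ignored.\<close>

definition balanced_block :: "nat \<Rightarrow> nat \<Rightarrow> 'a gain_edge set \<Rightarrow> ('a \<Rightarrow> complex) \<Rightarrow> bool" where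
  "balanced_block i j F \<theta> \<longleftrightarrow> F \<subseteq> K \<and> x i \<in> verts_of F \<and> x j \<in> verts_of F \<and>
     excess (verts_of F) F = 3 \<and> potential q0 \<theta> F \<and>
     (\<forall>k\<in>{i, j}. x k \<noteq> q0 \<longrightarrow> g k * \<theta> (x k) = 1)"

lemma bridge_valid: "i < 3 \<Longrightarrow> j < 3 \<Longrightarrow> i \<noteq> j \<Longrightarrow> valid_edge q0 (bridge i j)"
  using x_eq[of i j] g_cube[of i] g_cube[of j] g_nonzero[of i]
  by (auto simp: bridge_def valid_edge_def power_mult_distrib power_inverse field_simps)

text \<open>The equation of the bridge is
  \<open>g i * \<theta> (x i) = g j * \<theta> (x j)\<close>, so one scalar factor normalises both
  ends.\<close>

lemma normalize:
  assumes "i < 3" "j < 3" "i \<noteq> j" "potential q0 \<theta> (insert (bridge i j) F)"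
  shows "\<exists>\<theta>'. potential q0 \<theta>' F \<and> (\<forall>k\<in>{i, j}. x k \<noteq> q0 \<longrightarrow> g k * \<theta>' (x k) = 1)"
proof -
  have p: "potential q0 \<theta> F" using assms(4) by (auto intro: potential_subset)
  have nz: "\<theta> y \<noteq> 0" "\<theta> y ^ 3 = 1" for y
    using potential_nonzero[OF p] p by (auto simp: potential_def)
  have eq: "g i * \<theta> (x i) = g j * \<theta> (x j)" if "x i \<noteq> q0" "x j \<noteq> q0"
    using assms(4) that g_nonzero[OF assms(1)] by (auto simp: potential_def bridge_def field_simps)
  \<comment> \<open>If \<open>x i\<close> is \<open>q0\<close>, only the value at \<open>x j\<close>
    has to be normalised.\<close>
  define k where "k = (if x i = q0 then j else i)"
  have k: "k < 3" using assms by (simp add: k_def)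
  define c where "c = inverse (g k * \<theta> (x k))"
  have c3: "c ^ 3 = 1" using nz g_cube[OF k] by (simp add: c_def power_inverse power_mult_distrib)
  have "g l * (c * \<theta> (x l)) = 1" if l: "l \<in> {i, j}" "x l \<noteq> q0" for l
  proof -
    have "g l * \<theta> (x l) = g k * \<theta> (x k)" using l eq by (auto simp: k_def)
    then have "g l * (c * \<theta> (x l)) = c * (g k * \<theta> (x k))" by (simp add: algebra_simps)
    also have "\<dots> = 1" using nz g_nonzero[OF k] unfolding c_def by (intro left_inverse) simp
    finally show ?thesis .
  qed
  with potential_scale[OF p c3] show ?thesis by blast
qed

text \<open>A violating set must contain the bridge; without it the excess grows by one and exactly
  meets the bound. If the bridge is already an edge of \<open>K\<close>, it is a block by itself:
  tight if it is a loop, balanced otherwise.\<close>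

lemma block_exists:
  assumes ij: "i < 3" "j < 3" "i \<noteq> j"
    and bad: "bridge i j \<in> K \<or> \<not> sparse_edges q0 (insert (bridge i j) K)"
  shows "(\<exists>F. tight_block i j F) \<or> (\<exists>F \<theta>. balanced_block i j F \<theta>)"
proof (cases "bridge i j \<in> K")
  case True
  define F where "F = {bridge i j}"
  have F: "F \<subseteq> K" "verts_of F = {x i, x j}" using True by (auto simp: F_def bridge_def)
  show ?thesis
  proof (cases "x i = x j")
    case eq: True
    then have "tight_block i j F"
      using F x_eq(1)[OF ij] by (auto simp: tight_block_def excess_def F_def)
    then show ?thesis by blast
  next
    case False
    obtain \<theta> where "potential q0 \<theta> (insert (bridge i j) F)"
    proof
      show "potential q0 (\<lambda>y. if y = x i then inverse (g i) * g j else 1) (insert (bridge i j) F)"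
        using False g_cube[OF ij(1)] g_cube[OF ij(2)]
        by (auto simp: potential_def F_def bridge_def power_mult_distrib power_inverse)
    qed
    from normalize[OF ij this] obtain \<theta>' where "potential q0 \<theta>' F"
      "\<forall>k\<in>{i, j}. x k \<noteq> q0 \<longrightarrow> g k * \<theta>' (x k) = 1" by blast
    then have "balanced_block i j F \<theta>'"
      using F False by (auto simp: balanced_block_def excess_def F_def)
    then show ?thesis by blast
  qed
next
  case False
  then have "\<not> sparse_edges q0 (insert (bridge i j) K)" using bad by blast
  moreover have spK: "sparse_edges q0 K" using sparse_edges_subset[OF sparse K_subset] .
  ultimately obtain F where F: "F \<subseteq> insert (bridge i j) K" "F \<noteq> {}"
    and viol: "(\<exists>\<theta>. potential q0 \<theta> F) \<and> excess (verts_of F) F < 3 \<or>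
      excess (verts_of F) F < 1 + of_bool (q0 \<in> verts_of F)"
    using bridge_valid[OF ij] unfolding sparse_edges_def
    by (metis (no_types, lifting) finite_insert insert_iff not_less)
  have "bridge i j \<in> F"
  proof (rule ccontr)
    assume "bridge i j \<notin> F"
    then have "F \<subseteq> K" using F by auto
    then show False using spK F(2) viol unfolding sparse_edges_def by (meson not_less)
  qed
  define F' where "F' = F - {bridge i j}"
  have F': "F = insert (bridge i j) F'" "bridge i j \<notin> F'" "F' \<subseteq> K"
    using \<open>bridge i j \<in> F\<close> F by (auto simp: F'_def)
  have F'E: "F' \<subseteq> E" using F' K_subset by auto
  then have fin: "finite F'" by (rule sparse_finite[OF sparse])
  have V: "verts_of F = {x i, x j} \<union> verts_of F'" unfolding F'(1) by (simp add: bridge_def)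
  have exc: "excess (verts_of F) F = excess (verts_of F) F' - 1"
    using F'(2) fin by (simp add: excess_def F'(1))
  have finV: "finite (verts_of F)" "verts_of F' \<subseteq> verts_of F" "verts_of F \<noteq> {}"
    using V fin by auto
  from viol show ?thesis
  proof
    assume *: "excess (verts_of F) F < 1 + of_bool (q0 \<in> verts_of F)"
    have ge: "1 + of_bool (q0 \<in> verts_of F) \<le> excess (verts_of F) F'"
      by (rule sparse_excess[OF sparse F'E finV])
    \<comment> \<open>An end of the bridge on no other edge of the violating set would account for 2
      in the excess and prevent the violation. This puts both ends into the block.\<close>
    have "verts_of F' = verts_of F"
    proof (rule ccontr)
      assume neq: "\<not> ?thesis"
      then obtain y where y: "y \<in> verts_of F" "y \<notin> verts_of F'" using finV by blast
      show False
      proof (cases "F' = {}")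
        case True
        then have "excess (verts_of F) F = 2 * int (card (verts_of F)) - 1" using exc by (simp add: excess_def)
        moreover have "card (verts_of F) \<ge> 1" using finV by (simp add: Suc_leI card_gt_0_iff)
        moreover have "card (verts_of F) \<ge> 2" if "q0 \<in> verts_of F"
        proof -
          have "x i \<noteq> x j" using that x_eq(1)[OF ij] V True by auto
          then show ?thesis using V True by simp
        qed
        ultimately show False using * by (cases "q0 \<in> verts_of F") auto
      next
        case False
        have "1 + of_bool (q0 \<in> verts_of F') \<le> excess (verts_of F') F'"
          using sparse F'E False unfolding sparse_edges_def by blast
        moreover have "card (verts_of F - verts_of F') \<ge> 1"
          using y finV by (metis DiffI One_nat_def Suc_leI card_gt_0_iff empty_iff finite_Diff)
        ultimately show False using * exc excess_superset[OF finV(1,2)]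
          by (cases "q0 \<in> verts_of F"; cases "q0 \<in> verts_of F'") auto
      qed
    qed
    then have "tight_block i j F'" using F' V * exc ge by (auto simp: tight_block_def)
    then show ?thesis by blast
  next
    assume *: "(\<exists>\<theta>. potential q0 \<theta> F) \<and> excess (verts_of F) F < 3"
    then obtain \<theta> where "potential q0 \<theta> (insert (bridge i j) F')" using F' by auto
    from normalize[OF ij this] obtain \<theta>' where \<theta>': "potential q0 \<theta>' F'"
      "\<forall>k\<in>{i, j}. x k \<noteq> q0 \<longrightarrow> g k * \<theta>' (x k) = 1" by blast
    \<comment> \<open>At a common neighbour the two gains differ, so one value cannot be normalised
      for both.\<close>
    have neq: "x i \<noteq> x j"
    proof
      assume "x i = x j"
      moreover from this have "g i \<noteq> g j" "x i \<noteq> q0" using x_eq[OF ij] by auto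
      ultimately show False using \<theta>' by (metis insertI1 insertI2 mult_cancel_right mult_zero_right zero_neq_one)
    qed
    have le: "excess (verts_of F) F' \<le> 3" using * exc by simp
    then have "F' \<noteq> {}"
      using balanced_excess_ge3(2)[OF sparse F'E \<theta>'(1) finV(1,2) _ _ neq] V by auto
    then have "3 \<le> excess (verts_of F) F'" "verts_of F = verts_of F'"
      using balanced_excess_nonempty[OF sparse F'E \<theta>'(1) finV(1,2)] le by auto
    then have "balanced_block i j F' \<theta>'"
      using le V F' \<theta>' by (auto simp: balanced_block_def)
    then show ?thesis by blast
  qed
qed

end

section \<open>Combining the blocks that obstruct the three bridges\<close>

context degree_three
begin

lemma Int_singletonD: "A \<inter> B = {c} \<Longrightarrow> y \<in> A \<Longrightarrow> y \<in> B \<Longrightarrow> y = c"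
  by auto

lemma balanced_block_sym: "balanced_block i j F \<theta> \<Longrightarrow> balanced_block j i F \<theta>"
  by (auto simp: balanced_block_def)

lemma triple_all:
  assumes "{i, j, k} = {0, 1, 2::nat}" "P i" "P j" "P k"
  shows "P 0" "P 1" "P 2"
proof -
  have "\<forall>n\<in>{0, 1, 2}. P n" unfolding assms(1)[symmetric] using assms(2-4) by simp
  then show "P 0" "P 1" "P 2" by simp_all
qed

lemma tight_false:
  assumes "{i, j, k} = {0, 1, 2}" "F \<subseteq> K" "x i \<in> verts_of F" "x j \<in> verts_of F" "x k \<in> verts_of F"
    "excess (verts_of F) F \<le> 1 + of_bool (q0 \<in> verts_of F)"
  shows False
  by (rule tight_superset_false[OF assms(2) triple_all[OF assms(1,3,4,5)] assms(6)])

lemma balanced_false: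
  assumes "{i, j, k} = {0, 1, 2}" "F \<subseteq> K" "x i \<in> verts_of F" "x j \<in> verts_of F" "x k \<in> verts_of F"
    "excess (verts_of F) F \<le> 3" "potential q0 \<theta> F"
    "\<And>l. l \<in> {i, j, k} \<Longrightarrow> x l \<noteq> q0 \<Longrightarrow> g l * \<theta> (x l) = 1"
  shows False
proof -
  have "l \<in> {i, j, k}" if "l < 3" for l using that assms(1) by auto
  then show False
    by (intro balanced_superset_false[OF assms(2) triple_all[OF assms(1,3,4,5)] assms(6,7)] assms(8))
qed

lemma K_fin: "F \<subseteq> K \<Longrightarrow> finite F"
  using sparse_finite[OF sparse] K_subset by blast

lemma K_excess_union:
  "F \<subseteq> K \<Longrightarrow> F' \<subseteq> K \<Longrightarrow> excess (verts_of (F \<union> F')) (F \<union> F') =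
    excess (verts_of F) F + excess (verts_of F') F' - excess (verts_of F \<inter> verts_of F') (F \<inter> F')"
  by (intro excess_union K_fin)

lemma verts_of_Int: "verts_of (F \<inter> F') \<subseteq> verts_of F \<inter> verts_of F'"
  by (auto simp: verts_of_def)

lemma x_neq_of_balanced:
  assumes "balanced_block i j F \<theta>" "i < 3" "j < 3" "i \<noteq> j"
  shows "x i \<noteq> x j"
proof
  assume eq: "x i = x j"
  then have *: "x i \<noteq> q0" "g i \<noteq> g j" using x_eq assms by auto
  then have "g i * \<theta> (x i) = 1" "g j * \<theta> (x i) = 1" using assms(1) eq by (auto simp: balanced_block_def)
  then show False using *(2) by (metis mult_cancel_right mult_zero_right zero_neq_one)
qed

text \<open>If the potentials agreed on all common vertices except \<open>q0\<close>, they would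
  glue to a potential of the union, a set of excess at most \<open>3 + 3 - 3\<close> that contains
  all three normalised neighbours. So they differ at some \<open>z\<close>, while they agree at
  \<open>x i\<close>; their quotient is not constant and \<open>excess_two_potentials\<close>
  applies.\<close>

lemma balanced_pair:
  assumes perm: "{i, j, k} = {0, 1, 2}" "i < 3" "j < 3" "k < 3"
    and F: "balanced_block i j F \<theta>" and F': "balanced_block i k F' \<theta>'"
    and xi: "x i \<noteq> q0" and y: "y \<in> verts_of F" "y \<in> verts_of F'" "y \<noteq> x i"
  shows "\<exists>z \<in> verts_of F \<inter> verts_of F'. z \<noteq> q0 \<and> \<theta> z \<noteq> \<theta>' z"
    "4 \<le> excess (verts_of F \<inter> verts_of F') (F \<inter> F')"
    "q0 \<notin> verts_of F \<inter> verts_of F' \<Longrightarrow> excess (verts_of F \<inter> verts_of F') (F \<inter> F') \<le> 4 \<Longrightarrow> F \<inter> F' = {}"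
proof -
  let ?U = "verts_of F \<inter> verts_of F'" and ?I = "F \<inter> F'"
  have K: "F \<subseteq> K" "F' \<subseteq> K" "F \<union> F' \<subseteq> K" "?I \<subseteq> E"
    using F F' K_subset by (auto simp: balanced_block_def)
  have pot: "potential q0 \<theta> F" "potential q0 \<theta>' F'" using F F' by (auto simp: balanced_block_def)
  have potI: "potential q0 \<theta> ?I" "potential q0 \<theta>' ?I" using pot by (auto intro: potential_subset)
  have fin: "finite ?U" using K_fin[OF K(1)] by simp
  have in_U: "x i \<in> ?U" "y \<in> ?U" using F F' y by (auto simp: balanced_block_def)
  have "g i * \<theta> (x i) = 1" "g i * \<theta>' (x i) = 1"
    using F F' xi by (auto simp: balanced_block_def)
  then have norm: "\<theta> (x i) = \<theta>' (x i)" "\<theta> (x i) \<noteq> 0"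
    using g_nonzero[OF perm(2)] by (metis mult_cancel_left, auto)
  show ex: "\<exists>z \<in> ?U. z \<noteq> q0 \<and> \<theta> z \<noteq> \<theta>' z"
  proof (rule ccontr)
    assume "\<not> ?thesis"
    then have agree: "\<And>z. z \<in> ?U \<Longrightarrow> z \<noteq> q0 \<Longrightarrow> \<theta> z = \<theta>' z" by blast
    define \<theta>'' where "\<theta>'' = (\<lambda>z. if z \<in> verts_of F then \<theta> z else \<theta>' z)"
    have "potential q0 \<theta>'' (F \<union> F')"
      unfolding \<theta>''_def by (rule potential_merge[OF pot]) (use agree in auto)
    moreover have "excess (verts_of (F \<union> F')) (F \<union> F') \<le> 3"
      using K_excess_union[OF K(1,2)] F F'
        balanced_excess_ge3(1)[OF sparse K(4) potI(1) fin verts_of_Int in_U(2,1) y(3)]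
      by (simp add: balanced_block_def)
    moreover have "g l * \<theta>'' (x l) = 1" if "l \<in> {i, j, k}" "x l \<noteq> q0" for l
    proof (cases "x l \<in> verts_of F")
      case True
      show ?thesis
      proof (cases "l = k")
        case lk: True
        then have "\<theta> (x l) = \<theta>' (x l)" using True F' that by (intro agree) (auto simp: balanced_block_def)
        then show ?thesis using True F' that lk by (auto simp: balanced_block_def \<theta>''_def)
      next
        case False
        then show ?thesis using True F that by (auto simp: balanced_block_def \<theta>''_def)
      qed
    next
      case False
      then have "l = k" using F that by (auto simp: balanced_block_def)
      then show ?thesis using False F' that by (auto simp: balanced_block_def \<theta>''_def)
    qed
    ultimately show False
      using balanced_false[OF perm(1) K(3), of \<theta>''] F F' by (auto simp: balanced_block_def)
  qed
  then obtain z where z: "z \<in> ?U" "z \<noteq> q0" "\<theta> z \<noteq> \<theta>' z" by blast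
  then have ratio: "\<theta> (x i) / \<theta>' (x i) \<noteq> \<theta> z / \<theta>' z"
    using norm potential_nonzero[OF pot(2), of z] by (auto simp: field_simps)
  note two = excess_two_potentials[OF sparse K(4) potI fin verts_of_Int in_U(1) z(1) xi z(2) ratio]
  show "4 \<le> excess ?U ?I" by (rule two(1))
  show "q0 \<notin> ?U \<Longrightarrow> excess ?U ?I \<le> 4 \<Longrightarrow> ?I = {}" by (rule two(2))
qed

text \<open>The other two blocks cannot be tight, since the union of two tight sets that meet is
  tight. They are balanced and meet \<open>F\<close> in a single vertex, because an overlap of
  excess 3 would leave the union tight. Then the union of all three blocks is tight again; the cases
  differ in how the balanced blocks overlap.\<close>

lemma no_tight_block:
  assumes perm: "{i, j, k} = {0, 1, 2}" "i < 3" "j < 3" "k < 3" "i \<noteq> j" "i \<noteq> k" "j \<noteq> k"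
    and F: "tight_block i j F"
    and F': "tight_block i k F' \<or> balanced_block i k F' \<theta>'"
    and G: "tight_block j k G \<or> balanced_block j k G \<theta>"
  shows False
proof -
  have FK: "F \<subseteq> K" and xF: "x i \<in> verts_of F" "x j \<in> verts_of F"
    and dF: "excess (verts_of F) F = 1 + of_bool (q0 \<in> verts_of F)"
    using F by (auto simp: tight_block_def)
  have perm': "{j, i, k} = {0, 1, 2}" using perm by auto
  have two_tight: False
    if "tight_block a k H" "{a, b, k} = {0, 1, 2}" "x a \<in> verts_of F" "x b \<in> verts_of F" for a b H
  proof -
    have H: "H \<subseteq> K" "F \<union> H \<subseteq> K" "F \<inter> H \<subseteq> E" "x a \<in> verts_of H" "x k \<in> verts_of H"
      "excess (verts_of H) H = 1 + of_bool (q0 \<in> verts_of H)"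
      using that FK K_subset by (auto simp: tight_block_def)
    have "1 + of_bool (q0 \<in> verts_of F \<inter> verts_of H) \<le> excess (verts_of F \<inter> verts_of H) (F \<inter> H)"
      by (rule sparse_excess[OF sparse H(3) _ verts_of_Int]) (use H that K_fin[OF FK] in auto)
    then have "excess (verts_of (F \<union> H)) (F \<union> H) \<le> 1 + of_bool (q0 \<in> verts_of (F \<union> H))"
      unfolding K_excess_union[OF FK H(1)] H dF by (auto split: if_splits simp: of_bool_def)
    then show False using tight_false[OF that(2) H(2)] H that by auto
  qed
  have F': "balanced_block i k F' \<theta>'" using F' two_tight[OF _ perm(1) xF] by blast
  have G: "balanced_block j k G \<theta>" using G two_tight[OF _ perm' xF(2,1)] by blast
  have K: "F' \<subseteq> K" "G \<subseteq> K" "F \<union> F' \<subseteq> K" "F' \<union> G \<subseteq> K" "F \<inter> F' \<subseteq> E" "F \<inter> G \<subseteq> E" "F' \<inter> G \<subseteq> E"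
    using F' G FK K_subset by (auto simp: balanced_block_def)
  have pot: "potential q0 \<theta>' F'" "potential q0 \<theta> G" using F' G by (auto simp: balanced_block_def)
  have xF': "x i \<in> verts_of F'" "x k \<in> verts_of F'" and dF': "excess (verts_of F') F' = 3"
    using F' by (auto simp: balanced_block_def)
  have xG: "x j \<in> verts_of G" "x k \<in> verts_of G" and dG: "excess (verts_of G) G = 3"
    using G by (auto simp: balanced_block_def)
  have fin: "finite (verts_of F)" "finite (verts_of F')" "finite (verts_of G)"
    using K_fin K FK by auto
  have single: "verts_of F \<inter> verts_of H = {x a}" "F \<inter> H = {}"
    if H: "balanced_block a k H \<eta>" and ab: "{a, b, k} = {0, 1, 2}" "x a \<in> verts_of F" "x b \<in> verts_of F"
    for a b H \<eta>
  proof -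
    have HK: "H \<subseteq> K" "F \<union> H \<subseteq> K" "F \<inter> H \<subseteq> E" and pI: "potential q0 \<eta> (F \<inter> H)"
      and xH: "x a \<in> verts_of H" "x k \<in> verts_of H"
      using H FK K_subset by (auto simp: balanced_block_def intro: potential_subset)
    show *: "verts_of F \<inter> verts_of H = {x a}"
    proof (rule ccontr)
      assume "\<not> ?thesis"
      then obtain y where y: "y \<in> verts_of F \<inter> verts_of H" "y \<noteq> x a" using ab xH by auto
      have "3 \<le> excess (verts_of F \<inter> verts_of H) (F \<inter> H)"
        by (rule balanced_excess_ge3(1)[OF sparse HK(3) pI _ verts_of_Int y(1) _ y(2)]) (use fin ab xH in auto)
      then have "excess (verts_of (F \<union> H)) (F \<union> H) \<le> 1 + of_bool (q0 \<in> verts_of (F \<union> H))"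
        using H unfolding K_excess_union[OF FK HK(1)] dF by (auto simp: balanced_block_def)
      then show False using tight_false[OF ab(1) HK(2)] xH ab by auto
    qed
    show "F \<inter> H = {}"
      using balanced_single_vertex[OF sparse HK(3) pI, of "x a"] verts_of_Int[of F H] * by auto
  qed
  note sF' = single[OF F' perm(1) xF] and sG = single[OF G perm' xF(2,1)]
  have xk: "x k \<notin> verts_of F" using tight_false[OF perm(1) FK xF] dF by auto
  have all: "F \<union> F' \<union> G \<subseteq> K" "x i \<in> verts_of (F \<union> F' \<union> G)" "x j \<in> verts_of (F \<union> F' \<union> G)"
    "x k \<in> verts_of (F \<union> F' \<union> G)"
    using K xF xF' by auto
  note fin_all = tight_false[OF perm(1) all]
  show False
  proof (cases "x i = x j")
    case False
    \<comment> \<open>A single common vertex has excess 2, whence \<open>1 + 3 - 2\<close>, plus 1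
      if \<open>q0\<close> lies in \<open>F\<close>.\<close>
    have dFF': "excess (verts_of (F \<union> F')) (F \<union> F') = 2 + of_bool (q0 \<in> verts_of F)"
      unfolding K_excess_union[OF FK K(1)] sF' dF dF' by (simp add: excess_def)
    have xj: "x j \<notin> verts_of F'"
      using Int_singletonD[OF sF'(1) xF(2)] False by metis
    let ?U = "verts_of (F \<union> F') \<inter> verts_of G" and ?I = "(F \<union> F') \<inter> G"
    have I: "?I = F' \<inter> G" "?I \<subseteq> E" "potential q0 \<theta> ?I"
      using sG K K_subset pot by (auto intro: potential_subset)
    have U: "finite ?U" "x j \<in> ?U" "x k \<in> ?U" "x j \<noteq> x k" using fin xF xF' xG xk by auto
    \<comment> \<open>\<open>x j\<close> lies on no edge of \<open>F' \<inter> G\<close>, so a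
      nonempty intersection even has excess 5.\<close>
    have "4 \<le> excess ?U ?I"
    proof (cases "?I = {}")
      case True
      show ?thesis by (rule balanced_excess_ge3(2)[OF sparse I(2,3) U(1) verts_of_Int U(2-4) True])
    next
      case False
      have "verts_of ?I \<subseteq> verts_of F'" unfolding I(1) by (rule verts_of_mono) auto
      then have "?U \<noteq> verts_of ?I" using U(2) xj by auto
      with balanced_excess_nonempty(2)[OF sparse I(2,3) U(1) verts_of_Int False] show ?thesis by simp
    qed
    then have "excess (verts_of (F \<union> F' \<union> G)) (F \<union> F' \<union> G) \<le> 1 + of_bool (q0 \<in> verts_of F)"
      unfolding K_excess_union[OF K(3) K(2)] dFF' dG by simp
    then show False by (intro fin_all) auto
  next
    case True
    have u: "x i \<noteq> q0" "g i \<noteq> g j" using x_eq[OF perm(2,3,5) True] by auto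
    let ?U = "verts_of F' \<inter> verts_of G" and ?I = "F' \<inter> G"
    have pI: "potential q0 \<theta>' ?I" "potential q0 \<theta> ?I" using pot by (auto intro: potential_subset)
    have U: "finite ?U" "x i \<in> ?U" "x k \<in> ?U" "x i \<noteq> x k" using fin xF xF' xG xk True by auto
    have VU: "verts_of F \<inter> verts_of (F' \<union> G) = {x i}" "F \<inter> (F' \<union> G) = {}" using sF' sG True by auto
    have "excess (verts_of (F \<union> (F' \<union> G))) (F \<union> (F' \<union> G)) =
        1 + of_bool (q0 \<in> verts_of F) + (6 - excess ?U ?I) - 2"
      unfolding K_excess_union[OF FK K(4)] VU dF
      unfolding K_excess_union[OF K(1,2)] dF' dG by (simp add: excess_def)
    then have dall: "excess (verts_of (F \<union> F' \<union> G)) (F \<union> F' \<union> G) =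
        5 + of_bool (q0 \<in> verts_of F) - excess ?U ?I" by (simp add: Un_assoc)
    have ge3: "3 \<le> excess ?U ?I"
      by (rule balanced_excess_ge3(1)[OF sparse K(7) pI(1) U(1) verts_of_Int U(2-4)])
    show False
    \<comment> \<open>If \<open>x k\<close> is \<open>q0\<close>, then \<open>q0\<close> is not in
      \<open>F\<close> but in the union, whose bound is 2; overlap excess 3 suffices. Otherwise the
      two potentials agree at \<open>x k\<close> but not at \<open>x i = x j\<close>, where they are
      normalised by different gains, so the overlap has excess 4.\<close>
    proof (cases "x k = q0")
      case xkq: True
      have "excess (verts_of (F \<union> F' \<union> G)) (F \<union> F' \<union> G) \<le> 1 + of_bool (q0 \<in> verts_of (F \<union> F' \<union> G))"
        using xk xF' xkq unfolding dall using ge3 by auto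
      then show False by (rule fin_all)
    next
      case xkq: False
      have n: "g i * \<theta>' (x i) = 1" "g j * \<theta> (x i) = 1" "g k * \<theta>' (x k) = 1" "g k * \<theta> (x k) = 1"
        using F' G u xkq True by (auto simp: balanced_block_def)
      have "\<theta>' (x k) = \<theta> (x k)" using n g_nonzero[OF perm(4)] by (metis mult_cancel_left)
      moreover have "\<theta>' (x i) \<noteq> \<theta> (x i)" using n u by (metis mult_cancel_right mult_zero_right zero_neq_one)
      ultimately have "\<theta>' (x i) / \<theta> (x i) \<noteq> \<theta>' (x k) / \<theta> (x k)"
        using potential_nonzero[OF pot(1)] potential_nonzero[OF pot(2)] by (simp add: field_simps)
      from excess_two_potentials(1)[OF sparse K(7) pI U(1) verts_of_Int U(2,3) u(1) xkq this]
      have "excess (verts_of (F \<union> F' \<union> G)) (F \<union> F' \<union> G) \<le> 1 + of_bool (q0 \<in> verts_of F)"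
        unfolding dall by simp
      then show False by (intro fin_all) auto
    qed
  qed
qed

end

context degree_three
begin

text \<open>
  Three balanced blocks that pairwise share one vertex form a balanced set with excess 3.
\<close>

lemma single_overlaps_false:
  assumes perm: "{i, j, k} = {0, 1, 2}" "i < 3" "j < 3" "k < 3" "i \<noteq> j" "i \<noteq> k" "j \<noteq> k"
    and F: "balanced_block i j F \<theta>" and F': "balanced_block i k F' \<theta>'" and G: "balanced_block j k G \<eta>"
    and V: "verts_of F \<inter> verts_of F' = {x i}" "verts_of F \<inter> verts_of G = {x j}" "verts_of F' \<inter> verts_of G = {x k}"
  shows False
proof -
  have K: "F \<subseteq> K" "F' \<subseteq> K" "G \<subseteq> K" "F \<union> F' \<subseteq> K" "F \<union> F' \<union> G \<subseteq> K"
    using F F' G by (auto simp: balanced_block_def)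
  have pot: "potential q0 \<theta> F" "potential q0 \<theta>' F'" "potential q0 \<eta> G"
    using F F' G by (auto simp: balanced_block_def)
  have empty: "H \<inter> H' = {}" if "verts_of H \<inter> verts_of H' = {y}" "H \<subseteq> K" "potential q0 \<xi> H" for H H' y \<xi>
  proof (rule balanced_single_vertex[OF sparse])
    show "H \<inter> H' \<subseteq> E" using that K_subset by auto
    show "potential q0 \<xi> (H \<inter> H')" by (rule potential_subset[OF that(3)]) auto
    show "verts_of (H \<inter> H') \<subseteq> {y}" using verts_of_Int[of H H'] that(1) by simp
  qed
  have neq: "x j \<noteq> x k" using x_neq_of_balanced[OF G] perm by auto
  have VU: "verts_of (F \<union> F') \<inter> verts_of G = {x j, x k}" using V by auto
  have EU: "(F \<union> F') \<inter> G = {}" using empty[OF V(2) K(1) pot(1)] empty[OF V(3) K(2) pot(2)] by auto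
  \<comment> \<open>The first union has excess \<open>3 + 3 - 2\<close>; the second overlap consists
    of \<open>x j\<close> and \<open>x k\<close> without edges, whence
    \<open>4 + 3 - 4\<close>.\<close>
  have exc: "excess (verts_of (F \<union> F' \<union> G)) (F \<union> F' \<union> G) = 3"
    unfolding K_excess_union[OF K(4,3)] VU EU K_excess_union[OF K(1,2)] V(1) empty[OF V(1) K(1) pot(1)]
    using F F' G neq by (simp add: balanced_block_def excess_def)
  define \<theta>1 where "\<theta>1 = (\<lambda>y. if y \<in> verts_of F then \<theta> y else \<theta>' y)"
  define \<theta>2 where "\<theta>2 = (\<lambda>y. if y \<in> verts_of (F \<union> F') then \<theta>1 y else \<eta> y)"
  have inv: "b = inverse a" if "a * b = 1" for a b :: complex
    using inverse_unique[OF that] by simp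
  have nF: "x i \<noteq> q0 \<Longrightarrow> g i * \<theta> (x i) = 1" "x j \<noteq> q0 \<Longrightarrow> g j * \<theta> (x j) = 1"
    using F by (simp_all add: balanced_block_def)
  have nF': "x i \<noteq> q0 \<Longrightarrow> g i * \<theta>' (x i) = 1" "x k \<noteq> q0 \<Longrightarrow> g k * \<theta>' (x k) = 1"
    using F' by (simp_all add: balanced_block_def)
  have nG: "x j \<noteq> q0 \<Longrightarrow> g j * \<eta> (x j) = 1" "x k \<noteq> q0 \<Longrightarrow> g k * \<eta> (x k) = 1"
    using G by (simp_all add: balanced_block_def)
  note norm = nF[THEN inv] nF'[THEN inv] nG[THEN inv]
  have xs: "x i \<in> verts_of F" "x j \<in> verts_of F" "x k \<in> verts_of F'" "x k \<notin> verts_of F"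
  proof -
    show "x i \<in> verts_of F" "x j \<in> verts_of F" "x k \<in> verts_of F'"
      using F F' by (auto simp: balanced_block_def)
    have "x k \<in> verts_of G" using G by (auto simp: balanced_block_def)
    then show "x k \<notin> verts_of F" using Int_singletonD[OF V(2)] neq by metis
  qed
  have p1: "potential q0 \<theta>1 (F \<union> F')"
    unfolding \<theta>1_def
  proof (rule potential_merge[OF pot(1,2)])
    fix y assume "y \<in> verts_of F" "y \<in> verts_of F'" "y \<noteq> q0"
    then have "y = x i" "x i \<noteq> q0" using V(1) by blast+
    then show "\<theta> y = \<theta>' y" using norm by simp
  qed
  have p2: "potential q0 \<theta>2 (F \<union> F' \<union> G)"
    unfolding \<theta>2_def
  proof (rule potential_merge[OF p1 pot(3)])
    fix y assume "y \<in> verts_of (F \<union> F')" "y \<in> verts_of G" "y \<noteq> q0"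
    then have "y = x j \<or> y = x k" "y \<noteq> q0" using VU by blast+
    then show "\<theta>1 y = \<eta> y" using xs norm by (auto simp: \<theta>1_def)
  qed
  have "g l * \<theta>2 (x l) = 1" if "l \<in> {i, j, k}" "x l \<noteq> q0" for l
  proof -
    have "\<theta>2 (x l) = inverse (g l)" using that xs norm by (auto simp: \<theta>1_def \<theta>2_def)
    then show ?thesis using g_nonzero[of l] that perm(2-4) by auto
  qed
  then show False
    using balanced_false[OF perm(1) K(5) _ _ _ _ p2] exc xs by auto
qed

text \<open>By \<open>balanced_pair\<close> the union of \<open>F\<close> and \<open>F'\<close> has
  excess at most 2. Since no tight set contains all three neighbours, \<open>q0\<close> lies in none
  of the blocks, and the overlap of this union with \<open>G\<close> has excess exactly 3; so it has
  edges, and they cover all its vertices. If these edges all lay in one of \<open>F\<close> and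
  \<open>F'\<close>, that block would contain all neighbours and be normalised at each. Hence
  \<open>F\<close> and \<open>G\<close> share an edge, and \<open>balanced_pair\<close> at
  \<open>x j\<close> makes \<open>F \<union> G\<close> tight.\<close>

lemma no_balanced_blocks_overlap:
  assumes perm: "{i, j, k} = {0, 1, 2}" "i < 3" "j < 3" "k < 3" "i \<noteq> j" "i \<noteq> k" "j \<noteq> k"
    and F: "balanced_block i j F \<theta>" and F': "balanced_block i k F' \<theta>'" and G: "balanced_block j k G \<eta>"
    and xi: "x i \<noteq> q0" and y: "y \<in> verts_of F" "y \<in> verts_of F'" "y \<noteq> x i"
  shows False
proof -
  have perms: "{j, i, k} = {0, 1, 2}" "{k, i, j} = {0, 1, 2}" "{k, j, i} = {0, 1, 2}" "{i, k, j} = {0, 1, 2}"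
    unfolding perm(1)[symmetric] by auto
  have K: "F \<subseteq> K" "F' \<subseteq> K" "G \<subseteq> K" "F \<union> F' \<subseteq> K" "F \<union> G \<subseteq> K" "F' \<union> G \<subseteq> K" "F \<union> F' \<union> G \<subseteq> K"
    using F F' G by (auto simp: balanced_block_def)
  have pot: "potential q0 \<theta> F" "potential q0 \<theta>' F'" "potential q0 \<eta> G"
    and xs: "x i \<in> verts_of F" "x j \<in> verts_of F" "x i \<in> verts_of F'" "x k \<in> verts_of F'"
      "x j \<in> verts_of G" "x k \<in> verts_of G"
    and ds: "excess (verts_of F) F = 3" "excess (verts_of F') F' = 3" "excess (verts_of G) G = 3"
    using F F' G by (auto simp: balanced_block_def)
  have neq: "x j \<noteq> x k" using x_neq_of_balanced[OF G] perm by auto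
  let ?T = "F \<union> F'"
  have dT: "excess (verts_of ?T) ?T \<le> 2"
    using K_excess_union[OF K(1,2)] ds balanced_pair(2)[OF perm(1-4) F F' xi y] by simp
  have q0T: "q0 \<notin> verts_of ?T"
  proof
    assume "q0 \<in> verts_of ?T"
    then show False using tight_false[OF perm(1) K(4)] xs dT by auto
  qed
  let ?U = "verts_of ?T \<inter> verts_of G" and ?I = "?T \<inter> G"
  have I: "?I \<subseteq> E" "potential q0 \<eta> ?I" "finite ?U" "x j \<in> ?U" "x k \<in> ?U"
    using K K_subset pot xs K_fin[OF K(3)] by (auto intro: potential_subset)
  have dTG: "excess (verts_of (?T \<union> G)) (?T \<union> G) \<le> 5 - excess ?U ?I"
    using K_excess_union[OF K(4,3)] dT ds by simp
  have allTG: "x i \<in> verts_of (?T \<union> G)" "x j \<in> verts_of (?T \<union> G)" "x k \<in> verts_of (?T \<union> G)"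
    using xs by auto
  have ge3: "3 \<le> excess ?U ?I"
    by (rule balanced_excess_ge3(1)[OF sparse I(1,2,3) verts_of_Int I(4,5) neq])
  have lt4: "excess ?U ?I < 4"
  proof (rule ccontr)
    assume "\<not> ?thesis"
    then have "excess (verts_of (?T \<union> G)) (?T \<union> G) \<le> 1 + of_bool (q0 \<in> verts_of (?T \<union> G))"
      using dTG by simp
    then show False by (rule tight_false[OF perm(1) K(7) allTG])
  qed
  have q0G: "q0 \<notin> verts_of G"
  proof
    assume "q0 \<in> verts_of G"
    then have "excess (verts_of (?T \<union> G)) (?T \<union> G) \<le> 1 + of_bool (q0 \<in> verts_of (?T \<union> G))"
      using dTG ge3 by simp
    then show False by (rule tight_false[OF perm(1) K(7) allTG])
  qed
  have xq: "x j \<noteq> q0" "x k \<noteq> q0" using q0G xs by auto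
  have Ine: "?I \<noteq> {}"
    using balanced_excess_ge3(2)[OF sparse I(1,2,3) verts_of_Int I(4,5) neq] lt4 by auto
  have VI: "verts_of ?I = ?U"
    using balanced_excess_nonempty(2)[OF sparse I(1,2,3) verts_of_Int Ine] lt4 by auto
  text \<open>If \<open>?I\<close> lies in one of the blocks, this block contains all three neighbours.\<close>
  have inside: False
    if H: "balanced_block i a H \<zeta>" "?I \<subseteq> H" and ab: "{i, a, b} = {0, 1, 2}" "{a, b} = {j, k}" for a b H \<zeta>
  proof -
    have H': "H \<subseteq> K" "potential q0 \<zeta> H" "excess (verts_of H) H \<le> 3" "x i \<in> verts_of H"
      "g i * \<zeta> (x i) = 1" using H xi by (auto simp: balanced_block_def)
    have ab': "a = j \<and> b = k \<or> a = k \<and> b = j" using ab(2) by (simp add: doubleton_eq_iff)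
    have abx: "x a \<in> ?U" "x b \<in> ?U" "x a \<noteq> q0" "x b \<noteq> q0" "g a \<noteq> 0" "g b \<noteq> 0"
      using ab' I(4,5) xq g_nonzero[OF perm(3)] g_nonzero[OF perm(4)] by auto
    have UH: "?U \<subseteq> verts_of H" using verts_of_mono[OF H(2)] VI by simp
    have na: "g a * \<zeta> (x a) = 1" using H abx by (auto simp: balanced_block_def)
    have "g j * \<eta> (x j) = 1" "g k * \<eta> (x k) = 1"
      using G xq by (simp_all add: balanced_block_def)
    then have nG: "g a * \<eta> (x a) = 1" "g b * \<eta> (x b) = 1" using ab' by auto
    have "\<zeta> (x a) / \<eta> (x a) = \<zeta> (x b) / \<eta> (x b)"
    proof (rule ccontr)
      assume "\<not> ?thesis"
      then have "4 \<le> excess ?U ?I"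
        by (intro excess_two_potentials(1)[OF sparse I(1) potential_subset[OF H'(2) H(2)] I(2,3) verts_of_Int
              abx(1,2,3,4)])
      then show False using lt4 by simp
    qed
    moreover have "\<zeta> (x a) = \<eta> (x a)" using na nG(1) abx(5) by (metis mult_cancel_left)
    ultimately have "\<zeta> (x b) = \<eta> (x b)"
      using potential_nonzero[OF pot(3), of "x a"] potential_nonzero[OF pot(3), of "x b"] by simp
    then have "g b * \<zeta> (x b) = 1" using nG(2) by simp
    then have "g l * \<zeta> (x l) = 1" if "l \<in> {i, a, b}" for l using that na H'(5) by auto
    moreover have "x a \<in> verts_of H" "x b \<in> verts_of H" using UH abx(1,2) by blast+
    ultimately show False using balanced_false[OF ab(1) H'(1,4) _ _ H'(3,2)] by simp
  qed
  have nonempty: "F \<inter> G \<noteq> {}" "F' \<inter> G \<noteq> {}"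
  proof -
    show "F \<inter> G \<noteq> {}"
    proof
      assume "F \<inter> G = {}"
      then have "?I \<subseteq> F'" by auto
      then show False by (rule inside[OF F' _ perms(4)]) auto
    qed
    show "F' \<inter> G \<noteq> {}"
    proof
      assume "F' \<inter> G = {}"
      then have "?I \<subseteq> F" by auto
      then show False by (rule inside[OF F _ perm(1)]) auto
    qed
  qed
  obtain z where z: "z \<in> verts_of F" "z \<in> verts_of G" "z \<noteq> x j"
  proof -
    have FG: "F \<inter> G \<subseteq> E" "potential q0 \<theta> (F \<inter> G)"
      using K K_subset pot by (auto intro: potential_subset)
    have "\<not> verts_of (F \<inter> G) \<subseteq> {x j}"
      using balanced_single_vertex[OF sparse FG] nonempty by blast
    then show thesis using that verts_of_Int[of F G] by blast
  qed
  note pair = balanced_pair[OF perms(1) perm(3,2,4) balanced_block_sym[OF F] G xq(1) z]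
  have "q0 \<notin> verts_of F \<inter> verts_of G" using q0G by auto
  \<comment> \<open>The common edge excludes excess 4, so the union has excess at most
    \<open>3 + 3 - 5\<close>.\<close>
  with pair(3) nonempty have "4 < excess (verts_of F \<inter> verts_of G) (F \<inter> G)" by fastforce
  then have "excess (verts_of (F \<union> G)) (F \<union> G) \<le> 1 + of_bool (q0 \<in> verts_of (F \<union> G))"
    using K_excess_union[OF K(1,3)] ds by simp
  with xs show False by (intro tight_false[OF perm(1) K(5)]) auto
qed

text \<open>A larger overlap can only occur at a neighbour equal to \<open>q0\<close>, where
  potentials are not normalised. But with \<open>q0\<close> the bound for tight sets is 2, and it is
  reached: \<open>3 + 3 - 3\<close> for the two blocks at \<open>q0\<close>, then
  \<open>3 + 3 - 4\<close> with the third. So all overlaps are single vertices.\<close>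

lemma no_balanced_blocks:
  assumes F: "balanced_block 0 1 F \<theta>" and F': "balanced_block 0 2 F' \<theta>'" and G: "balanced_block 1 2 G \<eta>"
  shows False
proof -
  have perm: "{0, 1, 2} = {0, 1, 2::nat}" "{1, 0, 2} = {0, 1, 2::nat}" "{2, 0, 1} = {0, 1, 2::nat}" by auto
  note ov0 = no_balanced_blocks_overlap[OF perm(1) _ _ _ _ _ _ F F' G, simplified]
  note ov1 = no_balanced_blocks_overlap[OF perm(2) _ _ _ _ _ _ balanced_block_sym[OF F] G F', simplified]
  note ov2 = no_balanced_blocks_overlap[OF perm(3) _ _ _ _ _ _ balanced_block_sym[OF F'] balanced_block_sym[OF G] F, simplified]
  have xs: "x 0 \<in> verts_of F" "x 1 \<in> verts_of F" "x 0 \<in> verts_of F'" "x 2 \<in> verts_of F'"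
      "x 1 \<in> verts_of G" "x 2 \<in> verts_of G"
    using F F' G by (auto simp: balanced_block_def)
  have neq: "x 0 \<noteq> x 1" "x 0 \<noteq> x 2" "x 1 \<noteq> x 2"
    using x_neq_of_balanced[OF F] x_neq_of_balanced[OF F'] x_neq_of_balanced[OF G] by auto
  have at_q0: False
    if perm: "{a, b, c} = {0, 1, 2::nat}" "a < 3" "b < 3" "c < 3" "a \<noteq> b" "a \<noteq> c" "b \<noteq> c"
      and A: "balanced_block a b A \<alpha>" and B: "balanced_block a c B \<beta>" and C: "balanced_block b c C \<delta>"
      and xa: "x a = q0" and y: "y \<in> verts_of A" "y \<in> verts_of B" "y \<noteq> x a"
      and V: "verts_of A \<inter> verts_of C = {x b}" "verts_of B \<inter> verts_of C = {x c}"
    for a b c A B C \<alpha> \<beta> \<delta> y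
  proof -
    have K: "A \<subseteq> K" "B \<subseteq> K" "C \<subseteq> K" "A \<union> B \<subseteq> K" "A \<union> B \<union> C \<subseteq> K"
      using A B C by (auto simp: balanced_block_def)
    have pot: "potential q0 \<alpha> A" "potential q0 \<beta> B" "potential q0 \<delta> C"
      and xs: "x a \<in> verts_of A" "x b \<in> verts_of A" "x a \<in> verts_of B" "x c \<in> verts_of B"
        "x b \<in> verts_of C" "x c \<in> verts_of C"
      and ds: "excess (verts_of A) A = 3" "excess (verts_of B) B = 3" "excess (verts_of C) C = 3"
      using A B C by (auto simp: balanced_block_def)
    have I: "A \<inter> B \<subseteq> E" "potential q0 \<alpha> (A \<inter> B)" "finite (verts_of A \<inter> verts_of B)"
      using K K_subset pot K_fin[OF K(1)] by (auto intro: potential_subset)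
    have "3 \<le> excess (verts_of A \<inter> verts_of B) (A \<inter> B)"
      by (rule balanced_excess_ge3(1)[OF sparse I verts_of_Int _ _ y(3)]) (use xs y in auto)
    then have dAB: "excess (verts_of (A \<union> B)) (A \<union> B) \<le> 3"
      using K_excess_union[OF K(1,2)] ds by simp
    have J: "(A \<union> B) \<inter> C \<subseteq> E" "potential q0 \<delta> ((A \<union> B) \<inter> C)"
      using K K_subset pot by (auto intro: potential_subset)
    have bc: "x b \<noteq> x c" using x_neq_of_balanced[OF C] perm by auto
    have VU: "verts_of (A \<union> B) \<inter> verts_of C = {x b, x c}" using V by auto
    have "A \<inter> C = {}"
      by (rule balanced_single_vertex[OF sparse, of _ \<delta> "x b"])
        (use V verts_of_Int[of A C] J K K_subset pot in \<open>auto intro: potential_subset\<close>)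
    moreover have "B \<inter> C = {}"
      by (rule balanced_single_vertex[OF sparse, of _ \<delta> "x c"])
        (use V verts_of_Int[of B C] J K K_subset pot in \<open>auto intro: potential_subset\<close>)
    ultimately have EU: "(A \<union> B) \<inter> C = {}" by auto
    have "excess (verts_of (A \<union> B \<union> C)) (A \<union> B \<union> C) \<le> 2"
      using K_excess_union[OF K(4,3)] dAB ds bc unfolding VU EU by (simp add: excess_def)
    then have "excess (verts_of (A \<union> B \<union> C)) (A \<union> B \<union> C) \<le> 1 + of_bool (q0 \<in> verts_of (A \<union> B \<union> C))"
      using xs xa by simp
    with xs show False by (intro tight_false[OF perm(1) K(5)]) auto
  qed
  have V0: "verts_of F \<inter> verts_of F' = {x 0}" if "x 0 \<noteq> q0" using ov0 that xs by auto
  have V1: "verts_of F \<inter> verts_of G = {x 1}" if "x 1 \<noteq> q0" using ov1 that xs by auto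
  have V2: "verts_of F' \<inter> verts_of G = {x 2}" if "x 2 \<noteq> q0" using ov2 that xs by auto
  have "verts_of F \<inter> verts_of F' = {x 0}"
  proof (rule ccontr)
    assume n: "\<not> ?thesis"
    then have q: "x 0 = q0" using V0 by auto
    from n obtain y where y: "y \<in> verts_of F" "y \<in> verts_of F'" "y \<noteq> x 0" using xs by auto
    have "x 1 \<noteq> q0" "x 2 \<noteq> q0" using q neq by auto
    then show False using at_q0[OF perm(1) _ _ _ _ _ _ F F' G q y] V1 V2 by simp
  qed
  moreover have "verts_of F \<inter> verts_of G = {x 1}"
  proof (rule ccontr)
    assume n: "\<not> ?thesis"
    then have q: "x 1 = q0" using V1 by auto
    from n obtain y where y: "y \<in> verts_of F" "y \<in> verts_of G" "y \<noteq> x 1" using xs by auto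
    have "x 0 \<noteq> q0" "x 2 \<noteq> q0" using q neq by auto
    then show False
      using at_q0[OF perm(2) _ _ _ _ _ _ balanced_block_sym[OF F] G F' q y] V0 V2 by (simp add: Int_commute)
  qed
  moreover have "verts_of F' \<inter> verts_of G = {x 2}"
  proof (rule ccontr)
    assume n: "\<not> ?thesis"
    then have q: "x 2 = q0" using V2 by auto
    from n obtain y where y: "y \<in> verts_of F'" "y \<in> verts_of G" "y \<noteq> x 2" using xs by auto
    have "x 0 \<noteq> q0" "x 1 \<noteq> q0" using q neq by auto
    then show False
      using at_q0[OF perm(3) _ _ _ _ _ _ balanced_block_sym[OF F'] balanced_block_sym[OF G] F q y] V0 V1
      by (simp add: Int_commute)
  qed
  ultimately show False
    by (intro single_overlaps_false[OF perm(1) _ _ _ _ _ _ F F' G]) simp_all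
qed

theorem bridge_exists:
  "\<exists>i<3. \<exists>j<3. i \<noteq> j \<and> bridge i j \<notin> K \<and> sparse_edges q0 (insert (bridge i j) K)"
proof (rule ccontr)
  assume "\<not> ?thesis"
  then have "bridge i j \<in> K \<or> \<not> sparse_edges q0 (insert (bridge i j) K)" if "i < 3" "j < 3" "i \<noteq> j" for i j
    using that by blast
  then have block: "(\<exists>F. tight_block i j F) \<or> (\<exists>F \<theta>. balanced_block i j F \<theta>)" if "i < 3" "j < 3" "i \<noteq> j" for i j
    using block_exists that by blast
  have perm: "{0, 1, 2} = {0, 1, 2::nat}" "{0, 2, 1} = {0, 1, 2::nat}" "{1, 2, 0} = {0, 1, 2::nat}" by auto
  have no_tight: "\<nexists>F. tight_block i j F"
    if "{i, j, k} = {0, 1, 2::nat}" "i < 3" "j < 3" "k < 3" "i \<noteq> j" "i \<noteq> k" "j \<noteq> k" for i j k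
    using no_tight_block[OF that] block[of i k] block[of j k] that(2-7) by metis
  have "\<exists>F \<theta>. balanced_block 0 1 F \<theta>" "\<exists>F \<theta>. balanced_block 0 2 F \<theta>" "\<exists>F \<theta>. balanced_block 1 2 F \<theta>"
    using block[of 0 1] block[of 0 2] block[of 1 2] no_tight[OF perm(1)] no_tight[OF perm(2)] no_tight[OF perm(3)]
    by auto
  then show False using no_balanced_blocks by blast
qed

end

section \<open>Generic independence of sparse gain graphs\<close>

text \<open>The factors by which the coordinates \<open>b\<close> and \<open>a\<close> of a velocity
  change under the rotation by \<open>g\<close>. For the trivial character velocities rotate like
  positions, with \<open>cnj g\<close> and \<open>g\<close>; the nontrivial character multiplies
  both by \<open>g\<close>. As \<open>g ^ 3 = 1\<close>, this means \<open>g ^ 2\<close> and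
  \<open>g ^ 4\<close> in the first case, \<open>1\<close> and \<open>g ^ 2\<close> in the
  second.\<close>

definition b_factor :: "bool \<Rightarrow> complex \<Rightarrow> complex" where
  "b_factor j g = (if j then 1 else g ^ 2)"

definition a_factor :: "bool \<Rightarrow> complex \<Rightarrow> complex" where
  "a_factor j g = g ^ 2 * b_factor j g"

text \<open>
  The plane is complexified with isotropic coordinates \<open>(z, cnj z)\<close>, in which \<open>(a, b)\<close> is a velocity
  and the rotation by \<open>\<omega>\<close> acts as \<open>(\<omega>, cnj \<omega>)\<close>. Then \<open>row j z e\<close> is the row of \<open>e\<close> in the
  block of the rigidity matrix for the trivial character (\<open>j = False\<close>) or for
  a nontrivial character (\<open>j = True\<close>). The block of the other nontrivial character is conjugate.
\<close>

fun row :: "bool \<Rightarrow> ('a \<Rightarrow> complex) \<Rightarrow> 'a gain_edge \<Rightarrow> ('a \<Rightarrow> complex) \<Rightarrow> ('a \<Rightarrow> complex) \<Rightarrow> complex" where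
  "row j z (u, v, g) a b =
     cnj (z u - g * z v) * (a u - a_factor j g * a v) + (z u - g * z v) * (b u - b_factor j g * b v)"

text \<open>The velocity of a fixed vertex must be invariant under all factors. Only the factor 1,
  that of \<open>b\<close> for a nontrivial character, permits a nonzero value.\<close>

definition admissible :: "bool \<Rightarrow> 'a \<Rightarrow> ('a \<Rightarrow> complex) \<Rightarrow> ('a \<Rightarrow> complex) \<Rightarrow> bool" where
  "admissible j q0 a b \<longleftrightarrow> a q0 = 0 \<and> (j \<or> b q0 = 0)"

definition independent_rows :: "bool \<Rightarrow> 'a \<Rightarrow> ('a \<Rightarrow> complex) \<Rightarrow> 'a gain_edge set \<Rightarrow> bool" where
  "independent_rows j q0 z E \<longleftrightarrow>
     (\<forall>c. \<exists>a b. admissible j q0 a b \<and> (\<forall>e\<in>E. row j z e a b = c e))"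

text \<open>\<open>(w, True)\<close> stands for the coordinate \<open>a w\<close> and
  \<open>(w, False)\<close> for \<open>b w\<close>.\<close>

definition coords :: "bool \<Rightarrow> 'a \<Rightarrow> 'a set \<Rightarrow> ('a \<times> bool) set" where
  "coords j q0 U = {(w, s). w \<in> U \<and> (w = q0 \<longrightarrow> j \<and> \<not> s)}"

fun coefficient :: "bool \<Rightarrow> ('a \<Rightarrow> complex) \<Rightarrow> 'a gain_edge \<Rightarrow> 'a \<times> bool \<Rightarrow> complex" where
  "coefficient j z (u, v, g) (w, s) =
     (if s then cnj (z u - g * z v) * (of_bool (w = u) - a_factor j g * of_bool (w = v))
      else (z u - g * z v) * (of_bool (w = u) - b_factor j g * of_bool (w = v)))"

lemma finite_coords [simp]: "finite U \<Longrightarrow> finite (coords j q0 U)"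
  by (rule finite_subset[of _ "U \<times> UNIV"]) (auto simp: coords_def)

lemma row_eq_sum:
  assumes U: "finite U" "verts_of {e} \<subseteq> U" and ab: "admissible j q0 a b"
  shows "row j z e a b = (\<Sum>i\<in>coords j q0 U. coefficient j z e i * (if snd i then a (fst i) else b (fst i)))"
proof -
  obtain u v g where e: "e = (u, v, g)" by (cases e)
  have uv: "u \<in> U" "v \<in> U" using U e by auto
  let ?t = "\<lambda>i. coefficient j z e i * (if snd i then a (fst i) else b (fst i))"
  have "(\<Sum>i\<in>coords j q0 U. ?t i) = (\<Sum>i\<in>U \<times> UNIV. ?t i)"
    by (rule sum.mono_neutral_left) (use U ab in \<open>auto simp: coords_def admissible_def\<close>)
  also have "\<dots> = (\<Sum>w\<in>U. \<Sum>s\<in>UNIV. ?t (w, s))"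
    unfolding sum.cartesian_product by (rule sum.cong) auto
  also have "\<dots> = (\<Sum>w\<in>U. ?t (w, True)) + (\<Sum>w\<in>U. ?t (w, False))"
    by (simp add: UNIV_bool sum.distrib add.commute)
  also have "(\<Sum>w\<in>U. ?t (w, True)) = cnj (z u - g * z v) *
      ((\<Sum>w\<in>U. of_bool (w = u) * a w) - a_factor j g * (\<Sum>w\<in>U. of_bool (w = v) * a w))"
    by (simp add: e algebra_simps sum_distrib_left sum_subtractf sum.distrib)
  also have "(\<Sum>w\<in>U. ?t (w, False)) = (z u - g * z v) *
      ((\<Sum>w\<in>U. of_bool (w = u) * b w) - b_factor j g * (\<Sum>w\<in>U. of_bool (w = v) * b w))"
    by (simp add: e algebra_simps sum_distrib_left sum_subtractf sum.distrib)
  finally show ?thesis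
    using uv U(1) by (simp add: e of_bool_def if_distrib[of "\<lambda>x. x * _"] cong: if_cong)
qed

lemma independent_rows_iff_solvable:
  assumes U: "finite U" "verts_of E \<subseteq> U"
  shows "independent_rows j q0 z E \<longleftrightarrow> solvable_system E (coords j q0 U) (coefficient j z)"
proof -
  have sub: "verts_of {e} \<subseteq> U" if "e \<in> E" for e using that U(2) verts_of_mono[of "{e}" E] by blast
  show ?thesis
  proof
    assume I: "independent_rows j q0 z E"
    show "solvable_system E (coords j q0 U) (coefficient j z)"
      unfolding solvable_system_def
    proof
      fix c
      obtain a b where ab: "admissible j q0 a b" "\<forall>e\<in>E. row j z e a b = c e"
        using I unfolding independent_rows_def by metis
      show "\<exists>x. \<forall>e\<in>E. (\<Sum>i\<in>coords j q0 U. coefficient j z e i * x i) = c e"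
        using ab row_eq_sum[OF U(1) sub ab(1)] by (intro exI[of _ "\<lambda>i. if snd i then a (fst i) else b (fst i)"]) simp
    qed
  next
    assume S: "solvable_system E (coords j q0 U) (coefficient j z)"
    show "independent_rows j q0 z E"
      unfolding independent_rows_def
    proof
      fix c
      obtain x where x: "\<forall>e\<in>E. (\<Sum>i\<in>coords j q0 U. coefficient j z e i * x i) = c e"
        using S unfolding solvable_system_def by metis
      define a where "a = (\<lambda>w. if (w, True) \<in> coords j q0 U then x (w, True) else 0)"
      define b where "b = (\<lambda>w. if (w, False) \<in> coords j q0 U then x (w, False) else 0)"
      have ab: "admissible j q0 a b" by (auto simp: admissible_def a_def b_def coords_def)
      have "row j z e a b = c e" if e: "e \<in> E" for e
      proof -
        have "row j z e a b = (\<Sum>i\<in>coords j q0 U. coefficient j z e i * x i)"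
          unfolding row_eq_sum[OF U(1) sub[OF e] ab]
        proof (rule sum.cong)
          fix i assume "i \<in> coords j q0 U"
          then show "coefficient j z e i * (if snd i then a (fst i) else b (fst i)) = coefficient j z e i * x i"
            by (cases i; cases "snd i") (simp_all add: a_def b_def)
        qed simp
        then show ?thesis using x e by simp
      qed
      with ab show "\<exists>a b. admissible j q0 a b \<and> (\<forall>e\<in>E. row j z e a b = c e)" by blast
    qed
  qed
qed

lemma independent_rows_generic:
  assumes "finite E" "independent_rows j q0 z0 E"
  shows "\<exists>f. line_polynomial f \<and> f z0 \<noteq> 0 \<and> (\<forall>z. f z \<noteq> 0 \<longrightarrow> independent_rows j q0 z E)"
proof -
  have fin: "finite (verts_of E)" using assms by simp
  have "line_polynomial (\<lambda>z. coefficient j z e i)" for e and i :: "'a \<times> bool"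
    by (cases e; cases i; cases "snd i") auto
  then show ?thesis
    unfolding independent_rows_iff_solvable[OF fin subset_refl]
    by (intro solvable_system_generic)
      (use assms fin independent_rows_iff_solvable[OF fin subset_refl] in simp_all)
qed

lemma cube_root_facts:
  assumes "(g::complex) ^ 3 = 1"
  shows "g \<noteq> 0" "cnj g = inverse g" "inverse g = g ^ 2" "cnj g * g = 1"
proof -
  show nz: "g \<noteq> 0" using assms by auto
  have "norm g ^ 3 = 1" using assms by (metis norm_one norm_power)
  then have n: "norm g = 1" using power_eq_imp_eq_base[of "norm g" 3 1] by simp
  then show "cnj g * g = 1" by (metis complex_norm_square mult.commute of_real_1 power_one)
  then show "cnj g = inverse g" by (metis inverse_unique mult.commute)
  show "inverse g = g ^ 2" using assms by (intro inverse_unique) (simp add: power2_eq_square power3_eq_cube mult.assoc)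
qed

lemma b_factor_mult: "b_factor j (g * h) = b_factor j g * b_factor j h"
  by (simp add: b_factor_def power_mult_distrib)

lemma a_factor_mult: "a_factor j (g * h) = a_factor j g * a_factor j h"
  by (simp add: a_factor_def b_factor_mult power_mult_distrib)

lemma factor_nonzero: "g \<noteq> 0 \<Longrightarrow> b_factor j g \<noteq> 0" "g \<noteq> 0 \<Longrightarrow> a_factor j g \<noteq> 0"
  by (simp_all add: b_factor_def a_factor_def)

lemma factor_inverse: "b_factor j (inverse g) = inverse (b_factor j g)" "a_factor j (inverse g) = inverse (a_factor j g)"
  by (simp_all add: b_factor_def a_factor_def power_inverse)

definition orientation_factor :: "bool \<Rightarrow> 'a gain_edge \<Rightarrow> 'a \<Rightarrow> 'a \<Rightarrow> complex \<Rightarrow> complex" where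
  "orientation_factor j e v x g = (if e = (v, x, g) then 1 else inverse (g * b_factor j g))"

text \<open>Seen from its other end, the vector of the edge is multiplied by
  \<open>- inverse g\<close> and the row by a nonzero scalar, so orientations do not affect
  independence.\<close>

lemma row_joins:
  assumes "joins e v x g" "g ^ 3 = 1"
  shows "row j z e a b = orientation_factor j e v x g * row j z (v, x, g) a b"
    "orientation_factor j e v x g \<noteq> 0"
proof -
  note g = cube_root_facts[OF assms(2)]
  show "orientation_factor j e v x g \<noteq> 0"
    using g factor_nonzero by (simp add: orientation_factor_def)
  show "row j z e a b = orientation_factor j e v x g * row j z (v, x, g) a b"
  proof (cases "e = (v, x, g)")
    case True
    then show ?thesis by (simp add: orientation_factor_def)
  next
    case False
    then have e: "e = (x, v, inverse g)" using assms by (auto simp: joins_def)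
    have h: "b_factor j g \<noteq> 0" using factor_nonzero g by auto
    have A: "cnj (z x - inverse g * z v) = - g * cnj (z v - g * z x)"
      using g(1) by (simp add: g(2) field_simps)
    have B: "z x - inverse g * z v = - inverse g * (z v - g * z x)"
      using g(1) by (simp add: field_simps)
    have "- G * W * (ax - inverse (G ^ 2) * inverse H * av) + - inverse G * Z * (bx - inverse H * bv) =
        inverse (G * H) * (W * (av - G ^ 2 * H * ax) + Z * (bv - H * bx))"
      if "G \<noteq> 0" "H \<noteq> 0" for G H W Z ax av bx bv :: complex
      using that by (simp add: field_simps power2_eq_square)
    note key = this
    have *: "orientation_factor j e v x g = inverse (g * b_factor j g)"
      using False by (simp add: orientation_factor_def)
    show ?thesis
      unfolding * unfolding e row.simps A unfolding B factor_inverse a_factor_def power_inverse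
      by (rule key[OF g(1) h])
  qed
qed

lemma row_cong:
  assumes "\<And>w. w \<in> verts_of {e} \<Longrightarrow> z w = z' w \<and> a w = a' w \<and> b w = b' w"
  shows "row j z e a b = row j z' e a' b'"
  using assms by (cases e) auto

lemma row_linear:
  "row j z e (\<lambda>w. s * a w + t * a' w) (\<lambda>w. s * b w + t * b' w) = s * row j z e a b + t * row j z e a' b'"
  by (cases e) (simp add: algebra_simps)

section \<open>Adding a vertex: rows as functions of its velocity\<close>

definition a_part :: "bool \<Rightarrow> ('a \<Rightarrow> complex) \<Rightarrow> 'a \<Rightarrow> 'a gain_edge \<Rightarrow> complex" where
  "a_part j z v e = row j z e (\<lambda>w. of_bool (w = v)) (\<lambda>_. 0)"

definition b_part :: "bool \<Rightarrow> ('a \<Rightarrow> complex) \<Rightarrow> 'a \<Rightarrow> 'a gain_edge \<Rightarrow> complex" where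
  "b_part j z v e = row j z e (\<lambda>_. 0) (\<lambda>w. of_bool (w = v))"

lemma row_update:
  "row j z e (a(v := s)) (b(v := t)) =
     row j z e (a(v := 0)) (b(v := 0)) + s * a_part j z v e + t * b_part j z v e"
  by (cases e) (auto simp: a_part_def b_part_def algebra_simps)

lemma line_polynomial_parts [intro, simp]:
  "line_polynomial (\<lambda>z. a_part j z v e)" "line_polynomial (\<lambda>z. b_part j z v e)"
  by (cases e; auto simp: a_part_def b_part_def)+

text \<open>The rows of \<open>K\<close> do not involve the velocity of \<open>v\<close>, which is
  therefore free to solve the equations of \<open>S\<close>.\<close>

lemma independent_rows_extend:
  assumes K: "independent_rows j q0 z K" and v: "v \<notin> verts_of K" "v \<noteq> q0"
    and S: "\<And>r. \<exists>s t. \<forall>e\<in>S. s * a_part j z v e + t * b_part j z v e = r e"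
  shows "independent_rows j q0 z (K \<union> S)"
  unfolding independent_rows_def
proof
  fix c
  obtain a b where ab: "admissible j q0 a b" "\<forall>e\<in>K. row j z e a b = c e"
    using K unfolding independent_rows_def by metis
  obtain s t where st: "\<forall>e\<in>S. s * a_part j z v e + t * b_part j z v e =
      c e - row j z e (a(v := 0)) (b(v := 0))"
    using S[of "\<lambda>e. c e - row j z e (a(v := 0)) (b(v := 0))"] by blast
  have "row j z e (a(v := s)) (b(v := t)) = c e" if "e \<in> K" for e
  proof -
    have "v \<notin> verts_of {e}" using that v verts_of_mono[of "{e}" K] by blast
    then have "row j z e (a(v := s)) (b(v := t)) = row j z e a b" by (intro row_cong) auto
    then show ?thesis using ab that by simp
  qed
  moreover have "row j z e (a(v := s)) (b(v := t)) = c e" if "e \<in> S" for e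
    using st[rule_format, OF that] unfolding row_update[of _ _ _ _ _ s _ t] by (simp add: algebra_simps)
  moreover have "admissible j q0 (a(v := s)) (b(v := t))" using ab v by (simp add: admissible_def)
  ultimately show "\<exists>a b. admissible j q0 a b \<and> (\<forall>e\<in>K \<union> S. row j z e a b = c e)" by blast
qed

text \<open>Cramer's determinant of two equations for the velocity of \<open>v\<close>.\<close>

definition cross_part :: "bool \<Rightarrow> ('a \<Rightarrow> complex) \<Rightarrow> 'a \<Rightarrow> 'a gain_edge \<Rightarrow> 'a gain_edge \<Rightarrow> complex" where
  "cross_part j z v e e' = a_part j z v e * b_part j z v e' - a_part j z v e' * b_part j z v e"

lemma solve_pair:
  assumes "cross_part j z v e e' \<noteq> 0"
  shows "\<exists>s t. \<forall>d\<in>{e, e'}. s * a_part j z v d + t * b_part j z v d = r d"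
proof -
  let ?D = "cross_part j z v e e'"
  let ?s = "(r e * b_part j z v e' - r e' * b_part j z v e) / ?D"
  let ?t = "(r e' * a_part j z v e - r e * a_part j z v e') / ?D"
  have "?s * a_part j z v e + ?t * b_part j z v e = r e * ?D / ?D"
    unfolding times_divide_eq_left add_divide_distrib[symmetric]
    by (rule arg_cong2[of _ _ _ _ "(/)"]) (simp_all add: cross_part_def algebra_simps)
  moreover have "?s * a_part j z v e' + ?t * b_part j z v e' = r e' * ?D / ?D"
    unfolding times_divide_eq_left add_divide_distrib[symmetric]
    by (rule arg_cong2[of _ _ _ _ "(/)"]) (simp_all add: cross_part_def algebra_simps)
  ultimately show ?thesis using assms by (intro exI[of _ ?s] exI[of _ ?t]) simp
qed

lemma parts_joins:
  assumes "joins e v x g" "g ^ 3 = 1" "x \<noteq> v"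
  shows "a_part j z v e = orientation_factor j e v x g * cnj (z v - g * z x)"
    "b_part j z v e = orientation_factor j e v x g * (z v - g * z x)"
  using assms unfolding a_part_def b_part_def row_joins(1)[OF assms(1,2)] by simp_all

lemma parts_loop:
  "a_part j z v (v, v, g) = cnj (1 - g) * (1 - a_factor j g) * cnj (z v)"
  "b_part j z v (v, v, g) = (1 - g) * (1 - b_factor j g) * z v"
  unfolding a_part_def b_part_def by (simp_all add: algebra_simps)

text \<open>\<open>2 * \<i>\<close> times the determinant of \<open>p\<close> and \<open>q\<close>
  as vectors of the plane.\<close>

definition area :: "complex \<Rightarrow> complex \<Rightarrow> complex" where
  "area p q = cnj p * q - cnj q * p"

lemma cross_part_joins:
  assumes "joins e v x g" "g ^ 3 = 1" "x \<noteq> v" "joins e' v x' g'" "g' ^ 3 = 1" "x' \<noteq> v"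
  shows "cross_part j z v e e' \<noteq> 0 \<longleftrightarrow> area (z v - g * z x) (z v - g' * z x') \<noteq> 0"
proof -
  have "cross_part j z v e e' = orientation_factor j e v x g * orientation_factor j e' v x' g' *
      area (z v - g * z x) (z v - g' * z x')"
    unfolding cross_part_def parts_joins[OF assms(1-3)] parts_joins[OF assms(4-6)]
    by (simp add: area_def algebra_simps)
  then show ?thesis using row_joins(2)[OF assms(1,2)] row_joins(2)[OF assms(4,5)] by simp
qed

lemma area_scale: "area (c * p) (c * q) = cnj c * c * area p q"
  by (simp add: area_def algebra_simps)

lemma area_cube_roots:
  assumes "g ^ 3 = 1" "h ^ 3 = 1" "g \<noteq> h"
  shows "area g h \<noteq> 0"
proof
  note G = cube_root_facts[OF assms(1)] and H = cube_root_facts[OF assms(2)]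
  assume "area g h = 0"
  then have "inverse g * h = inverse h * g" by (simp add: area_def G H)
  then have "h ^ 2 = g ^ 2" using G H by (simp add: field_simps power2_eq_square)
  then have "inverse h = inverse g" using G H by simp
  then show False using assms by simp
qed

lemma distinct_lifts:
  assumes "x \<noteq> x' \<or> x \<noteq> q0 \<and> g \<noteq> g'" "(g::complex) ^ 3 = 1" "g' ^ 3 = 1"
  shows "\<exists>z. z q0 = 0 \<and> g * z x - g' * z x' \<noteq> 0"
proof -
  have nz: "g \<noteq> 0" "g' \<noteq> 0" using assms(2,3) cube_root_facts(1) by blast+
  show ?thesis
  proof (cases "x = q0")
    case True
    then show ?thesis using assms nz by (intro exI[of _ "\<lambda>w. of_bool (w = x') :: complex"]) auto
  next
    case False
    then show ?thesis using assms nz by (intro exI[of _ "\<lambda>w. of_bool (w = x) :: complex"]) auto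
  qed
qed

definition triangle :: "complex \<Rightarrow> complex \<Rightarrow> complex \<Rightarrow> complex" where
  "triangle p q r = area (q - p) (r - p)"

text \<open>For \<open>v\<close> at the midpoint of two lifts: its edge to one of them is parallel
  to its edge to the third lift only if the three are collinear.\<close>

lemma area_midpoint: "area ((p + q) / 2 - p) ((p + q) / 2 - r) = - triangle p q r / 2"
  by (simp add: triangle_def area_def field_simps)

lemma triangle_perm: "triangle q p r = - triangle p q r" "triangle p r q = - triangle p q r"
  by (simp_all add: triangle_def area_def algebra_simps)

text \<open>Explicit positions: three lifts of one vertex form a regular triangle; if exactly two
  lifts belong to one vertex, the third goes to the origin; three different vertices, two of them
  free, have lifts at 1, \<open>\<i>\<close> and 0.\<close>

lemma noncollinear_lifts:
  assumes d: "\<And>i j. i < 3 \<Longrightarrow> j < 3 \<Longrightarrow> i \<noteq> j \<Longrightarrow> x i = x j \<Longrightarrow> x i \<noteq> q0 \<and> g i \<noteq> g j"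
    and g: "\<And>i. i < 3 \<Longrightarrow> g i ^ 3 = (1::complex)"
    and ijk: "i < 3" "j < 3" "k < (3::nat)" "i \<noteq> j" "i \<noteq> k" "j \<noteq> k"
  shows "\<exists>z. z q0 = 0 \<and> triangle (g i * z (x i)) (g j * z (x j)) (g k * z (x k)) \<noteq> 0"
proof -
  define T where "T = (\<lambda>i j k z. triangle (g i * z (x i)) (g j * z (x j)) (g k * z (x k)))"
  define good where "good = (\<lambda>i j k. \<exists>z. z q0 = 0 \<and> T i j k z \<noteq> 0)"
  have swap: "good i j k \<longleftrightarrow> good j i k" "good i j k \<longleftrightarrow> good i k j" for i j k
  proof -
    have "T j i k z = - T i j k z" "T i k j z = - T i j k z" for z
      unfolding T_def by (rule triangle_perm)+
    then show "good i j k \<longleftrightarrow> good j i k" "good i j k \<longleftrightarrow> good i k j" unfolding good_def by simp_all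
  qed
  have all_equal: "good i j k" if "i < 3" "j < 3" "k < 3" "i \<noteq> j" "i \<noteq> k" "j \<noteq> k" "x i = x j" "x i = x k" for i j k
  proof -
    let ?z = "\<lambda>w. of_bool (w = x i) :: complex"
    have n: "x i \<noteq> q0" "g i \<noteq> g j" "g i \<noteq> g k" "g j \<noteq> g k" using d[of i j] d[of i k] d[of j k] that by auto
    note G = cube_root_facts[OF g[OF that(1)]] cube_root_facts[OF g[OF that(2)]] cube_root_facts[OF g[OF that(3)]]
    \<comment> \<open>\<open>w\<close> and \<open>w'\<close> are the two nontrivial cube roots of
      unity, so \<open>w' = w ^ 2\<close> and the area becomes
      \<open>- 3 * (w * (w - 1))\<close>.\<close>
    define w where "w = inverse (g i) * g j"
    define w' where "w' = inverse (g i) * g k"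
    have ww: "g j = g i * w" "g k = g i * w'" using cube_root_facts(1)[OF g[OF that(1)]] by (auto simp: w_def w'_def)
    have w3: "w ^ 3 = 1" "w' ^ 3 = 1" using g that by (auto simp: w_def w'_def power_mult_distrib power_inverse)
    have w1: "w \<noteq> 1" "w' \<noteq> 1" "w \<noteq> w'" using n ww by auto
    have "(w - 1) * (w ^ 2 + w + 1) = 0" "(w' - 1) * (w' ^ 2 + w' + 1) = 0"
      using w3 by (simp_all add: algebra_simps power2_eq_square power3_eq_cube)
    then have q: "w ^ 2 + w + 1 = 0" "w' ^ 2 + w' + 1 = 0" using w1 by auto
    have "(w - w') * (w + w' + 1) = (w ^ 2 + w + 1) - (w' ^ 2 + w' + 1)"
      by (simp add: algebra_simps power2_eq_square)
    then have "w + w' + 1 = 0" using q w1 by simp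
    then have "w' + (w + 1) = w ^ 2 + (w + 1)" using q(1) by (simp add: add_ac)
    then have w': "w' = w ^ 2" by simp
    have c1: "cnj w = w ^ 2" using cube_root_facts(2,3)[OF w3(1)] by simp
    have "(w ^ 2) ^ 2 = w ^ 3 * w" by (simp add: power2_eq_square power3_eq_cube)
    then have c: "cnj w = w ^ 2" "cnj (w ^ 2) = w" using c1 w3 by simp_all
    have "area (w - 1) (w ^ 2 - 1) = (w ^ 2 - 1) ^ 2 - (w - 1) ^ 2"
      unfolding area_def complex_cnj_diff c by (simp add: power2_eq_square)
    also have "\<dots> = (w ^ 2 - w) * (w ^ 2 + w + 1 - 3)" by (simp add: algebra_simps power2_eq_square)
    also have "\<dots> = - 3 * (w * (w - 1))" unfolding q(1) by (simp add: algebra_simps power2_eq_square)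
    finally have "area (w - 1) (w ^ 2 - 1) \<noteq> 0" using w1 w3 by auto
    moreover have "T i j k ?z = cnj (g i) * g i * area (w - 1) (w ^ 2 - 1)"
      unfolding T_def triangle_def area_scale[symmetric] using that ww w' by (simp add: algebra_simps)
    ultimately have "T i j k ?z \<noteq> 0" using G by simp
    then show ?thesis using n unfolding good_def by (intro exI[of _ ?z]) simp
  qed
  have two_equal: "good i j k" if "i < 3" "j < 3" "k < 3" "i \<noteq> j" "x i = x j" "x i \<noteq> x k" for i j k
  proof -
    let ?z = "\<lambda>w. of_bool (w = x i) :: complex"
    have n: "x i \<noteq> q0" "g i \<noteq> g j" using d[of i j] that by auto
    have "T k i j ?z = area (g i) (g j)" using that unfolding T_def triangle_def by simp
    then have "T k i j ?z \<noteq> 0" using area_cube_roots[of "g i" "g j"] g n that by simp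
    then have "good k i j" using n unfolding good_def by (intro exI[of _ ?z]) simp
    then show ?thesis using swap by blast
  qed
  have distinct: "good i j k" if "i < 3" "j < 3" "k < 3" "x i \<noteq> x j" "x i \<noteq> x k" "x j \<noteq> x k"
      "x i \<noteq> q0" "x j \<noteq> q0" for i j k
  proof -
    let ?z = "\<lambda>w. if w = x i then 1 / g i else if w = x j then \<i> / g j else 0"
    have "g i \<noteq> 0" "g j \<noteq> 0" using cube_root_facts(1) g that by blast+
    then have "T k i j ?z = area 1 \<i>" using that unfolding T_def triangle_def by auto
    then have "T k i j ?z \<noteq> 0" by (simp add: area_def)
    then have "good k i j" using that unfolding good_def by (intro exI[of _ ?z]) auto
    then show ?thesis using swap by blast
  qed
  have "good i j k"
  proof (cases "x i = x j \<or> x i = x k \<or> x j = x k")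
    case True
    then show ?thesis
      using all_equal[OF ijk] two_equal[of i j k] two_equal[of i k j] two_equal[of j k i] ijk swap by metis
  next
    case False
    then show ?thesis
      using distinct[of i j k] distinct[of i k j] distinct[of j k i] ijk swap by metis
  qed
  then show ?thesis by (simp add: good_def T_def)
qed

lemma sum_card_fibres:
  assumes "finite E" "finite N"
  shows "(\<Sum>v\<in>N. card {e\<in>E. t e = v}) = card {e\<in>E. t e \<in> N}"
proof -
  have "{e\<in>E. t e \<in> N} = (\<Union>v\<in>N. {e\<in>E. t e = v})" by auto
  moreover have "\<forall>i\<in>N. \<forall>j\<in>N. i \<noteq> j \<longrightarrow> {e\<in>E. t e = i} \<inter> {e\<in>E. t e = j} = {}" by auto
  ultimately show ?thesis using assms card_UN_disjoint[of N "\<lambda>v. {e\<in>E. t e = v}"] by simp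
qed

text \<open>The degree counts loops twice. If all degrees were at least 4, counting ends of edges
  would bound \<open>2 * card E\<close> from below by \<open>4 * card N\<close>, plus 1 if
  \<open>q0\<close> occurs; sparsity bounds \<open>card E\<close> by \<open>2 * card N - 1\<close>,
  plus 1 if \<open>q0\<close> occurs.\<close>

lemma low_degree_vertex:
  assumes sparse: "sparse_edges q0 E" and "E \<noteq> {}"
  shows "\<exists>v\<in>verts_of E - {q0}. card {e\<in>E. v \<in> verts_of {e}} + card {e\<in>E. fst e = v \<and> fst (snd e) = v} \<le> 3"
proof (rule ccontr)
  define N where "N = verts_of E - {q0}"
  assume "\<not> ?thesis"
  then have big: "4 \<le> card {e\<in>E. v \<in> verts_of {e}} + card {e\<in>E. fst e = v \<and> fst (snd e) = v}" if "v \<in> N" for v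
    using that unfolding N_def by force
  have fin: "finite E" "finite N" using sparse by (auto simp: sparse_edges_def N_def)
  have deg: "card {e\<in>E. v \<in> verts_of {e}} + card {e\<in>E. fst e = v \<and> fst (snd e) = v} =
      card {e\<in>E. fst e = v} + card {e\<in>E. fst (snd e) = v}" for v
  proof -
    have "{e\<in>E. v \<in> verts_of {e}} = {e\<in>E. fst e = v} \<union> {e\<in>E. fst (snd e) = v}"
      "{e\<in>E. fst e = v \<and> fst (snd e) = v} = {e\<in>E. fst e = v} \<inter> {e\<in>E. fst (snd e) = v}" by auto
    then show ?thesis using card_Un_Int[of "{e\<in>E. fst e = v}" "{e\<in>E. fst (snd e) = v}"] fin by simp
  qed
  have "4 * card N = (\<Sum>v\<in>N. 4)" by simp
  also have "\<dots> \<le> (\<Sum>v\<in>N. card {e\<in>E. fst e = v} + card {e\<in>E. fst (snd e) = v})"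
    by (rule sum_mono) (use big deg in force)
  also have "\<dots> = card {e\<in>E. fst e \<in> N} + card {e\<in>E. fst (snd e) \<in> N}"
    using fin by (simp add: sum.distrib sum_card_fibres)
  finally have le: "4 * card N \<le> card {e\<in>E. fst e \<in> N} + card {e\<in>E. fst (snd e) \<in> N}" .
  have le1: "card {e\<in>E. fst e \<in> N} \<le> card E" "card {e\<in>E. fst (snd e) \<in> N} \<le> card E"
    using fin by (auto intro: card_mono)
  \<comment> \<open>An edge at \<open>q0\<close> has an end that the degrees over \<open>N\<close>
    do not count.\<close>
  have "4 * int (card N) + of_bool (q0 \<in> verts_of E) \<le> 2 * int (card E)"
  proof (cases "q0 \<in> verts_of E")
    case True
    then obtain e where e: "e \<in> E" "fst e = q0 \<or> fst (snd e) = q0" by (auto simp: verts_of_def)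
    have "card {e\<in>E. fst e \<in> N} < card E \<or> card {e\<in>E. fst (snd e) \<in> N} < card E"
      using e fin by (auto simp: N_def intro!: psubset_card_mono)
    then show ?thesis using le le1 True by auto
  next
    case False
    then show ?thesis using le le1 by simp
  qed
  moreover have "1 + of_bool (q0 \<in> verts_of E) \<le> 2 * int (card (verts_of E)) - int (card E)"
    using sparse assms(2) unfolding sparse_edges_def excess_def by blast
  moreover have "int (card (verts_of E)) = int (card N) + of_bool (q0 \<in> verts_of E)"
  proof (cases "q0 \<in> verts_of E")
    case True
    then have "verts_of E = insert q0 N" "q0 \<notin> N" by (auto simp: N_def)
    then show ?thesis using fin True by simp
  next
    case False
    then show ?thesis by (simp add: N_def)
  qed
  ultimately show False by (cases "q0 \<in> verts_of E") auto
qed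

lemma independent_rows_cong:
  assumes "\<And>w. w \<in> verts_of E \<Longrightarrow> z w = z' w" "independent_rows m q0 z E"
  shows "independent_rows m q0 z' E"
proof -
  have "row m z e a b = row m z' e a b" if "e \<in> E" for e a b
    using assms(1) that verts_of_mono[of "{e}" E] by (intro row_cong) blast
  then show ?thesis using assms(2) unfolding independent_rows_def by simp
qed

lemma line_polynomial_cross_part [intro, simp]: "line_polynomial (\<lambda>z. cross_part m z v e e')"
  unfolding cross_part_def by (intro line_polynomial_diff line_polynomial_mult line_polynomial_parts)

text \<open>Both conditions are generic, so each may be verified at a configuration of its own,
  \<open>z0\<close> for \<open>K\<close> and \<open>z1\<close> for the pair.\<close>

lemma extend_by_pair:
  assumes "finite K" "z0 q0 = 0" "independent_rows m q0 z0 K" "v \<notin> verts_of K" "v \<noteq> q0"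
    and "z1 q0 = 0" "cross_part m z1 v e e' \<noteq> 0"
  shows "\<exists>z. z q0 = 0 \<and> independent_rows m q0 z (K \<union> {e, e'})"
proof -
  obtain f where f: "line_polynomial f" "f z0 \<noteq> 0" "\<And>z. f z \<noteq> 0 \<Longrightarrow> independent_rows m q0 z K"
    using independent_rows_generic[OF assms(1,3)] by blast
  obtain z where "z q0 = 0" "\<forall>h\<in>{f, \<lambda>z. cross_part m z v e e'}. h z \<noteq> 0"
    using line_polynomials_common_nonzero[of "{f, \<lambda>z. cross_part m z v e e'}" q0] assms f by auto
  then have z: "z q0 = 0" "f z \<noteq> 0" "cross_part m z v e e' \<noteq> 0" by auto
  show ?thesis
    by (rule exI[of _ z])
      (intro conjI z(1) independent_rows_extend[OF f(3)[OF z(2)] assms(4,5)] solve_pair[OF z(3)])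
qed

lemma extend_by_edge:
  assumes "finite K" "z0 q0 = 0" "independent_rows m q0 z0 K" "v \<notin> verts_of K" "v \<noteq> q0"
    and "z1 q0 = 0" "a_part m z1 v e \<noteq> 0"
  shows "\<exists>z. z q0 = 0 \<and> independent_rows m q0 z (K \<union> {e})"
proof -
  obtain f where f: "line_polynomial f" "f z0 \<noteq> 0" "\<And>z. f z \<noteq> 0 \<Longrightarrow> independent_rows m q0 z K"
    using independent_rows_generic[OF assms(1,3)] by blast
  obtain z where "z q0 = 0" "\<forall>h\<in>{f, \<lambda>z. a_part m z v e}. h z \<noteq> 0"
    using line_polynomials_common_nonzero[of "{f, \<lambda>z. a_part m z v e}" q0] assms f by auto
  then have z: "z q0 = 0" "f z \<noteq> 0" "a_part m z v e \<noteq> 0" by auto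
  have "\<exists>s t. \<forall>d\<in>{e}. s * a_part m z v d + t * b_part m z v d = r d" for r
    using z(3) by (intro exI[of _ "r e / a_part m z v e"] exI[of _ 0]) simp
  then show ?thesis
    by (intro exI[of _ z] conjI z(1) independent_rows_extend[OF f(3)[OF z(2)] assms(4,5)])
qed

lemma edge_at_vertex:
  assumes "valid_edge q0 e" "v \<in> verts_of {e}"
  obtains (loop) g where "e = (v, v, g)" "g ^ 3 = 1" "g \<noteq> 1"
  | (link) x g where "joins e v x g" "x \<noteq> v" "g ^ 3 = 1"
proof -
  obtain u w g where e: "e = (u, w, g)" by (cases e)
  have g: "g ^ 3 = 1" "inverse g ^ 3 = 1" using assms e by (auto simp: valid_edge_def power_inverse)
  consider "u = v" "w = v" | "u = v" "w \<noteq> v" | "u \<noteq> v" "w = v" using assms(2) e by auto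
  then show thesis
  proof cases
    case 1
    then show thesis using loop e g assms(1) by (auto simp: valid_edge_def)
  next
    case 2
    then show thesis using link[of w g] e g by (simp add: joins_def)
  next
    case 3
    then show thesis using link[of u "inverse g"] e g by (simp add: joins_def)
  qed
qed

lemma a_factor_neq_1:
  assumes "g ^ 3 = 1" "g \<noteq> 1"
  shows "a_factor m g \<noteq> 1"
proof
  assume "a_factor m g = 1"
  then have "g ^ 2 = 1 \<or> g ^ 4 = 1" by (auto simp: a_factor_def b_factor_def split: if_splits)
  moreover have "g ^ 4 = g ^ 3 * g" by (simp add: eval_nat_numeral)
  ultimately have "g ^ 2 = 1" using assms by auto
  then show False using assms by (simp add: power3_eq_cube power2_eq_square)
qed

lemma a_part_nonzero:
  assumes "valid_edge q0 e" "v \<in> verts_of {e}" "v \<noteq> q0"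
  shows "\<exists>z. z q0 = 0 \<and> a_part m z v e \<noteq> 0"
  using assms(1,2)
proof (cases rule: edge_at_vertex)
  case (loop g)
  then show ?thesis
    using assms(3) a_factor_neq_1[of g m] unfolding loop(1) parts_loop
    by (intro exI[of _ "\<lambda>w. of_bool (w = v) :: complex"]) auto
next
  case (link x g)
  then show ?thesis
    using assms(3) row_joins(2)[OF link(1,3)] unfolding parts_joins[OF link(1,3,2)]
    by (intro exI[of _ "\<lambda>w. of_bool (w = v) :: complex"]) auto
qed

text \<open>Two loops at \<open>v\<close> exceed the count, and two links can be made non-parallel.
  For a loop and a link: if \<open>m\<close> holds, the loop row has no \<open>b\<close> part while
  that of the link can be nonzero; for the trivial character the loop row looks like that of an edge
  in direction \<open>z v\<close>, so the link must not point to the origin. A link to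
  \<open>q0\<close> always does, hence the second hypothesis.\<close>

lemma cross_part_nonzero:
  assumes sparse: "sparse_edges q0 E" and m: "m \<or> q0 \<notin> verts_of E"
    and e: "e \<in> E" "e' \<in> E" "e \<noteq> e'" "v \<in> verts_of {e}" "v \<in> verts_of {e'}" and v: "v \<noteq> q0"
  shows "\<exists>z. z q0 = 0 \<and> cross_part m z v e e' \<noteq> 0"
proof -
  have valid: "valid_edge q0 e" "valid_edge q0 e'" using sparse e by (auto simp: sparse_edges_def)
  have loop_link: "\<exists>z. z q0 = 0 \<and> cross_part m z v d d' \<noteq> 0"
    if d: "d = (v, v, g)" "g ^ 3 = 1" "g \<noteq> 1" and d': "joins d' v x h" "x \<noteq> v" "h ^ 3 = 1" "d' \<in> E"
    for d d' g x h
  proof -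
    let ?k = "orientation_factor m d' v x h"
    have k: "?k \<noteq> 0" using row_joins(2)[OF d'(1,3)] .
    note G = cube_root_facts[OF d(2)]
    have cross: "cross_part m z v d d' = ?k * (cnj (1 - g) * (1 - a_factor m g) * cnj (z v) * (z v - h * z x) -
        cnj (z v - h * z x) * ((1 - g) * (1 - b_factor m g) * z v))" for z
      unfolding cross_part_def d(1) parts_loop parts_joins[OF d'(1,3,2)] by (simp add: algebra_simps)
    have cg: "cnj (1 - g) \<noteq> 0" "1 - g \<noteq> 0" using d by auto
    show ?thesis
    proof (cases m)
      case True
      let ?z = "\<lambda>w. of_bool (w = v) :: complex"
      have "cross_part m ?z v d d' \<noteq> 0"
        unfolding cross using True k cg d'(2) a_factor_neq_1[OF d(2,3), of m] by (simp add: b_factor_def)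
      then show ?thesis using v by (intro exI[of _ ?z]) simp
    next
      case False
      then have "q0 \<notin> verts_of E" using m by simp
      then have xq: "x \<noteq> q0" using d' ends_subset_verts_of[of d' E] by (auto simp: joins_def)
      \<comment> \<open>The link gets the direction \<open>1 - \<i>\<close>, which is not a real
        multiple of \<open>z v = 1\<close>.\<close>
      let ?z = "\<lambda>w. if w = v then 1 else if w = x then \<i> / h else 0"
      have h: "h \<noteq> 0" using cube_root_facts(1) d' by blast
      have g4: "a_factor m g = g" "b_factor m g = cnj g"
      proof -
        have "a_factor m g = g ^ 3 * g" using False by (simp add: a_factor_def b_factor_def eval_nat_numeral)
        then show "a_factor m g = g" using d by simp
        show "b_factor m g = cnj g" using False G by (simp add: b_factor_def)
      qed
      have "z x' * (h * (\<i> / h)) = z x' * \<i>" for z :: "'a \<Rightarrow> complex" and x' using h by simp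
      have P: "?z v - h * ?z x = 1 - \<i>" using d'(2) h by simp
      have "cross_part m ?z v d d' = ?k * (cnj (1 - g) * (1 - g) * ((1 - \<i>) - cnj (1 - \<i>)))"
        unfolding cross P g4 by (simp add: algebra_simps)
      moreover have "(1 - \<i>) - cnj (1 - \<i>) \<noteq> 0" by (simp add: complex_eq_iff)
      ultimately have "cross_part m ?z v d d' \<noteq> 0" using k cg by simp
      then show ?thesis using v xq by (intro exI[of _ ?z]) simp
    qed
  qed
  have swap: "cross_part m z v e e' = - cross_part m z v e' e" for z by (simp add: cross_part_def)
  from valid(1) e(4) show ?thesis
  proof (cases rule: edge_at_vertex)
    case l: (loop g)
    from valid(2) e(5) show ?thesis
    proof (cases rule: edge_at_vertex)
      case l': (loop g')
      have "verts_of {e, e'} = {v}" using l l' by auto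
      moreover have "1 + of_bool (q0 \<in> verts_of {e, e'}) \<le> excess (verts_of {e, e'}) {e, e'}"
        using sparse e unfolding sparse_edges_def by (metis empty_subsetI insert_not_empty insert_subset)
      ultimately have False using e(3) v by (auto simp: excess_def)
      then show ?thesis ..
    next
      case l': (link x h)
      show ?thesis by (rule loop_link[OF l l' e(2)])
    qed
  next
    case l: (link x g)
    from valid(2) e(5) show ?thesis
    proof (cases rule: edge_at_vertex)
      case l': (loop h)
      show ?thesis using loop_link[OF l' l e(1)] swap by simp
    next
      case l': (link x' g')
      have "x \<noteq> x' \<or> x \<noteq> q0 \<and> g \<noteq> g'" using parallel_edges[OF sparse e(1-3) l(1)] l' l(2) v by metis
      from distinct_lifts[OF this l(3) l'(3)]
      obtain z where z: "z q0 = 0" "g * z x - g' * z x' \<noteq> 0" by blast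
      define p where "p = g * z x - g' * z x'"
      \<comment> \<open>\<open>v\<close> is placed off the line through the two lifts,
        perpendicularly to \<open>p\<close> at the first one.\<close>
      let ?z = "z(v := g * z x + \<i> * p)"
      have "?z v - g * ?z x = \<i> * p" using l(2) by simp
      moreover have "?z v - g' * ?z x' = \<i> * p + p" using l'(2) by (simp add: p_def algebra_simps)
      ultimately have "area (?z v - g * ?z x) (?z v - g' * ?z x') = area (\<i> * p) (\<i> * p + p)"
        by (simp only:)
      also have "\<dots> = - 2 * \<i> * (cnj p * p)" by (simp add: area_def algebra_simps)
      also have "\<dots> \<noteq> 0"
      proof -
        have "p \<noteq> 0" using z(2) by (simp only: p_def not_False_eq_True)
        then show ?thesis by simp
      qed
      finally have "cross_part m ?z v e e' \<noteq> 0"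
        using cross_part_joins[OF l(1,3,2) l'(1,3,2)] by blast
      then show ?thesis using z v by (intro exI[of _ ?z]) simp
    qed
  qed
qed

context degree_three
begin

text \<open>At the midpoint of two of its neighbours, \<open>v\<close> subdivides the bridge between them.\<close>

lemma row_bridge:
  assumes ij: "i < 3" "j < 3" and mid: "z v = (g i * z (x i) + g j * z (x j)) / 2"
  shows "row m z (bridge i j) a b = 2 / (g i * b_factor m (g i)) *
    (row m z (v, x i, g i) a b + row m z (v, x j, g j) a b)"
proof -
  note G = cube_root_facts[OF g_cube[OF ij(1)]]
  have H: "b_factor m (g i) \<noteq> 0" using factor_nonzero G by blast
  define D where "D = z v - g i * z (x i)"
  have Dj: "z v - g j * z (x j) = - D" using mid by (simp add: D_def field_simps)
  have "z (x i) - inverse (g i) * g j * z (x j) = inverse (g i) * (g i * z (x i) - g j * z (x j))"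
    using G(1) by (simp add: field_simps)
  also have "g i * z (x i) - g j * z (x j) = - 2 * D" using mid by (simp add: D_def field_simps)
  finally have B: "z (x i) - inverse (g i) * g j * z (x j) = - 2 * inverse (g i) * D" by simp
  have cB: "cnj (z (x i) - inverse (g i) * g j * z (x j)) = - 2 * g i * cnj D"
    unfolding B using G(1) by (simp add: G(2))
  have key: "- 2 * g0 * C * (ai - inverse (g0 ^ 2) * inverse h * F * aj) + - 2 * inverse g0 * D0 * (bi - inverse h * h' * bj) =
      2 / (g0 * h) * (C * (av - g0 ^ 2 * h * ai) + D0 * (bv - h * bi) + (- C * (av - F * aj) + - D0 * (bv - h' * bj)))"
    if "g0 \<noteq> 0" "h \<noteq> 0" for g0 h h' F C D0 ai aj av bi bj bv :: complex
    using that by (simp add: field_simps power2_eq_square)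
  show ?thesis
    unfolding bridge_def row.simps cB unfolding B Dj D_def[symmetric] a_factor_mult b_factor_mult factor_inverse
      a_factor_def[of m "g i"] inverse_mult_distrib complex_cnj_minus
    by (rule key[OF G(1) H])
qed

text \<open>With \<open>v\<close> at the midpoint, the row of the bridge is a combination of those
  of \<open>e i\<close> and \<open>e j\<close>. After \<open>e i\<close> and \<open>e k\<close> have
  been added, whose directions differ, the bridge is exchanged for \<open>e j\<close>.\<close>

lemma independent_add_vertex:
  assumes ij: "i < 3" "j < 3" "i \<noteq> j" and bridge: "bridge i j \<notin> K"
    and z0: "z0 q0 = 0" "independent_rows m q0 z0 (insert (bridge i j) K)"
  shows "\<exists>z. z q0 = 0 \<and> independent_rows m q0 z E"
proof -
  define k where "k = 3 - i - j"
  have k: "k < 3" "i \<noteq> k" "j \<noteq> k" and ijk: "{0, 1, 2} = {i, j, k}"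
    using ij by (auto simp: k_def less_Suc_eq numeral_3_eq_3 numeral_2_eq_2)
  let ?B = "insert (bridge i j) K"
  have fin: "finite ?B" using sparse_finite[OF sparse K_subset] by simp
  have vB: "v \<notin> verts_of ?B" using v(2) x_neq[OF ij(1)] x_neq[OF ij(2)] by (auto simp: bridge_def)
  let ?T = "\<lambda>z. triangle (g i * z (x i)) (g j * z (x j)) (g k * z (x k))"
  obtain f where f: "line_polynomial f" "f z0 \<noteq> 0" "\<And>z. f z \<noteq> 0 \<Longrightarrow> independent_rows m q0 z ?B"
    using independent_rows_generic[OF fin z0(2)] by blast
  have T: "line_polynomial ?T" unfolding triangle_def area_def
    by (intro line_polynomial_diff line_polynomial_mult line_polynomial_cnj line_polynomial_const line_polynomial_coord)
  have "\<exists>z. z q0 = 0 \<and> ?T z \<noteq> 0"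
    by (rule noncollinear_lifts) (use x_eq g_cube ij k in auto)
  then obtain z where "z q0 = 0" "\<forall>h\<in>{f, ?T}. h z \<noteq> 0"
    using line_polynomials_common_nonzero[of "{f, ?T}" q0] f z0(1) T by auto
  then have z: "z q0 = 0" "f z \<noteq> 0" "?T z \<noteq> 0" by auto
  let ?mid = "(g i * z (x i) + g j * z (x j)) / 2"
  define z' where "z' = z(v := ?mid)"
  have z': "z' v = ?mid" "\<And>l. l < 3 \<Longrightarrow> z' (x l) = z (x l)" "z' q0 = 0"
    using x_neq z v by (auto simp: z'_def)
  have ind: "independent_rows m q0 z' ?B"
    by (rule independent_rows_cong[OF _ f(3)[OF z(2)]]) (use vB in \<open>auto simp: z'_def\<close>)
  have "area (z' v - g i * z' (x i)) (z' v - g k * z' (x k)) = - ?T z / 2"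
    unfolding z'(1) z'(2)[OF ij(1)] z'(2)[OF k(1)] by (rule area_midpoint)
  then have "cross_part m z' v (e i) (e k) \<noteq> 0"
    using z(3) cross_part_joins[OF joins[OF ij(1)] g_cube[OF ij(1)] x_neq[OF ij(1)]
        joins[OF k(1)] g_cube[OF k(1)] x_neq[OF k(1)]] by simp
  then have ind': "independent_rows m q0 z' (?B \<union> {e i, e k})"
    by (rule independent_rows_extend[OF ind vB v(1) solve_pair])
  define o' where "o' = (\<lambda>l. orientation_factor m (e l) v (x l) (g l))"
  have row_e: "row m z' (e l) a b = o' l * row m z' (v, x l, g l) a b" "o' l \<noteq> 0" if "l < 3" for l a b
    unfolding o'_def using row_joins[OF joins[OF that] g_cube[OF that]] by blast+
  have mid': "z' v = (g i * z' (x i) + g j * z' (x j)) / 2" using z' ij by simp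
  define s where "s = 2 / (g i * b_factor m (g i))"
  have s: "s \<noteq> 0" using g_nonzero[OF ij(1)] factor_nonzero by (simp add: s_def)
  have "independent_rows m q0 z' E"
    unfolding independent_rows_def
  proof
    fix c
    \<comment> \<open>This value on the bridge forces the row of \<open>e j\<close> to take the
      value \<open>c (e j)\<close>.\<close>
    define c' where "c' = c(bridge i j := s * (c (e i) / o' i + c (e j) / o' j))"
    obtain a b where ab: "admissible m q0 a b" "\<forall>d\<in>?B \<union> {e i, e k}. row m z' d a b = c' d"
      using ind' unfolding independent_rows_def by metis
    have neq: "bridge i j \<noteq> e l" if "l < 3" for l
      using e_ends[OF that] vB by auto
    have K: "row m z' d a b = c d" if "d \<in> K \<union> {e i, e k}" for d
    proof -
      have "d \<noteq> bridge i j" using that bridge neq[OF ij(1)] neq[OF k(1)] by auto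
      then show ?thesis using ab(2) that by (auto simp: c'_def)
    qed
    then have "row m z' (e i) a b = c (e i)" by blast
    then have "o' i * row m z' (v, x i, g i) a b = c (e i)" by (simp only: row_e(1)[OF ij(1)])
    then have Ri: "row m z' (v, x i, g i) a b = c (e i) / o' i"
      using row_e(2)[OF ij(1)] by (simp add: field_simps)
    have "row m z' (bridge i j) a b = s * (c (e i) / o' i + c (e j) / o' j)"
      using ab(2) by (simp add: c'_def)
    then have "row m z' (v, x j, g j) a b = c (e j) / o' j"
      unfolding row_bridge[OF ij(1,2) mid'] Ri s_def[symmetric] using s by simp
    then have "row m z' (e j) a b = c (e j)" using row_e[OF ij(2)] by simp
    moreover have "d \<in> K \<union> {e i, e k} \<or> d = e j" if "d \<in> E" for d
    proof -
      have "{e 0, e 1, e 2} = e ` {0, 1, 2}" by auto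
      then show ?thesis using that E_eq unfolding ijk by auto
    qed
    ultimately have "\<forall>d\<in>E. row m z' d a b = c d" using K by blast
    with ab(1) show "\<exists>a b. admissible m q0 a b \<and> (\<forall>d\<in>E. row m z' d a b = c d)" by blast
  qed
  then show ?thesis using z' by blast
qed

end

theorem sparse_edges_independent:
  assumes "sparse_edges q0 E" "m \<or> q0 \<notin> verts_of E"
  shows "\<exists>z. z q0 = 0 \<and> independent_rows m q0 z E"
  using assms
proof (induction "card (verts_of E - {q0})" arbitrary: E rule: less_induct)
  case less
  show ?case
  proof (cases "E = {}")
    case True
    then show ?thesis by (intro exI[of _ "\<lambda>_. 0"]) (auto simp: independent_rows_def admissible_def intro!: exI[of _ "\<lambda>_. 0"])
  next
    case False
    obtain v where v: "v \<in> verts_of E" "v \<noteq> q0"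
      and deg: "card {e\<in>E. v \<in> verts_of {e}} + card {e\<in>E. fst e = v \<and> fst (snd e) = v} \<le> 3"
      using low_degree_vertex[OF less.prems(1) False] by blast
    define S where "S = {e\<in>E. v \<in> verts_of {e}}"
    define K where "K = E - S"
    have finE: "finite E" using less.prems by (simp add: sparse_edges_def)
    have fin: "finite S" "finite K" using finE by (auto simp: S_def K_def)
    have EKS: "E = K \<union> S" by (auto simp: K_def S_def)
    have vK: "v \<notin> verts_of K" by (auto simp: K_def S_def verts_of_def)
    have smaller: "card (verts_of F - {q0}) < card (verts_of E - {q0})"
      if "v \<notin> verts_of F" "verts_of F \<subseteq> verts_of E" for F
      by (rule psubset_card_mono) (use that v finE in auto)
    have VK: "verts_of K \<subseteq> verts_of E" by (rule verts_of_mono) (auto simp: K_def)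
    have spK: "sparse_edges q0 K" by (rule sparse_edges_subset[OF less.prems(1)]) (auto simp: K_def)
    have "m \<or> q0 \<notin> verts_of K" using less.prems VK by auto
    from less.hyps[OF smaller[OF vK VK] spK this]
    obtain z0 where z0: "z0 q0 = 0" "independent_rows m q0 z0 K" by blast
    have valid: "valid_edge q0 e" if "e \<in> S" for e using that less.prems by (auto simp: S_def sparse_edges_def)
    have "card S \<le> 3" using deg by (simp add: S_def)
    moreover have "S \<noteq> {}" using v by (auto simp: S_def verts_of_def)
    then have "card S \<noteq> 0" using fin by simp
    ultimately consider "card S = 1" | "card S = 2" | "card S = 3" by linarith
    then show ?thesis
    proof cases
      case 1
      then obtain e where S: "S = {e}" using card_1_singletonE by blast
      then have e: "valid_edge q0 e" "v \<in> verts_of {e}" using valid by (auto simp: S_def)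
      obtain z1 where "z1 q0 = 0" "a_part m z1 v e \<noteq> 0" using a_part_nonzero[OF e v(2)] by blast
      from extend_by_edge[OF fin(2) z0 vK v(2) this] show ?thesis using EKS S by simp
    next
      case 2
      then obtain e e' where S: "S = {e, e'}" "e \<noteq> e'" by (meson card_2_iff)
      then have "e \<in> S" "e' \<in> S" by auto
      then have e: "e \<in> E" "e' \<in> E" "v \<in> verts_of {e}" "v \<in> verts_of {e'}" by (auto simp: S_def)
      obtain z1 where "z1 q0 = 0" "cross_part m z1 v e e' \<noteq> 0"
        using cross_part_nonzero[OF less.prems e(1,2) S(2) e(3,4) v(2)] by blast
      from extend_by_pair[OF fin(2) z0 vK v(2) this] show ?thesis using EKS S by simp
    next
      case 3
      then obtain e0 e1 e2 where S: "S = {e0, e1, e2}" "e0 \<noteq> e1" "e0 \<noteq> e2" "e1 \<noteq> e2"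
        by (metis card_3_iff)
      \<comment> \<open>Loops count twice in the degree, so three incident edges leave no room for
        one.\<close>
      have noloop: "{e\<in>E. fst e = v \<and> fst (snd e) = v} = {}"
      proof -
        have "card {e\<in>E. fst e = v \<and> fst (snd e) = v} = 0" using deg 3 by (simp add: S_def)
        then show ?thesis using finE by simp
      qed
      have link: "\<exists>x g. joins e v x g \<and> x \<noteq> v" if "e \<in> S" for e
      proof -
        have "v \<in> verts_of {e}" "e \<in> E" using that by (auto simp: S_def)
        with valid[OF that] show ?thesis
        proof (cases rule: edge_at_vertex)
          case (loop g)
          then show ?thesis using noloop \<open>e \<in> E\<close> by auto
        next
          case (link x g)
          then show ?thesis by blast
        qed
      qed
      define e where "e = (\<lambda>i::nat. if i = 0 then e0 else if i = 1 then e1 else e2)"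
      have eS: "e i \<in> S" for i using S by (simp add: e_def)
      obtain x where "\<forall>i. \<exists>g. joins (e i) v (x i) g \<and> x i \<noteq> v" using link[OF eS] by metis
      then obtain g where xg: "\<forall>i. joins (e i) v (x i) (g i) \<and> x i \<noteq> v" by metis
      interpret degree_three q0 E K v e x g
      proof
        show "E = K \<union> {e 0, e 1, e 2}" using EKS S by (simp add: e_def)
      qed (use less.prems v vK S xg in \<open>auto simp: e_def\<close>)
      obtain i j where ij: "i < 3" "j < 3" "i \<noteq> j" "bridge i j \<notin> K" "sparse_edges q0 (insert (bridge i j) K)"
        using bridge_exists by blast
      have xE: "x l \<in> verts_of E" for l
      proof -
        have "e l \<in> E" using eS[of l] by (simp add: S_def)
        moreover have "joins (e l) v (x l) (g l)" using xg by blast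
        ultimately show ?thesis using ends_subset_verts_of[of "e l" E] by (auto simp: joins_def)
      qed
      have V: "verts_of (insert (bridge i j) K) \<subseteq> verts_of E"
        using VK xE by (auto simp: bridge_def)
      have "v \<notin> verts_of (insert (bridge i j) K)" using vK xg by (auto simp: bridge_def)
      from less.hyps[OF smaller[OF this V] ij(5)] less.prems(2) V
      obtain z0 where "z0 q0 = 0" "independent_rows m q0 z0 (insert (bridge i j) K)" by blast
      from independent_add_vertex[OF ij(1-4) this] show ?thesis .
    qed
  qed
qed

section \<open>Counts\<close>

lemma card_coords:
  assumes "finite U"
  shows "card (coords m q0 U) = 2 * card (U - {q0}) + of_bool (m \<and> q0 \<in> U)"
proof -
  have eq: "coords m q0 U = (U - {q0}) \<times> UNIV \<union> (if m \<and> q0 \<in> U then {(q0, False)} else {})"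
    by (auto simp: coords_def)
  show ?thesis
    unfolding eq using assms by (subst card_Un_disjoint) (auto simp: card_cartesian_product)
qed

definition component :: "('a \<Rightarrow> complex) \<Rightarrow> ('a \<Rightarrow> complex) \<Rightarrow> 'a \<times> bool \<Rightarrow> complex" where
  "component a b p = (if snd p then a (fst p) else b (fst p))"

text \<open>The rows of \<open>F\<close> and the coordinates in \<open>P\<close> form an independent system.\<close>

lemma independent_rows_card:
  assumes U: "finite U" "verts_of F \<subseteq> U" and fin: "finite F"
    and ind: "independent_rows m q0 z F" and P: "P \<subseteq> coords m q0 U"
    and kernel: "\<And>r. \<exists>a b. admissible m q0 a b \<and> (\<forall>e\<in>F. row m z e a b = 0) \<and> (\<forall>p\<in>P. component a b p = r p)"
  shows "card F + card P \<le> card (coords m q0 U)"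
proof -
  let ?X = "coords m q0 U"
  have finX: "finite ?X" using U by simp
  have finP: "finite P" using P finX by (rule finite_subset)
  have sub: "verts_of {e} \<subseteq> U" if "e \<in> F" for e using that U(2) verts_of_mono[of "{e}" F] by blast
  define M :: "'a gain_edge + 'a \<times> bool \<Rightarrow> 'a \<times> bool \<Rightarrow> complex" where "M = (\<lambda>y i. case y of Inl e \<Rightarrow> coefficient m z e i | Inr p \<Rightarrow> of_bool (i = p))"
  have "solvable_system (Inl ` F \<union> Inr ` P) ?X M"
    unfolding solvable_system_def
  proof
    fix c :: "'a gain_edge + 'a \<times> bool \<Rightarrow> complex"
    obtain a b where ab: "admissible m q0 a b" "\<forall>e\<in>F. row m z e a b = c (Inl e)"
      using ind unfolding independent_rows_def by (elim allE[of _ "\<lambda>e. c (Inl e)"]) blast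
    \<comment> \<open>The solution for the rows is corrected by a kernel vector that supplies the
      missing values on \<open>P\<close>.\<close>
    obtain a' b' where ab': "admissible m q0 a' b'" "\<forall>e\<in>F. row m z e a' b' = 0"
      "\<forall>p\<in>P. component a' b' p = c (Inr p) - component a b p"
      using kernel[of "\<lambda>p. c (Inr p) - component a b p"] by blast
    define a'' where "a'' = (\<lambda>w. 1 * a w + 1 * a' w)"
    define b'' where "b'' = (\<lambda>w. 1 * b w + 1 * b' w)"
    have ab'': "admissible m q0 a'' b''"
      using ab(1) ab'(1) by (auto simp: admissible_def a''_def b''_def)
    have "(\<Sum>i\<in>?X. M y i * component a'' b'' i) = c y" if y: "y \<in> Inl ` F \<union> Inr ` P" for y
    proof (cases y)
      case (Inl e)
      then have e: "e \<in> F" using y by auto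
      have "(\<Sum>i\<in>?X. M y i * component a'' b'' i) = row m z e a'' b''"
        unfolding row_eq_sum[OF U(1) sub[OF e] ab''] by (simp add: M_def Inl component_def)
      also have "\<dots> = c y"
        unfolding a''_def b''_def row_linear using ab ab' e Inl by simp
      finally show ?thesis .
    next
      case (Inr p)
      then have p: "p \<in> P" using y by auto
      then have "p \<in> ?X" using P by blast
      then have "(\<Sum>i\<in>?X. M y i * component a'' b'' i) = component a'' b'' p"
        using finX by (simp add: M_def Inr of_bool_def if_distrib[of "\<lambda>x. x * _"] cong: if_cong)
      also have "\<dots> = component a b p + component a' b' p"
        by (simp add: component_def a''_def b''_def)
      finally show ?thesis using ab'(3) p Inr by simp
    qed
    then show "\<exists>x. \<forall>y\<in>Inl ` F \<union> Inr ` P. (\<Sum>i\<in>?X. M y i * x i) = c y" by blast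
  qed
  then have "card (Inl ` F \<union> Inr ` P) \<le> card ?X"
    using fin finP finX by (intro solvable_system_card_le) auto
  moreover have "card (Inl ` F \<union> Inr ` P) = card F + card P"
    using fin finP by (subst card_Un_disjoint) (auto simp: card_image)
  ultimately show ?thesis by simp
qed

text \<open>Lifts of different orbits are different points, and only the fixed vertex may be at the
  origin. This is the form in which injectivity of the framework enters the counts.\<close>

definition separated :: "'a \<Rightarrow> 'a set \<Rightarrow> ('a \<Rightarrow> complex) \<Rightarrow> bool" where
  "separated q0 U z \<longleftrightarrow> z q0 = 0 \<and>
     (\<forall>u\<in>insert q0 U. \<forall>v\<in>insert q0 U. \<forall>g. u \<noteq> v \<longrightarrow> g ^ 3 = 1 \<longrightarrow> z u \<noteq> g * z v)"

lemma separated_nonzero: "separated q0 U z \<Longrightarrow> u \<in> U \<Longrightarrow> u \<noteq> q0 \<Longrightarrow> z u \<noteq> 0"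
  unfolding separated_def by (metis insertCI mult_1 one_power2 power_one)

lemma row_translation: "row True z e (\<lambda>_. 0) (\<lambda>_. c) = 0"
  by (cases e) (simp add: b_factor_def)

text \<open>For the trivial character the factors are \<open>g\<close> and \<open>cnj g\<close>, so
  this multiple of \<open>(z, - cnj z)\<close>, a complexified rotation about the origin, is
  compatible with them.\<close>

lemma row_rotation:
  assumes "valid_edge q0 e"
  shows "row False z e (\<lambda>w. t * z w) (\<lambda>w. - t * cnj (z w)) = 0"
proof -
  obtain u v g where e: "e = (u, v, g)" by (cases e)
  have g: "g ^ 3 = 1" using assms e by (auto simp: valid_edge_def)
  note G = cube_root_facts[OF g]
  have "a_factor False g = g ^ 3 * g" by (simp add: a_factor_def b_factor_def eval_nat_numeral)
  then have "a_factor False g = g" "b_factor False g = cnj g" using g G by (simp_all add: b_factor_def)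
  then show ?thesis by (simp add: e algebra_simps)
qed

text \<open>The kernel contains the translations with constant \<open>b\<close>, whose value at one
  vertex is arbitrary.\<close>

lemma count_unbalanced_True:
  assumes "finite U" "verts_of F \<subseteq> U" "U \<noteq> {}" "finite F" "independent_rows True q0 z F"
  shows "int (card F) \<le> 2 * int (card (U - {q0})) + of_bool (q0 \<in> U) - 1"
proof -
  obtain w where w: "w \<in> U" using assms by auto
  have "card F + card {(w, False)} \<le> card (coords True q0 U)"
  proof (rule independent_rows_card[OF assms(1,2,4,5)])
    show "{(w, False)} \<subseteq> coords True q0 U" using w by (simp add: coords_def)
    show "\<exists>a b. admissible True q0 a b \<and> (\<forall>e\<in>F. row True z e a b = 0) \<and>
        (\<forall>p\<in>{(w, False)}. component a b p = r p)" for r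
      by (rule exI[of _ "\<lambda>_. 0"], rule exI[of _ "\<lambda>_. r (w, False)"])
        (simp add: row_translation admissible_def component_def)
  qed
  then show ?thesis
    unfolding card_coords[OF assms(1)] by (cases "q0 \<in> U") (simp_all del: card_Diff_insert card_Diff_singleton_if card_Diff_singleton)
qed

text \<open>The kernel contains the rotations. Their value at a free end of some edge is arbitrary,
  since separation keeps that vertex off the origin.\<close>

lemma count_unbalanced_False:
  assumes "finite U" "verts_of F \<subseteq> U" "F \<noteq> {}" "finite F" "independent_rows False q0 z F"
    and valid: "\<forall>e\<in>F. valid_edge q0 e" and sep: "separated q0 U z"
  shows "int (card F) \<le> 2 * int (card (U - {q0})) - 1"
proof -
  obtain e where e: "e \<in> F" using assms by auto
  then have "{fst e, fst (snd e)} \<subseteq> U" using ends_subset_verts_of[OF e] assms(2) by blast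
  moreover have "fst e \<noteq> q0 \<or> fst (snd e) \<noteq> q0" using valid e by (cases e) (auto simp: valid_edge_def)
  ultimately obtain w where w: "w \<in> U" "w \<noteq> q0" by blast
  have zw: "z w \<noteq> 0" by (rule separated_nonzero[OF sep w])
  have z0: "z q0 = 0" using sep by (simp add: separated_def)
  have "card F + card {(w, True)} \<le> card (coords False q0 U)"
  proof (rule independent_rows_card[OF assms(1,2,4,5)])
    show "{(w, True)} \<subseteq> coords False q0 U" using w by (simp add: coords_def)
    fix r
    define t where "t = r (w, True) / z w"
    have "t * z w = r (w, True)" using zw by (simp add: t_def)
    then have "admissible False q0 (\<lambda>w. t * z w) (\<lambda>w. - t * cnj (z w)) \<and>
        (\<forall>e\<in>F. row False z e (\<lambda>w. t * z w) (\<lambda>w. - t * cnj (z w)) = 0) \<and>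
        (\<forall>p\<in>{(w, True)}. component (\<lambda>w. t * z w) (\<lambda>w. - t * cnj (z w)) p = r p)"
      using valid z0 row_rotation[of q0 _ z t]
      by (auto simp: admissible_def component_def simp del: row.simps mult_minus_left)
    then show "\<exists>a b. admissible False q0 a b \<and> (\<forall>e\<in>F. row False z e a b = 0) \<and>
        (\<forall>p\<in>{(w, True)}. component a b p = r p)"
      by (intro exI)
  qed
  then show ?thesis using card_coords[OF assms(1), of False q0] by simp
qed

text \<open>
  A balanced gain graph lifts to the framework with joints \<open>inverse (\<theta> u) * z u\<close>, which has a
  three-dimensional space of trivial motions.
\<close>

lemma row_lifted_motion:
  assumes "potential q0 \<theta> F" "(u, v, g) \<in> F" "u \<noteq> q0" "v \<noteq> q0" "g ^ 3 = 1"
    and "a u = a_factor m (\<theta> u) * (s + t * (inverse (\<theta> u) * z u))"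
    and "a v = a_factor m (\<theta> v) * (s + t * (inverse (\<theta> v) * z v))"
    and "b u = b_factor m (\<theta> u) * (s' - t * (\<theta> u * cnj (z u)))"
    and "b v = b_factor m (\<theta> v) * (s' - t * (\<theta> v * cnj (z v)))"
  shows "row m z (u, v, g) a b = 0"
proof -
  have th: "\<theta> u = g * \<theta> v" using assms by (auto simp: potential_def)
  have "\<theta> v ^ 3 = 1" using assms(1) by (simp add: potential_def)
  note T = cube_root_facts[OF this] and G = cube_root_facts[OF assms(5)]
  let ?W = "cnj (z u - g * z v)" and ?Z = "z u - g * z v"
  have E1: "inverse (g * \<theta> v) * z u - inverse (\<theta> v) * z v = inverse (g * \<theta> v) * ?Z"
    using G(1) T(1) by (simp add: field_simps)
  have E2: "g * \<theta> v * cnj (z u) - \<theta> v * cnj (z v) = g * \<theta> v * ?W"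
    using G(1) T(1) by (simp add: G(2) field_simps)
  have E3: "row m z (u, v, g) a b =
      ?W * (a_factor m (g * \<theta> v) * t * (inverse (g * \<theta> v) * z u - inverse (\<theta> v) * z v)) -
      ?Z * (b_factor m (g * \<theta> v) * t * (g * \<theta> v * cnj (z u) - \<theta> v * cnj (z v)))"
    unfolding row.simps assms(6-9) th a_factor_mult b_factor_mult by (simp add: algebra_simps)
  have "row m z (u, v, g) a b = ?W * ?Z * t * (a_factor m (g * \<theta> v) * inverse (g * \<theta> v) -
      b_factor m (g * \<theta> v) * (g * \<theta> v))"
    unfolding E3 E1 E2 by (simp only: algebra_simps)
  moreover have "a_factor m (g * \<theta> v) * inverse (g * \<theta> v) = b_factor m (g * \<theta> v) * (g * \<theta> v)"
    using G(1) T(1) by (simp add: a_factor_def field_simps power2_eq_square)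
  ultimately show ?thesis by simp
qed

text \<open>A balanced set away from \<open>q0\<close> has no loops, so an edge has two different
  ends, whose lifted joints differ by separation. Two values of \<open>a\<close> and one of
  \<open>b\<close> at these ends then determine \<open>s\<close>, \<open>t\<close> and
  \<open>s'\<close>.\<close>

lemma count_balanced_free:
  assumes "finite U" "verts_of F \<subseteq> U" "F \<noteq> {}" "finite F" "independent_rows m q0 z F"
    and valid: "\<forall>e\<in>F. valid_edge q0 e" and sep: "separated q0 U z"
    and pot: "potential q0 \<theta> F" and q0: "q0 \<notin> U"
  shows "int (card F) \<le> 2 * int (card U) - 3"
proof -
  obtain u v g where e: "(u, v, g) \<in> F" using assms by auto
  have uv: "u \<in> U" "v \<in> U" using ends_subset_verts_of[OF e] assms(2) by auto
  have free: "w \<noteq> q0" if "w \<in> U" for w using that q0 by auto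
  have th: "\<theta> w ^ 3 = 1" for w using pot by (simp add: potential_def)
  note T = cube_root_facts[OF th]
  have g3: "h ^ 3 = 1" if "(x, y, h) \<in> F" for x y h using valid that by (auto simp: valid_edge_def)
  have neq: "u \<noteq> v"
  proof
    assume "u = v"
    then have "g \<noteq> 1" using valid e by (auto simp: valid_edge_def)
    moreover have "\<theta> u = g * \<theta> u" using pot e free[OF uv(1)] \<open>u = v\<close> by (auto simp: potential_def)
    ultimately show False using T(1)[of u] by simp
  qed
  define p where "p = (\<lambda>w. inverse (\<theta> w) * z w)"
  have pneq: "p u \<noteq> p v"
  proof
    assume "p u = p v"
    then have "z u = (\<theta> u * inverse (\<theta> v)) * z v" using T(1) by (simp add: p_def field_simps)
    moreover have "(\<theta> u * inverse (\<theta> v)) ^ 3 = 1" using th by (simp add: power_mult_distrib power_inverse)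
    ultimately show False using sep uv neq by (auto simp: separated_def)
  qed
  have fn: "a_factor m (\<theta> w) \<noteq> 0" "b_factor m (\<theta> w) \<noteq> 0" for w using factor_nonzero T(1) by blast+
  let ?P = "{(u, True), (v, True), (u, False)}"
  have "card F + card ?P \<le> card (coords m q0 U)"
  proof (rule independent_rows_card[OF assms(1,2,4,5)])
    show "?P \<subseteq> coords m q0 U" using uv free by (auto simp: coords_def)
    fix r :: "'a \<times> bool \<Rightarrow> complex"
    define ru where "ru = r (u, True) / a_factor m (\<theta> u)"
    define rv where "rv = r (v, True) / a_factor m (\<theta> v)"
    define t where "t = (ru - rv) / (p u - p v)"
    define s where "s = ru - t * p u"
    define s' where "s' = r (u, False) / b_factor m (\<theta> u) + t * (\<theta> u * cnj (z u))"
    define a where "a = (\<lambda>w. if w = q0 then 0 else a_factor m (\<theta> w) * (s + t * p w))"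
    define b where "b = (\<lambda>w. if w = q0 then 0 else b_factor m (\<theta> w) * (s' - t * (\<theta> w * cnj (z w))))"
    have tp: "t * (p u - p v) = ru - rv" using pneq by (simp add: t_def)
    have "s + t * p v = rv" using tp by (simp add: s_def algebra_simps)
    moreover have "s + t * p u = ru" by (simp add: s_def)
    ultimately have c: "component a b q = r q" if "q \<in> ?P" for q
      using that free[OF uv(1)] free[OF uv(2)] fn by (auto simp: component_def a_def b_def ru_def rv_def s'_def)
    have k: "row m z d a b = 0" if d: "d \<in> F" for d
    proof -
      obtain x y h where xyh: "d = (x, y, h)" by (cases d)
      then have xy: "x \<in> U" "y \<in> U" using ends_subset_verts_of[OF d] assms(2) by auto
      show ?thesis
        unfolding xyh
        by (rule row_lifted_motion[OF pot d[unfolded xyh] free[OF xy(1)] free[OF xy(2)] g3[OF d[unfolded xyh]],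
              of a m s t z b s'])
          (use free xy in \<open>simp_all add: a_def b_def p_def\<close>)
    qed
    have "admissible m q0 a b" by (simp add: admissible_def a_def b_def)
    then show "\<exists>a b. admissible m q0 a b \<and> (\<forall>e\<in>F. row m z e a b = 0) \<and> (\<forall>p\<in>?P. component a b p = r p)"
      using k c by blast
  qed
  moreover have "card ?P = 3" using neq by simp
  ultimately show ?thesis using card_coords[OF assms(1), of m q0] q0 by simp
qed

text \<open>The condition \<open>a q0 = 0\<close> excludes the translation \<open>s\<close>, so only
  two kernel parameters remain; but \<open>q0\<close> also has one column less, and the resulting
  bound is the same.\<close>

lemma count_balanced_fixed:
  assumes "finite U" "verts_of F \<subseteq> U" "F \<noteq> {}" "finite F" "independent_rows True q0 z F"
    and valid: "\<forall>e\<in>F. valid_edge q0 e" and sep: "separated q0 U z"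
    and pot: "potential q0 \<theta> F" and q0: "q0 \<in> U"
  shows "int (card F) \<le> 2 * int (card U) - 3"
proof -
  obtain e where e: "e \<in> F" using assms by auto
  then have "{fst e, fst (snd e)} \<subseteq> U" using ends_subset_verts_of[OF e] assms(2) by blast
  moreover have "fst e \<noteq> q0 \<or> fst (snd e) \<noteq> q0" using valid e by (cases e) (auto simp: valid_edge_def)
  ultimately obtain w where w: "w \<in> U" "w \<noteq> q0" by blast
  have zw: "z w \<noteq> 0" by (rule separated_nonzero[OF sep w])
  have z0: "z q0 = 0" using sep by (simp add: separated_def)
  have th: "\<theta> w ^ 3 = 1" for w using pot by (simp add: potential_def)
  note T = cube_root_facts[OF th]
  let ?P = "{(q0, False), (w, False)}"
  have "card F + card ?P \<le> card (coords True q0 U)"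
  proof (rule independent_rows_card[OF assms(1,2,4,5)])
    show "?P \<subseteq> coords True q0 U" using w q0 by (auto simp: coords_def)
    fix r :: "'a \<times> bool \<Rightarrow> complex"
    define s' where "s' = r (q0, False)"
    define t where "t = (s' - r (w, False)) / (\<theta> w * cnj (z w))"
    define a where "a = (\<lambda>w. a_factor True (\<theta> w) * (t * (inverse (\<theta> w) * z w)))"
    define b where "b = (\<lambda>w. s' - t * (\<theta> w * cnj (z w)))"
    have "t * (\<theta> w * cnj (z w)) = s' - r (w, False)" using zw T(1)[of w] by (simp add: t_def)
    then have c: "component a b q = r q" if "q \<in> ?P" for q
      using that z0 by (auto simp: component_def b_def s'_def)
    have a_eq: "a x = t * (\<theta> x * z x)" for x
      using T(1)[of x] by (simp add: a_def a_factor_def b_factor_def power2_eq_square)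
    have k: "row True z d a b = 0" if d: "d \<in> F" for d
    proof -
      obtain x y h where xyh: "d = (x, y, h)" by (cases d)
      have h3: "h ^ 3 = 1" and ne: "\<not> (x = q0 \<and> y = q0)" using valid d xyh by (auto simp: valid_edge_def)
      note H = cube_root_facts[OF h3]
      have b1: "b_factor True y = 1" "a_factor True y = y ^ 2" for y by (simp_all add: a_factor_def b_factor_def)
      \<comment> \<open>The potential does not control edges at \<open>q0\<close>, whose gain is
        arbitrary; these are computed directly from \<open>z q0 = 0\<close>.\<close>
      consider "x = q0" "y \<noteq> q0" | "x \<noteq> q0" "y = q0" | "x \<noteq> q0" "y \<noteq> q0" using ne by blast
      then show ?thesis
      proof cases
        case 1
        have "row True z d a b = t * cnj (z y) * \<theta> y * z y * (cnj h * h ^ 2 - h)"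
          unfolding xyh row.simps a_eq b1 using 1 z0 by (simp add: b_def algebra_simps)
        also have "cnj h * h ^ 2 = h" using H(4) by (simp add: power2_eq_square mult.assoc[symmetric])
        finally show ?thesis by simp
      next
        case 2
        then show ?thesis unfolding xyh row.simps a_eq b1 using z0 by (simp add: b_def algebra_simps)
      next
        case 3
        show ?thesis
          unfolding xyh
          by (rule row_lifted_motion[OF pot d[unfolded xyh] 3 h3, of a True 0 t z b s'])
            (simp_all add: a_def b_def b_factor_def)
      qed
    qed
    have "admissible True q0 a b" using z0 by (simp add: admissible_def a_def)
    then show "\<exists>a b. admissible True q0 a b \<and> (\<forall>e\<in>F. row True z e a b = 0) \<and> (\<forall>p\<in>?P. component a b p = r p)"
      using k c by blast
  qed
  moreover have "card ?P = 2" using w by simp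
  moreover have "card (coords True q0 U) = 2 * card (U - {q0}) + 1"
    using card_coords[OF assms(1), of True q0] q0 by (simp del: card_Diff_insert card_Diff_singleton_if card_Diff_singleton)
  moreover have "card U = card (U - {q0}) + 1"
    by (simp only: card_Suc_Diff1[OF assms(1) q0] flip: Suc_eq_plus1)
  ultimately show ?thesis by linarith
qed

theorem independent_rows_counts:
  assumes "finite U" "verts_of F \<subseteq> U" "F \<noteq> {}" "finite F" "independent_rows m q0 z F"
    and "\<forall>e\<in>F. valid_edge q0 e" "separated q0 U z"
  shows "int (card F) \<le> 2 * int (card (U - {q0})) + of_bool (m \<and> q0 \<in> U) - 1"
    "potential q0 \<theta> F \<Longrightarrow> int (card F) \<le> 2 * int (card U) - 3"
proof -
  have "verts_of F \<noteq> {}" using assms(3) by (simp add: verts_of_eq_empty)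
  then have U: "U \<noteq> {}" using assms(2) by auto
  show le: "int (card F) \<le> 2 * int (card (U - {q0})) + of_bool (m \<and> q0 \<in> U) - 1"
    using count_unbalanced_True[OF assms(1,2) U assms(4)] count_unbalanced_False[OF assms(1-4) _ assms(6,7)] assms(5)
    by (cases m) auto
  assume pot: "potential q0 \<theta> F"
  show "int (card F) \<le> 2 * int (card U) - 3"
  proof (cases "q0 \<in> U")
    case True
    show ?thesis
    proof (cases m)
      case m: True
      then show ?thesis using count_balanced_fixed[OF assms(1-4) _ assms(6,7) pot True] assms(5) by simp
    next
      case False
      \<comment> \<open>For the trivial character, the bound \<open>2 * card (U - {q0}) - 1\<close>
        is already the balanced one when \<open>q0\<close> lies in \<open>U\<close>.\<close>
      moreover have "card U = card (U - {q0}) + 1"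
        by (simp only: card_Suc_Diff1[OF assms(1) True] flip: Suc_eq_plus1)
      ultimately show ?thesis using le by (simp del: card_Diff_insert card_Diff_singleton_if card_Diff_singleton)
    qed
  next
    case False
    show ?thesis by (rule count_balanced_free[OF assms pot False])
  qed
qed

text \<open>
  For the trivial character an edge at \<open>q0\<close> and a loop have proportional rows, so that the
  case of \<open>(2, 0, 3, 1)\<close>-sparsity reduces to graphs without \<open>q0\<close>.
\<close>

definition edge_to_loop :: "complex \<Rightarrow> 'a \<Rightarrow> 'a gain_edge \<Rightarrow> 'a gain_edge" where
  "edge_to_loop \<omega> q0 = (\<lambda>(u, v, g). if u = q0 then (v, v, \<omega>) else if v = q0 then (u, u, \<omega>) else (u, v, g))"

lemma edge_to_loop_away: "q0 \<notin> verts_of {e} \<Longrightarrow> edge_to_loop \<omega> q0 e = e"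
  by (cases e) (auto simp: edge_to_loop_def)

lemma edge_to_loop_at:
  assumes "q0 \<in> verts_of {e}" "valid_edge q0 e"
  shows "\<exists>u. u \<noteq> q0 \<and> edge_to_loop \<omega> q0 e = (u, u, \<omega>) \<and> verts_of {e} = {u, q0}"
proof -
  obtain u v g where e: "e = (u, v, g)" by (cases e)
  then consider "u = q0" "v \<noteq> q0" | "u \<noteq> q0" "v = q0" using assms by (auto simp: valid_edge_def)
  then show ?thesis
    by cases (use e in \<open>auto simp: edge_to_loop_def\<close>)
qed

text \<open>On one free vertex the count allows only \<open>2 * 1 - 1\<close> edges, loops and edges
  to \<open>q0\<close> taken together; hence replacing edges by loops is injective. A set with a
  potential contains none of the new loops, so it consists of old edges and inherits their balanced
  count.\<close>

theorem sparse_edges_independent_False: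
  assumes fin: "finite E" and valid: "\<forall>e\<in>E. valid_edge q0 e"
    and balanced: "\<And>F \<theta>. F \<subseteq> E \<Longrightarrow> F \<noteq> {} \<Longrightarrow> potential q0 \<theta> F \<Longrightarrow> 3 \<le> excess (verts_of F) F"
    and all: "\<And>F. F \<subseteq> E \<Longrightarrow> F \<noteq> {} \<Longrightarrow> int (card F) \<le> 2 * int (card (verts_of F - {q0})) - 1"
  shows "\<exists>z. z q0 = 0 \<and> independent_rows False q0 z E"
proof -
  define \<omega> where "\<omega> = cis (2 * pi / 3)"
  have w: "\<omega> ^ 3 = 1" "\<omega> \<noteq> 1"
  proof -
    show "\<omega> ^ 3 = 1" using Complex.DeMoivre[of "2 * pi / 3" 3] by (simp add: \<omega>_def)
    have "cos (2 * pi / 3) = - 1 / 2" by (simp add: cos_120)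
    then have "Re \<omega> \<noteq> 1" by (simp add: \<omega>_def)
    then show "\<omega> \<noteq> 1" by auto
  qed
  note W = cube_root_facts[OF w(1)]
  let ?L = "edge_to_loop \<omega> q0"
  have vL: "valid_edge q0 (?L e) \<and> verts_of {?L e} = verts_of {e} - {q0}" if eE: "e \<in> E" for e
  proof (cases "q0 \<in> verts_of {e}")
    case True
    obtain u where "u \<noteq> q0" "?L e = (u, u, \<omega>)" "verts_of {e} = {u, q0}"
      using edge_to_loop_at[OF True] valid eE by blast
    then show ?thesis using w by (simp add: valid_edge_def insert_Diff_if)
  next
    case False
    then show ?thesis using edge_to_loop_away[OF False] valid eE by simp
  qed
  have inj: "inj_on ?L E"
  proof (rule inj_onI, rule ccontr)
    fix e e' assume e: "e \<in> E" "e' \<in> E" "?L e = ?L e'" "e \<noteq> e'"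
    then have V: "verts_of {e} - {q0} = verts_of {e'} - {q0}" using vL[of e] vL[of e'] by simp
    have "q0 \<in> verts_of {e} \<or> q0 \<in> verts_of {e'}"
      using e edge_to_loop_away[of q0 e \<omega>] edge_to_loop_away[of q0 e' \<omega>] by metis
    then obtain u where u: "verts_of {e} - {q0} = {u}"
    proof
      assume "q0 \<in> verts_of {e}"
      then obtain u where "u \<noteq> q0" "verts_of {e} = {u, q0}" using edge_to_loop_at valid e(1) by metis
      then show thesis using that[of u] by (simp add: insert_Diff_if)
    next
      assume "q0 \<in> verts_of {e'}"
      then obtain u where "u \<noteq> q0" "verts_of {e'} = {u, q0}" using edge_to_loop_at valid e(2) by metis
      then show thesis using that[of u] V by (simp add: insert_Diff_if)
    qed
    have "verts_of {e, e'} = verts_of {e} \<union> verts_of {e'}" by (auto simp: verts_of_def)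
    then have "verts_of {e, e'} - {q0} = {u}" using u V by (metis Un_Diff Un_absorb)
    then show False using all[of "{e, e'}"] e by simp
  qed
  have V: "verts_of (?L ` F) = verts_of F - {q0}" if "F \<subseteq> E" for F
  proof -
    have "verts_of (?L ` F) = (\<Union>e\<in>F. verts_of {?L e})" by (auto simp: verts_of_def)
    also have "\<dots> = (\<Union>e\<in>F. verts_of {e} - {q0})"
      by (rule SUP_cong) (use vL that in blast)+
    also have "\<dots> = verts_of F - {q0}" by (auto simp: verts_of_def)
    finally show ?thesis .
  qed
  have "sparse_edges q0 (?L ` E)"
    unfolding sparse_edges_def
  proof (intro conjI ballI allI impI)
    show "finite (?L ` E)" using fin by simp
    show "valid_edge q0 d" if "d \<in> ?L ` E" for d using that vL by auto
    fix F' assume "F' \<subseteq> ?L ` E" "F' \<noteq> {}"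
    then obtain F where F: "F \<subseteq> E" "F' = ?L ` F" "F \<noteq> {}" by (metis image_is_empty subset_image_iff)
    have card: "card F' = card F" using F inj by (metis card_image inj_on_subset)
    show "1 + of_bool (q0 \<in> verts_of F') \<le> excess (verts_of F') F'"
      using all[OF F(1,3)] V[OF F(1)] card F(2) by (simp add: excess_def)
    assume "\<exists>\<theta>. potential q0 \<theta> F'"
    then obtain \<theta> where pot: "potential q0 \<theta> F'" by blast
    have "?L e = e" if eF: "e \<in> F" for e
    proof (rule ccontr)
      assume "?L e \<noteq> e"
      then have "q0 \<in> verts_of {e}" using edge_to_loop_away by metis
      then obtain u where "?L e = (u, u, \<omega>)" "u \<noteq> q0"
        using edge_to_loop_at[of q0 e \<omega>] valid F(1) eF by blast
      moreover from this have "(u, u, \<omega>) \<in> F'" using F(2) eF by (metis image_eqI)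
      ultimately have "\<theta> u = \<omega> * \<theta> u" using pot by (auto simp: potential_def)
      then show False using w potential_nonzero[OF pot] by simp
    qed
    then have "F' = F" using F(2) image_cong[of F F ?L "\<lambda>e. e"] by simp
    then show "3 \<le> excess (verts_of F') F'" using balanced F pot by blast
  qed
  moreover have "q0 \<notin> verts_of (?L ` E)" using V by simp
  ultimately obtain z where z: "z q0 = 0" "independent_rows False q0 z (?L ` E)"
    using sparse_edges_independent[of q0 "?L ` E" False] by blast
  \<comment> \<open>The factor between the row of a new loop and that of the edge it
    replaces.\<close>
  define K where "K = cnj (1 - \<omega>) * (1 - \<omega>)"
  have K: "K \<noteq> 0" using w by (simp add: K_def)
  have row_eq: "row False z (?L e) a b = (if q0 \<in> verts_of {e} then K else 1) * row False z e a b"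
    if e: "e \<in> E" and ab: "admissible False q0 a b" for e a b
  proof -
    obtain u v g where uvg: "e = (u, v, g)" by (cases e)
    have ne: "\<not> (u = q0 \<and> v = q0)" and g: "g ^ 3 = 1" using valid e uvg by (auto simp: valid_edge_def)
    note G = cube_root_facts[OF g]
    have f: "a_factor False h = h" "b_factor False h = cnj h" if "h ^ 3 = 1" for h
    proof -
      have "a_factor False h = h ^ 3 * h" by (simp add: a_factor_def b_factor_def eval_nat_numeral)
      then show "a_factor False h = h" using that by simp
      show "b_factor False h = cnj h" using cube_root_facts(2,3)[OF that] by (simp add: b_factor_def)
    qed
    have loop: "row False z (x, x, \<omega>) a b = K * (cnj (z x) * a x + z x * b x)" for x
      unfolding row.simps f[OF w(1)] K_def by (simp add: algebra_simps)
    have 0: "a q0 = 0" "b q0 = 0" using ab by (auto simp: admissible_def)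
    have tl: "row False z (q0, v, g) a b = (cnj g * g) * (cnj (z v) * a v + z v * b v)"
      unfolding row.simps f[OF g] z(1) 0 by (simp add: algebra_simps)
    have hd: "row False z (u, q0, g) a b = cnj (z u) * a u + z u * b u"
      unfolding row.simps f[OF g] z(1) 0 by simp
    consider "u = q0" "v \<noteq> q0" | "u \<noteq> q0" "v = q0" | "u \<noteq> q0" "v \<noteq> q0" using ne by blast
    then show ?thesis
    proof cases
      case 1
      then show ?thesis using loop[of v] tl G(4) uvg by (simp add: edge_to_loop_def del: row.simps)
    next
      case 2
      then show ?thesis using loop[of u] hd uvg by (simp add: edge_to_loop_def del: row.simps)
    next
      case 3
      then show ?thesis using uvg by (simp add: edge_to_loop_def del: row.simps)
    qed
  qed
  have "independent_rows False q0 z E"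
    unfolding independent_rows_def
  proof
    fix c
    define k where "k = (\<lambda>e. if q0 \<in> verts_of {e} then K else 1)"
    have k0: "k e \<noteq> 0" for e using K by (simp add: k_def)
    define c' where "c' = (\<lambda>d. k (inv_into E ?L d) * c (inv_into E ?L d))"
    obtain a b where ab: "admissible False q0 a b" "\<forall>d\<in>?L ` E. row False z d a b = c' d"
      using z(2) unfolding independent_rows_def by metis
    have "row False z e a b = c e" if "e \<in> E" for e
    proof -
      have "k e * row False z e a b = row False z (?L e) a b"
        unfolding row_eq[OF that ab(1)] k_def ..
      also have "\<dots> = c' (?L e)" using ab(2) that by blast
      also have "\<dots> = k e * c e" using inv_into_f_f[OF inj that] by (simp add: c'_def)
      finally show ?thesis using k0 by simp
    qed
    with ab(1) show "\<exists>a b. admissible False q0 a b \<and> (\<forall>e\<in>E. row False z e a b = c e)" by blast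
  qed
  with z(1) show ?thesis by blast
qed

section \<open>Cycles and potentials\<close>

definition with_arcs :: "('a, 'b) pre_digraph \<Rightarrow> 'b set \<Rightarrow> ('a, 'b) pre_digraph" where
  "with_arcs G A = \<lparr>verts = verts G, arcs = A, tail = tail G, head = head G\<rparr>"

lemma with_arcs_simps [simp]:
  "verts (with_arcs G A) = verts G" "arcs (with_arcs G A) = A"
  "tail (with_arcs G A) = tail G" "head (with_arcs G A) = head G"
  "step_source (with_arcs G A) s = step_source G s" "step_target (with_arcs G A) s = step_target G s"
  by (cases s; simp add: with_arcs_def)+

lemma walk_verts:
  assumes "wf_digraph G" "undirected_walk G u w v"
  shows "u \<in> verts G" "v \<in> verts G"
  using assms(2)
proof (induction w arbitrary: u)
  case (Cons s w)
  {
    case 1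
    then show ?case using assms(1) by (cases s) (auto simp: wf_digraph_def split: if_splits)
  next
    case 2
    then show ?case using Cons by auto
  }
qed auto

lemma walk_append:
  assumes "wf_digraph G"
  shows "undirected_walk G u (w @ w') v \<longleftrightarrow> (\<exists>x. undirected_walk G u w x \<and> undirected_walk G x w' v)"
proof (induction w arbitrary: u)
  case Nil
  show ?case using walk_verts(1)[OF assms, of u w' v] by auto
next
  case (Cons s w)
  then show ?case by auto
qed

lemma not_distinct_map_decomp:
  "\<not> distinct (map f w) \<Longrightarrow> \<exists>w1 s w2 s' w3. w = w1 @ s # w2 @ s' # w3 \<and> f s = f s'"
proof (induction w)
  case (Cons s w)
  show ?case
  proof (cases "f s \<in> f ` set w")
    case True
    then obtain s' w2 w3 where "w = w2 @ s' # w3" "f s = f s'" by (metis imageE split_list)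
    then show ?thesis by (intro exI[of _ "[]"]) auto
  next
    case False
    then obtain w1 t w2 t' w3 where "w = w1 @ t # w2 @ t' # w3" "f t = f t'" using Cons by auto
    then show ?thesis by (intro exI[of _ "s # w1"]) auto
  qed
qed simp

text \<open>A minimal walk repeats neither sources nor arcs. Closing it by one arc therefore gives a
  cycle in the sense of \<open>undirected_cycle\<close>, which demands both.\<close>

lemma shortest_walk:
  assumes wf: "wf_digraph G" and "undirected_walk G v w0 u"
  obtains w where "undirected_walk G v w u" "distinct (map (step_source G) w)"
    "u \<notin> step_source G ` set w" "distinct (map fst w)"
proof -
  define w where "w = arg_min length (\<lambda>w. undirected_walk G v w u)"
  have walk: "undirected_walk G v w u"
    unfolding w_def by (rule arg_min_natI) (rule assms(2))
  have min: "length w \<le> length w'" if "undirected_walk G v w' u" for w'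
    unfolding w_def by (rule arg_min_nat_le) (rule that)
  note app = walk_append[OF wf]
  have "u \<notin> step_source G ` set w"
  proof
    assume "u \<in> step_source G ` set w"
    then obtain s w1 w2 where w: "w = w1 @ s # w2" "step_source G s = u"
      by (metis imageE split_list)
    then have "undirected_walk G v w1 u" using walk by (auto simp: app)
    from min[OF this] show False using w by simp
  qed
  moreover have src: "distinct (map (step_source G) w)"
  proof (rule ccontr)
    assume "\<not> ?thesis"
    from not_distinct_map_decomp[OF this]
    obtain w1 s w2 s' w3 where w: "w = w1 @ s # w2 @ s' # w3" "step_source G s = step_source G s'"
      by blast
    have "undirected_walk G v (w1 @ s' # w3) u"
      using walk w(2) unfolding w(1) by (auto simp: app)
    from min[OF this] show False using w by simp
  qed
  moreover have "distinct (map fst w)"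
  proof (rule ccontr)
    assume "\<not> ?thesis"
    from not_distinct_map_decomp[OF this]
    obtain w1 s w2 s' w3 where w: "w = w1 @ s # w2 @ s' # w3" "fst s = fst s'"
      by blast
    have "step_source G s \<noteq> step_source G s'" using src unfolding w(1) by simp
    \<comment> \<open>The arc is traversed in opposite directions, so both passages and everything
      between them can be cut out.\<close>
    then have "step_target G s' = step_source G s" using w(2) by (cases s; cases s') (auto split: if_splits)
    then have "undirected_walk G v (w1 @ w3) u"
      using walk unfolding w(1) by (auto simp: app)
    from min[OF this] show False using w by simp
  qed
  ultimately show thesis using that walk by blast
qed

text \<open>The equations of the arcs telescope; applied to a closed walk, this gives its gain the
  value 1 under \<open>\<xi>\<close>.\<close>

lemma walk_potential:
  assumes "group \<Gamma>" and \<psi>: "\<And>e. e \<in> arcs G \<Longrightarrow> \<psi> e \<in> carrier \<Gamma>"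
    and mult: "\<And>g h. g \<in> carrier \<Gamma> \<Longrightarrow> h \<in> carrier \<Gamma> \<Longrightarrow> \<xi> (g \<otimes>\<^bsub>\<Gamma>\<^esub> h) = \<xi> g * \<xi> h"
    and cube: "\<And>g. g \<in> carrier \<Gamma> \<Longrightarrow> \<xi> g ^ 3 = (1::complex)"
    and pot: "\<And>e. e \<in> arcs G \<Longrightarrow> \<theta> (tail G e) = \<xi> (\<psi> e) * \<theta> (head G e)"
    and walk: "undirected_walk G u w v"
  shows "walk_gain \<Gamma> \<psi> w \<in> carrier \<Gamma>" "\<theta> u = \<xi> (walk_gain \<Gamma> \<psi> w) * \<theta> v"
proof -
  interpret group \<Gamma> by fact
  have "\<xi> \<one>\<^bsub>\<Gamma>\<^esub> * \<xi> \<one>\<^bsub>\<Gamma>\<^esub> = \<xi> \<one>\<^bsub>\<Gamma>\<^esub>" using mult[of "\<one>\<^bsub>\<Gamma>\<^esub>" "\<one>\<^bsub>\<Gamma>\<^esub>"] by simp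
  moreover have nz: "\<xi> g \<noteq> 0" if "g \<in> carrier \<Gamma>" for g using cube[OF that] by auto
  ultimately have one: "\<xi> \<one>\<^bsub>\<Gamma>\<^esub> = 1" by simp
  have inv: "\<xi> (inv\<^bsub>\<Gamma>\<^esub> g) * \<xi> g = 1" if "g \<in> carrier \<Gamma>" for g
    using mult[of "inv\<^bsub>\<Gamma>\<^esub> g" g] that one by simp
  have "walk_gain \<Gamma> \<psi> w \<in> carrier \<Gamma> \<and> \<theta> u = \<xi> (walk_gain \<Gamma> \<psi> w) * \<theta> v"
    using walk
  proof (induction w arbitrary: u)
    case Nil
    then show ?case by (simp add: one)
  next
    case (Cons s w)
    obtain e d where s: "s = (e, d)" by (cases s)
    have e: "e \<in> arcs G" using Cons.prems s by simp
    let ?x = "step_target G s"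
    have IH: "walk_gain \<Gamma> \<psi> w \<in> carrier \<Gamma>" "\<theta> ?x = \<xi> (walk_gain \<Gamma> \<psi> w) * \<theta> v"
      using Cons by auto
    show ?case
    proof (cases d)
      case True
      then show ?thesis using Cons.prems s IH \<psi>[OF e] mult pot[OF e] by (auto simp: mult.assoc)
    next
      case False
      have "\<theta> u = \<xi> (inv\<^bsub>\<Gamma>\<^esub> (\<psi> e)) * \<theta> ?x"
        using False Cons.prems s pot[OF e] inv[OF \<psi>[OF e]] by (auto simp: mult.assoc[symmetric])
      then show ?thesis using False Cons.prems s IH \<psi>[OF e] mult by (auto simp: mult.assoc)
    qed
  qed
  then show "walk_gain \<Gamma> \<psi> w \<in> carrier \<Gamma>" "\<theta> u = \<xi> (walk_gain \<Gamma> \<psi> w) * \<theta> v" by auto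
qed

lemma walk_subset_arcs:
  assumes "undirected_walk (with_arcs G A) u w v" "A \<subseteq> B"
  shows "undirected_walk (with_arcs G B) u w v" "fst ` set w \<subseteq> A"
  using assms(1)
proof (induction w arbitrary: u)
  case (Cons s w)
  { case 1 then show ?case using Cons assms(2) by auto }
  { case 2 then show ?case using Cons assms(2) by auto }
qed auto

text \<open>Arcs are added one at a time. If the ends of the new arc are already connected, a
  shortest walk between them closes to a cycle of trivial gain, which yields the equation of the
  arc; otherwise the potential is rescaled on the component of its head.\<close>

lemma potential_of_cycles:
  assumes group: "group \<Gamma>" and wf: "wf_digraph G" and fin: "finite (arcs G)"
    and \<psi>: "\<And>e. e \<in> arcs G \<Longrightarrow> \<psi> e \<in> carrier \<Gamma>"
    and mult: "\<And>g h. g \<in> carrier \<Gamma> \<Longrightarrow> h \<in> carrier \<Gamma> \<Longrightarrow> \<xi> (g \<otimes>\<^bsub>\<Gamma>\<^esub> h) = \<xi> g * \<xi> h"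
    and cube: "\<And>g. g \<in> carrier \<Gamma> \<Longrightarrow> \<xi> g ^ 3 = (1::complex)"
    and cycles: "\<And>w. undirected_cycle G w \<Longrightarrow> walk_gain \<Gamma> \<psi> w = \<one>\<^bsub>\<Gamma>\<^esub>"
  shows "\<exists>\<theta>. (\<forall>x. \<theta> x ^ 3 = 1) \<and> (\<forall>e\<in>arcs G. \<theta> (tail G e) = \<xi> (\<psi> e) * \<theta> (head G e))"
proof -
  interpret group \<Gamma> by fact
  have "\<exists>\<theta>. (\<forall>x. \<theta> x ^ 3 = 1) \<and> (\<forall>e\<in>A. \<theta> (tail G e) = \<xi> (\<psi> e) * \<theta> (head G e))"
    if "finite A" "A \<subseteq> arcs G" for A
    using that
  proof (induction A rule: finite_induct)
    case empty
    then show ?case by (intro exI[of _ "\<lambda>_. 1"]) simp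
  next
    case (insert e A)
    then obtain \<theta> where \<theta>: "\<forall>x. \<theta> x ^ 3 = 1" "\<forall>e\<in>A. \<theta> (tail G e) = \<xi> (\<psi> e) * \<theta> (head G e)" by auto
    let ?G = "with_arcs G A" and ?u = "tail G e" and ?v = "head G e"
    have e: "e \<in> arcs G" "\<psi> e \<in> carrier \<Gamma>" using insert.prems \<psi> by auto
    have A: "A \<subseteq> arcs G" using insert.prems by auto
    have wfA: "wf_digraph ?G" using wf A by (auto simp: wf_digraph_def)
    have G_all: "with_arcs G (arcs G) = G" by (simp add: with_arcs_def)
    have \<psi>A: "\<psi> d \<in> carrier \<Gamma>" if "d \<in> arcs ?G" for d using that A \<psi> by auto
    have potA: "\<theta> (tail ?G d) = \<xi> (\<psi> d) * \<theta> (head ?G d)" if "d \<in> arcs ?G" for d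
      using that \<theta>(2) by simp
    show ?case
    proof (cases "\<exists>w. undirected_walk ?G ?v w ?u")
      case True
      then obtain w0 where "undirected_walk ?G ?v w0 ?u" by blast
      then obtain w where w: "undirected_walk ?G ?v w ?u" "distinct (map (step_source ?G) w)"
        "?u \<notin> step_source ?G ` set w" "distinct (map fst w)"
        by (rule shortest_walk[OF wfA])
      have sub: "fst ` set w \<subseteq> A" by (rule walk_subset_arcs(2)[OF w(1) subset_refl])
      have "undirected_walk G ?v w ?u" using walk_subset_arcs(1)[OF w(1) A] G_all by simp
      then have "undirected_walk G ?u ((e, True) # w) ?u" using e by simp
      moreover have "step_source ?G = step_source G" by (rule ext) simp
      ultimately have "undirected_cycle G ((e, True) # w)"
        unfolding undirected_cycle_def using w(2-4) sub insert.hyps by fastforce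
      then have one: "walk_gain \<Gamma> \<psi> ((e, True) # w) = \<one>\<^bsub>\<Gamma>\<^esub>" by (rule cycles)
      have wp: "walk_gain \<Gamma> \<psi> w \<in> carrier \<Gamma>" "\<theta> ?v = \<xi> (walk_gain \<Gamma> \<psi> w) * \<theta> ?u"
        by (rule walk_potential[OF group \<psi>A mult cube potA w(1)]; assumption)+
      have "\<xi> (\<psi> e) * \<theta> ?v = \<xi> (\<psi> e \<otimes>\<^bsub>\<Gamma>\<^esub> walk_gain \<Gamma> \<psi> w) * \<theta> ?u"
        using wp e mult by simp
      also have "\<psi> e \<otimes>\<^bsub>\<Gamma>\<^esub> walk_gain \<Gamma> \<psi> w = \<one>\<^bsub>\<Gamma>\<^esub>" using one by simp
      also have "\<xi> \<one>\<^bsub>\<Gamma>\<^esub> = 1"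
        using mult[of "\<one>\<^bsub>\<Gamma>\<^esub>" "\<one>\<^bsub>\<Gamma>\<^esub>"] cube[of "\<one>\<^bsub>\<Gamma>\<^esub>"] by auto
      finally show ?thesis using \<theta> by (intro exI[of _ \<theta>]) auto
    next
      case False
      define C where "C = {x. \<exists>w. undirected_walk ?G ?v w x}"
      define c where "c = \<theta> ?u / (\<xi> (\<psi> e) * \<theta> ?v)"
      have c3: "c ^ 3 = 1" using \<theta>(1) cube[OF e(2)] by (simp add: c_def power_divide power_mult_distrib)
      define \<theta>' where "\<theta>' = (\<lambda>x. if x \<in> C then \<theta> x * c else \<theta> x)"
      have v: "?v \<in> C" using wf e by (auto simp: C_def wf_digraph_def intro!: exI[of _ "[]"])
      have u: "?u \<notin> C" using False by (simp add: C_def)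
      have step: "y \<in> C" if x: "x \<in> C" and s: "undirected_walk ?G x [s] y" for x y s
      proof -
        obtain w where "undirected_walk ?G ?v w x" using x by (auto simp: C_def)
        then have "undirected_walk ?G ?v (w @ [s]) y" using s walk_append[OF wfA] by blast
        then show ?thesis by (auto simp: C_def)
      qed
      have same: "tail G d \<in> C \<longleftrightarrow> head G d \<in> C" if "d \<in> A" for d
      proof -
        have d: "d \<in> arcs G" using that A by auto
        have "tail G d \<in> verts G" "head G d \<in> verts G" using wf d by (auto simp: wf_digraph_def)
        then have "undirected_walk ?G (tail G d) [(d, True)] (head G d)"
          "undirected_walk ?G (head G d) [(d, False)] (tail G d)" using that by auto
        then show ?thesis using step by blast
      qed
      have nz: "\<xi> (\<psi> e) \<noteq> 0" "\<theta> ?v \<noteq> 0"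
        using cube[OF e(2)] \<theta>(1) by (auto dest!: spec[of _ ?v])
      then have "\<theta>' ?u = \<xi> (\<psi> e) * \<theta>' ?v" using u v by (simp add: \<theta>'_def c_def)
      moreover have "\<theta>' (tail G d) = \<xi> (\<psi> d) * \<theta>' (head G d)" if "d \<in> A" for d
        using same[OF that] \<theta>(2) that by (auto simp: \<theta>'_def)
      moreover have "\<forall>x. \<theta>' x ^ 3 = 1" using \<theta>(1) c3 by (auto simp: \<theta>'_def power_mult_distrib)
      ultimately show ?thesis by (intro exI[of _ \<theta>']) auto
    qed
  qed
  from this[OF fin subset_refl] show ?thesis .
qed

section \<open>Complex coordinates in the plane\<close>

definition to_complex :: "real^2 \<Rightarrow> complex" where
  "to_complex x = Complex (x $ 1) (x $ 2)"

definition of_complex :: "complex \<Rightarrow> real^2" where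
  "of_complex c = vector [Re c, Im c]"

lemma to_of_complex [simp]: "to_complex (of_complex c) = c" "of_complex (to_complex x) = x"
  by (simp_all add: to_complex_def of_complex_def complex_eq_iff vec_eq_iff forall_2)

lemma to_complex_inject [simp]: "to_complex x = to_complex y \<longleftrightarrow> x = y"
  by (metis to_of_complex(2))

lemma to_complex_add [simp]: "to_complex (x + y) = to_complex x + to_complex y"
  by (simp add: to_complex_def complex_eq_iff)

lemma to_complex_diff [simp]: "to_complex (x - y) = to_complex x - to_complex y"
  by (simp add: to_complex_def complex_eq_iff)

lemma to_complex_zero [simp]: "to_complex 0 = 0"
  by (simp add: to_complex_def complex_eq_iff)

lemma to_complex_scaleR [simp]: "to_complex (r *\<^sub>R x) = of_real r * to_complex x"
  by (simp add: to_complex_def complex_eq_iff)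

lemma inner_to_complex: "x \<bullet> y = Re (cnj (to_complex x) * to_complex y)"
  by (simp add: to_complex_def inner_vec_def sum_2)

lemma to_complex_rotation2: "to_complex (rotation2 \<theta> *v x) = cis \<theta> * to_complex x"
  by (simp add: to_complex_def rotation2_def matrix_vector_mult_def sum_2 complex_eq_iff)

definition skew :: "real \<Rightarrow> real^2^2" where
  "skew s = vector [vector [0, - s], vector [s, 0]]"

lemma transpose_skew: "transpose (skew s) = - skew s"
  by (simp add: skew_def transpose_def vec_eq_iff forall_2)

lemma to_complex_skew: "to_complex (skew s *v x) = \<i> * of_real s * to_complex x"
  by (simp add: to_complex_def skew_def matrix_vector_mult_def sum_2 complex_eq_iff)

lemma skew_matrix:
  assumes "transpose (M :: real^2^2) = - M"
  shows "M = skew (M $ 2 $ 1)"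
proof -
  have "transpose M $ i $ j = - M $ i $ j" for i j using assms by simp
  from this[of 1 1] this[of 2 2] this[of 1 2] show ?thesis
    by (simp add: skew_def transpose_def vec_eq_iff forall_2)
qed

lemma trivial_motion_iff:
  "trivial_motion V p m \<longleftrightarrow>
     (\<exists>s t. \<forall>v\<in>V. to_complex (m v) = \<i> * of_real s * to_complex (p v) + t)"
proof
  assume "trivial_motion V p m"
  then obtain M t where M: "transpose M = - M" "\<forall>v\<in>V. m v = M *v p v + t"
    unfolding trivial_motion_def by blast
  then obtain s where "M = skew s" using skew_matrix by blast
  then have "\<forall>v\<in>V. to_complex (m v) = \<i> * of_real s * to_complex (p v) + to_complex t"
    using M(2) by (simp add: to_complex_skew)
  then show "\<exists>s t. \<forall>v\<in>V. to_complex (m v) = \<i> * of_real s * to_complex (p v) + t" by blast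
next
  assume "\<exists>s t. \<forall>v\<in>V. to_complex (m v) = \<i> * of_real s * to_complex (p v) + t"
  then obtain s t where st: "\<forall>v\<in>V. to_complex (m v) = \<i> * of_real s * to_complex (p v) + t" by blast
  have "m v = skew s *v p v + of_complex t" if "v \<in> V" for v
  proof -
    have "to_complex (m v) = to_complex (skew s *v p v + of_complex t)"
      using st that by (simp add: to_complex_skew)
    then show ?thesis by (simp only: to_complex_inject)
  qed
  then show "trivial_motion V p m" unfolding trivial_motion_def using transpose_skew by blast
qed

text \<open>Twice the inner product is written as a sum of the shape of \<open>row\<close> with
  \<open>b = cnj a\<close>; dropping this relation between \<open>a\<close> and \<open>b\<close> is
  the complexification.\<close>

lemma infinitesimal_motion_iff:
  "infinitesimal_motion E p m \<longleftrightarrow>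
     (\<forall>u v. {u, v} \<in> E \<longrightarrow>
        cnj (to_complex (p u) - to_complex (p v)) * (to_complex (m u) - to_complex (m v)) +
        (to_complex (p u) - to_complex (p v)) * cnj (to_complex (m u) - to_complex (m v)) = 0)"
proof -
  have "x \<bullet> y = 0 \<longleftrightarrow> cnj (to_complex x) * to_complex y + to_complex x * cnj (to_complex y) = 0" for x y
  proof -
    have "cnj (to_complex x) * to_complex y + to_complex x * cnj (to_complex y) =
        complex_of_real (2 * Re (cnj (to_complex x) * to_complex y))" by (simp add: complex_eq_iff)
    then show ?thesis unfolding inner_to_complex by (simp only: of_real_eq_0_iff mult_eq_0_iff) simp
  qed
  then show ?thesis by (simp add: infinitesimal_motion_def)
qed

section \<open>The setting with three-fold symmetry\<close>

locale c3_graph =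
  fixes \<Gamma> :: "'g monoid" and \<gamma> :: 'g and V :: "'v set" and E :: "'v set set"
    and \<phi> :: "'g \<Rightarrow> 'v \<Rightarrow> 'v" and \<tau> :: "'g \<Rightarrow> real^2^2" and rep :: "'v set \<Rightarrow> 'v"
    and G :: "('v set, 'v set set) pre_digraph" and \<psi> :: "'v set set \<Rightarrow> 'g"
  assumes is_group: "group \<Gamma>" and gen: "\<gamma> \<in> carrier \<Gamma>" "carrier \<Gamma> = generate \<Gamma> {\<gamma>}"
    and order3: "card (carrier \<Gamma>) = 3" and act: "graph_action \<Gamma> \<phi> V E"
    and c3: "C3_representation \<Gamma> \<gamma> \<tau>" and simple: "simple_graph V E"
    and quot: "quotient_gain_graph \<Gamma> \<phi> V E rep G \<psi>"
    and few_fixed: "card (fixed_orbits \<Gamma> \<phi> V) \<le> 1"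
begin

sublocale group \<Gamma> by (rule is_group)

sublocale act: group_action \<Gamma> V \<phi> using act by (simp add: graph_action_def)

text \<open>The number by which \<open>\<tau> g\<close> multiplies every point of the complex plane,
  read off at the point 1.\<close>

definition character :: "'g \<Rightarrow> complex" where
  "character g = to_complex (\<tau> g *v of_complex 1)"

lemma tau_mult: "g \<in> carrier \<Gamma> \<Longrightarrow> h \<in> carrier \<Gamma> \<Longrightarrow> \<tau> (g \<otimes>\<^bsub>\<Gamma>\<^esub> h) *v x = \<tau> g *v (\<tau> h *v x)"
  using c3 by (simp add: C3_representation_def matrix_vector_mul_assoc)

lemma tau_gamma: "to_complex (\<tau> \<gamma> *v x) = cis (2 * pi / 3) * to_complex x"
  using c3 by (simp add: C3_representation_def to_complex_rotation2)

lemma cis_cube: "cis (2 * pi / 3) ^ 3 = 1" "cis (2 * pi / 3) \<noteq> 1"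
proof -
  show "cis (2 * pi / 3) ^ 3 = 1" using Complex.DeMoivre[of "2 * pi / 3" 3] by simp
  show "cis (2 * pi / 3) \<noteq> 1"
  proof
    assume "cis (2 * pi / 3) = 1"
    then have "Re (cis (2 * pi / 3)) = Re 1" by (rule arg_cong)
    then show False by (simp add: cos_120)
  qed
qed

text \<open>Only \<open>\<tau> \<gamma>\<close> is prescribed. The other values follow by induction
  over the generated group, where the identity and the inverse are obtained by cancelling the
  rotation \<open>\<tau> \<gamma>\<close>.\<close>

lemma tau_complex:
  assumes "g \<in> carrier \<Gamma>"
  shows "\<exists>c. c ^ 3 = 1 \<and> (\<forall>x. to_complex (\<tau> g *v x) = c * to_complex x)"
proof -
  have w0: "cis (2 * pi / 3) \<noteq> 0" by simp
  have one: "to_complex (\<tau> \<one>\<^bsub>\<Gamma>\<^esub> *v x) = to_complex x" for x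
  proof -
    have "to_complex (\<tau> \<gamma> *v x) = to_complex (\<tau> \<gamma> *v (\<tau> \<one>\<^bsub>\<Gamma>\<^esub> *v x))"
      using tau_mult[of \<gamma> "\<one>\<^bsub>\<Gamma>\<^esub>" x] gen(1) by simp
    then show ?thesis unfolding tau_gamma using w0 by simp
  qed
  from assms have "g \<in> generate \<Gamma> {\<gamma>}" using gen by simp
  then show ?thesis
  proof (induction rule: generate.induct)
    case one
    show ?case using \<open>\<And>x. to_complex (\<tau> \<one>\<^bsub>\<Gamma>\<^esub> *v x) = to_complex x\<close> by (intro exI[of _ 1]) simp
  next
    case (incl h)
    then show ?case using tau_gamma cis_cube by auto
  next
    case (inv h)
    then have h: "h = \<gamma>" by simp
    have "cis (2 * pi / 3) * to_complex (\<tau> (inv\<^bsub>\<Gamma>\<^esub> \<gamma>) *v x) = to_complex x" for x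
    proof -
      have "to_complex (\<tau> \<gamma> *v (\<tau> (inv\<^bsub>\<Gamma>\<^esub> \<gamma>) *v x)) = to_complex x"
        using tau_mult[of \<gamma> "inv\<^bsub>\<Gamma>\<^esub> \<gamma>" x] gen(1) one by simp
      then show ?thesis unfolding tau_gamma .
    qed
    then have "to_complex (\<tau> (inv\<^bsub>\<Gamma>\<^esub> \<gamma>) *v x) = inverse (cis (2 * pi / 3)) * to_complex x" for x
      using w0 by (metis left_inverse mult.assoc mult_1)
    then show ?case using cis_cube unfolding h
      by (intro exI[of _ "inverse (cis (2 * pi / 3))"]) (simp add: power_inverse del: cis_inverse)
  next
    case (eng g h)
    then obtain c d where cd: "c ^ 3 = 1" "\<And>x. to_complex (\<tau> g *v x) = c * to_complex x"
      "d ^ 3 = 1" "\<And>x. to_complex (\<tau> h *v x) = d * to_complex x" by blast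
    have "g \<in> carrier \<Gamma>" "h \<in> carrier \<Gamma>" using eng gen by auto
    then show ?case using cd by (intro exI[of _ "c * d"]) (simp add: tau_mult power_mult_distrib)
  qed
qed

lemma tau_character: "g \<in> carrier \<Gamma> \<Longrightarrow> to_complex (\<tau> g *v x) = character g * to_complex x"
  using tau_complex[of g] by (auto simp: character_def)

lemma character_cube: "g \<in> carrier \<Gamma> \<Longrightarrow> character g ^ 3 = 1"
  using tau_complex[of g] by (auto simp: character_def)

lemma character_mult:
  "g \<in> carrier \<Gamma> \<Longrightarrow> h \<in> carrier \<Gamma> \<Longrightarrow> character (g \<otimes>\<^bsub>\<Gamma>\<^esub> h) = character g * character h"
  unfolding character_def[of "g \<otimes>\<^bsub>\<Gamma>\<^esub> h"] by (simp add: tau_mult tau_character)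

lemma character_inj: "inj_on character (carrier \<Gamma>)"
proof (rule inj_onI)
  fix g h assume gh: "g \<in> carrier \<Gamma>" "h \<in> carrier \<Gamma>" "character g = character h"
  have "\<tau> g *v x = \<tau> h *v x" for x
    using tau_character[OF gh(1), of x] tau_character[OF gh(2), of x] gh(3) by (metis to_complex_inject)
  then have "\<tau> g = \<tau> h" by (simp add: matrix_eq)
  then show "g = h" using c3 gh by (auto simp: C3_representation_def inj_on_def)
qed

lemma character_nonzero: "g \<in> carrier \<Gamma> \<Longrightarrow> character g \<noteq> 0"
  using character_cube[of g] by auto

lemma character_one: "character \<one>\<^bsub>\<Gamma>\<^esub> = 1"
proof -
  have "character \<one>\<^bsub>\<Gamma>\<^esub> * character \<one>\<^bsub>\<Gamma>\<^esub> = character \<one>\<^bsub>\<Gamma>\<^esub>"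
    using character_mult[of "\<one>\<^bsub>\<Gamma>\<^esub>" "\<one>\<^bsub>\<Gamma>\<^esub>"] by simp
  then show ?thesis using character_nonzero[of "\<one>\<^bsub>\<Gamma>\<^esub>"] by simp
qed

lemma character_eq_one: "g \<in> carrier \<Gamma> \<Longrightarrow> character g = 1 \<longleftrightarrow> g = \<one>\<^bsub>\<Gamma>\<^esub>"
  using character_inj character_one by (metis inj_onD one_closed)

lemma character_gamma: "character \<gamma> = cis (2 * pi / 3)"
  by (simp add: character_def tau_gamma)

lemma finite_carrier: "finite (carrier \<Gamma>)"
  using order3 by (metis card.infinite zero_neq_numeral)

lemma sum_translate:
  assumes "h \<in> carrier \<Gamma>"
  shows "(\<Sum>g\<in>carrier \<Gamma>. f (g \<otimes>\<^bsub>\<Gamma>\<^esub> h)) = (\<Sum>g\<in>carrier \<Gamma>. f g)"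
proof (rule sum.reindex_bij_witness[of _ "\<lambda>g. g \<otimes>\<^bsub>\<Gamma>\<^esub> inv\<^bsub>\<Gamma>\<^esub> h" "\<lambda>g. g \<otimes>\<^bsub>\<Gamma>\<^esub> h"])
qed (use assms in \<open>simp_all add: m_assoc\<close>)

text \<open>Translation by \<open>\<gamma>\<close> permutes the group and multiplies the sum by a
  nontrivial root of unity.\<close>

lemma character_sums:
  "(\<Sum>g\<in>carrier \<Gamma>. character g) = 0" "(\<Sum>g\<in>carrier \<Gamma>. character g ^ 2) = 0"
proof -
  define w where "w = cis (2 * pi / 3)"
  have w: "w ^ 3 = 1" "w \<noteq> 1" using cis_cube by (auto simp: w_def)
  have tr: "character (g \<otimes>\<^bsub>\<Gamma>\<^esub> \<gamma>) = character g * w" if "g \<in> carrier \<Gamma>" for g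
    using that gen character_mult character_gamma by (simp add: w_def)
  have eq: "(\<Sum>g\<in>carrier \<Gamma>. character g) = (\<Sum>g\<in>carrier \<Gamma>. character g) * w"
    using sum_translate[OF gen(1), of character] tr by (simp add: sum_distrib_right)
  then have "(\<Sum>g\<in>carrier \<Gamma>. character g) * (1 - w) = 0"
    by (simp only: right_diff_distrib mult_1_right eq[symmetric] diff_self)
  then show "(\<Sum>g\<in>carrier \<Gamma>. character g) = 0" using w by simp
  have eq2: "(\<Sum>g\<in>carrier \<Gamma>. character g ^ 2) = (\<Sum>g\<in>carrier \<Gamma>. character g ^ 2) * w ^ 2"
    using sum_translate[OF gen(1), of "\<lambda>g. character g ^ 2"] tr
    by (simp add: power_mult_distrib sum_distrib_right)
  then have "(\<Sum>g\<in>carrier \<Gamma>. character g ^ 2) * (1 - w ^ 2) = 0"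
    by (simp only: right_diff_distrib mult_1_right eq2[symmetric] diff_self)
  moreover have "w ^ 2 \<noteq> 1"
  proof
    assume "w ^ 2 = 1"
    then show False using w by (simp add: power3_eq_cube power2_eq_square)
  qed
  ultimately show "(\<Sum>g\<in>carrier \<Gamma>. character g ^ 2) = 0" by simp
qed

lemma carrier_powers:
  assumes "g \<in> carrier \<Gamma>" "g \<noteq> \<one>\<^bsub>\<Gamma>\<^esub>"
  shows "carrier \<Gamma> = {\<one>\<^bsub>\<Gamma>\<^esub>, g, g \<otimes>\<^bsub>\<Gamma>\<^esub> g}"
proof -
  have c: "character g ^ 3 = 1" "character g \<noteq> 1" using assms character_cube character_eq_one by auto
  have gg: "g \<otimes>\<^bsub>\<Gamma>\<^esub> g \<in> carrier \<Gamma>" using assms by simp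
  have "character (g \<otimes>\<^bsub>\<Gamma>\<^esub> g) = character g ^ 2" using assms character_mult by (simp add: power2_eq_square)
  moreover have "character g ^ 2 \<noteq> 1" using c by (auto simp: power3_eq_cube power2_eq_square)
  moreover have "character g ^ 2 \<noteq> character g" using c character_nonzero[OF assms(1)] by (auto simp: power2_eq_square)
  ultimately have "g \<otimes>\<^bsub>\<Gamma>\<^esub> g \<noteq> \<one>\<^bsub>\<Gamma>\<^esub>" "g \<otimes>\<^bsub>\<Gamma>\<^esub> g \<noteq> g" using character_one by auto
  then have "card {\<one>\<^bsub>\<Gamma>\<^esub>, g, g \<otimes>\<^bsub>\<Gamma>\<^esub> g} = 3" using assms by auto
  then show ?thesis
    using card_subset_eq[OF finite_carrier, of "{\<one>\<^bsub>\<Gamma>\<^esub>, g, g \<otimes>\<^bsub>\<Gamma>\<^esub> g}"] order3 assms gg by simp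
qed

section \<open>The action on vertices and edges\<close>

lemma phi_in: "g \<in> carrier \<Gamma> \<Longrightarrow> v \<in> V \<Longrightarrow> \<phi> g v \<in> V"
  using act.element_image by blast

lemma phi_mult: "g \<in> carrier \<Gamma> \<Longrightarrow> h \<in> carrier \<Gamma> \<Longrightarrow> v \<in> V \<Longrightarrow> \<phi> (g \<otimes>\<^bsub>\<Gamma>\<^esub> h) v = \<phi> g (\<phi> h v)"
  using act.composition_rule by blast

lemma phi_one: "v \<in> V \<Longrightarrow> \<phi> \<one>\<^bsub>\<Gamma>\<^esub> v = v"
  using act.id_eq_one by (metis restrict_apply')

lemma phi_inv: "g \<in> carrier \<Gamma> \<Longrightarrow> v \<in> V \<Longrightarrow> \<phi> (inv\<^bsub>\<Gamma>\<^esub> g) (\<phi> g v) = v"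
  using phi_mult[of "inv\<^bsub>\<Gamma>\<^esub> g" g v] phi_one by simp

text \<open>The order 3 is prime: a single nontrivial element of the stabilizer generates the
  group.\<close>

lemma stabilizer_cases:
  assumes "v \<in> V"
  shows "stabilizer \<Gamma> \<phi> v = carrier \<Gamma> \<or> stabilizer \<Gamma> \<phi> v = {\<one>\<^bsub>\<Gamma>\<^esub>}"
proof (cases "\<exists>g\<in>carrier \<Gamma>. g \<noteq> \<one>\<^bsub>\<Gamma>\<^esub> \<and> \<phi> g v = v")
  case True
  then obtain g where g: "g \<in> carrier \<Gamma>" "g \<noteq> \<one>\<^bsub>\<Gamma>\<^esub>" "\<phi> g v = v" by blast
  have "\<phi> h v = v" if "h \<in> carrier \<Gamma>" for h
    using that carrier_powers[OF g(1,2)] phi_one[OF assms] phi_mult[OF g(1,1) assms] g(3) by auto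
  then show ?thesis by (auto simp: stabilizer_def)
next
  case False
  then show ?thesis using phi_one[OF assms] by (auto simp: stabilizer_def)
qed

abbreviation "orb \<equiv> Group_Action.orbit \<Gamma> \<phi>"

lemma orb_in: "v \<in> V \<Longrightarrow> orb v \<in> orbits \<Gamma> V \<phi>"
  by (auto simp: orbits_def)

lemma in_orb: "v \<in> V \<Longrightarrow> v \<in> orb v"
  by (rule act.orbit_refl)

lemma orb_eq:
  assumes "v \<in> V" "u \<in> orb v"
  shows "orb u = orb v" "u \<in> V"
proof -
  obtain g where "g \<in> carrier \<Gamma>" "u = \<phi> g v" using assms by (auto simp: Group_Action.orbit_def)
  then show u: "u \<in> V" using phi_in assms by simp
  then show "orb u = orb v"
    using act.disjoint_union[OF orb_in[OF u] orb_in[OF assms(1)]] in_orb[OF u] assms by blast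
qed

lemma verts_eq: "verts G = orbits \<Gamma> V \<phi>"
  and arcs_eq: "arcs G = orbits \<Gamma> E (\<lambda>g e. \<phi> g ` e)"
  using quot by (auto simp: quotient_gain_graph_def)

lemma rep_in: "x \<in> verts G \<Longrightarrow> rep x \<in> x" "x \<in> verts G \<Longrightarrow> rep x \<in> V" "x \<in> verts G \<Longrightarrow> orb (rep x) = x"
proof -
  show *: "rep x \<in> x" if "x \<in> verts G" using that quot by (auto simp: quotient_gain_graph_def)
  assume x: "x \<in> verts G"
  then obtain v where v: "v \<in> V" "x = orb v" by (auto simp: verts_eq orbits_def)
  then show "rep x \<in> V" "orb (rep x) = x" using orb_eq[of v "rep x"] *[OF x] by auto
qed

lemma orb_vert: "v \<in> V \<Longrightarrow> orb v \<in> verts G"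
  by (simp add: verts_eq orb_in)

lemma finite_V: "finite V" using simple by (simp add: simple_graph_def)

lemma finite_E: "finite E"
  using simple finite_subset[of E "Pow V"] by (auto simp: simple_graph_def)

lemma finite_verts: "finite (verts G)"
  using finite_V by (simp add: verts_eq orbits_def setcompr_eq_image)

lemma finite_arcs: "finite (arcs G)"
  using finite_E by (simp add: arcs_eq orbits_def setcompr_eq_image)

lemma edge_verts: "{u, v} \<in> E \<Longrightarrow> u \<in> V \<and> v \<in> V \<and> u \<noteq> v"
  using simple by (auto simp: simple_graph_def card_insert_if split: if_splits)

lemma phi_edge: "g \<in> carrier \<Gamma> \<Longrightarrow> {u, v} \<in> E \<Longrightarrow> {\<phi> g u, \<phi> g v} \<in> E"
  using act by (force simp: graph_action_def)

definition fixed :: "'v \<Rightarrow> bool" where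
  "fixed v \<longleftrightarrow> (\<forall>g\<in>carrier \<Gamma>. \<phi> g v = v)"

lemma not_fixed: "v \<in> V \<Longrightarrow> \<not> fixed v \<Longrightarrow> g \<in> carrier \<Gamma> \<Longrightarrow> \<phi> g v = v \<Longrightarrow> g = \<one>\<^bsub>\<Gamma>\<^esub>"
  using stabilizer_cases[of v] by (auto simp: fixed_def stabilizer_def)

lemma fixed_orb: "v \<in> V \<Longrightarrow> fixed v \<Longrightarrow> orb v = {v}"
  using in_orb by (auto simp: fixed_def Group_Action.orbit_def)

lemma fixed_rep: "x \<in> verts G \<Longrightarrow> v \<in> x \<Longrightarrow> fixed v \<Longrightarrow> v = rep x"
  using rep_in[of x] orb_eq[of "rep x" v] fixed_orb[of v] by auto

lemma fixed_orbits_eq: "fixed_orbits \<Gamma> \<phi> V = {x \<in> verts G. fixed (rep x)}"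
proof -
  have st: "stabilizer \<Gamma> \<phi> v = carrier \<Gamma> \<longleftrightarrow> fixed v" for v
    by (auto simp: stabilizer_def fixed_def)
  have "fixed (rep (orb v))" if "v \<in> V" "fixed v" for v
    using fixed_rep[OF orb_vert[OF that(1)] in_orb[OF that(1)] that(2)] that by simp
  then show ?thesis
    unfolding fixed_orbits_def st using orb_vert rep_in by fastforce
qed

lemma free_orbits_eq: "free_orbits \<Gamma> \<phi> V = verts G - fixed_orbits \<Gamma> \<phi> V"
proof -
  have ne: "{\<one>\<^bsub>\<Gamma>\<^esub>} \<noteq> carrier \<Gamma>" using order3 by (metis card_1_singleton_iff One_nat_def numeral_eq_one_iff semiring_norm(86))
  have st: "stabilizer \<Gamma> \<phi> v = {\<one>\<^bsub>\<Gamma>\<^esub>} \<longleftrightarrow> \<not> fixed v" if "v \<in> V" for v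
    using stabilizer_cases[OF that] ne by (auto simp: stabilizer_def fixed_def)
  have fo: "fixed (rep (orb v)) \<longleftrightarrow> fixed v" if "v \<in> V" for v
  proof
    assume "fixed (rep (orb v))"
    then have "orb v = {rep (orb v)}" using fixed_orb rep_in orb_vert[OF that] by metis
    then show "fixed v" using in_orb[OF that] \<open>fixed (rep (orb v))\<close> by (metis singletonD)
  next
    assume "fixed v"
    then show "fixed (rep (orb v))" using fixed_rep[OF orb_vert[OF that] in_orb[OF that]] by simp
  qed
  show ?thesis
  proof
    show "free_orbits \<Gamma> \<phi> V \<subseteq> verts G - fixed_orbits \<Gamma> \<phi> V"
      unfolding free_orbits_def fixed_orbits_eq using st fo orb_vert by auto
    show "verts G - fixed_orbits \<Gamma> \<phi> V \<subseteq> free_orbits \<Gamma> \<phi> V"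
    proof
      fix x assume "x \<in> verts G - fixed_orbits \<Gamma> \<phi> V"
      then have "x \<in> verts G" "\<not> fixed (rep x)" by (auto simp: fixed_orbits_eq)
      then show "x \<in> free_orbits \<Gamma> \<phi> V"
        unfolding free_orbits_def using rep_in(2,3)[of x] st by (intro CollectI exI[of _ "rep x"]) auto
    qed
  qed
qed

text \<open>The empty set is not an orbit, so it serves as \<open>q0\<close> if there is no fixed vertex.\<close>

definition q0 :: "'v set" where
  "q0 = (if fixed_orbits \<Gamma> \<phi> V = {} then {} else the_elem (fixed_orbits \<Gamma> \<phi> V))"

lemma fixed_iff_q0: "x \<in> verts G \<Longrightarrow> fixed (rep x) \<longleftrightarrow> x = q0"
proof -
  assume x: "x \<in> verts G"
  have fin: "finite (fixed_orbits \<Gamma> \<phi> V)" using finite_verts by (simp add: fixed_orbits_eq)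
  show ?thesis
  proof (cases "fixed_orbits \<Gamma> \<phi> V = {}")
    case True
    then have "x \<noteq> q0" using rep_in(1)[OF x] by (auto simp: q0_def)
    then show ?thesis using True x by (auto simp: fixed_orbits_eq)
  next
    case False
    then have "card (fixed_orbits \<Gamma> \<phi> V) = 1" using few_fixed fin by (metis card_0_eq le_antisym less_one not_le)
    then obtain y where y: "fixed_orbits \<Gamma> \<phi> V = {y}" by (rule card_1_singletonE)
    then have "q0 = y" by (simp add: q0_def)
    moreover have "x \<in> fixed_orbits \<Gamma> \<phi> V \<longleftrightarrow> fixed (rep x)" using x by (simp add: fixed_orbits_eq)
    ultimately show ?thesis using y by auto
  qed
qed

lemma fixed_orbits_q0: "fixed_orbits \<Gamma> \<phi> V = verts G \<inter> {q0}"
  using fixed_iff_q0 by (auto simp: fixed_orbits_eq)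

lemma free_orbits_q0: "free_orbits \<Gamma> \<phi> V = verts G - {q0}"
  by (auto simp: free_orbits_eq fixed_orbits_q0)

text \<open>The definition of the gain graph provides the edge of the fourth claim only if both ends
  are free. If one end is fixed, the group moves any edge of the orbit until its other end is the
  required lift, so every gain is correct.\<close>

lemma arc_edge:
  assumes "e \<in> arcs G"
  shows "tail G e \<in> verts G" "head G e \<in> verts G" "\<psi> e \<in> carrier \<Gamma>"
    "{rep (tail G e), \<phi> (\<psi> e) (rep (head G e))} \<in> e" "e \<subseteq> E"
proof -
  obtain d where d: "d \<in> E" "e = {\<phi> g ` d | g. g \<in> carrier \<Gamma>}"
    using assms by (auto simp: arcs_eq orbits_def Group_Action.orbit_def)
  show sub: "e \<subseteq> E" using d act by (auto simp: graph_action_def)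
  have "\<forall>e\<in>arcs G. \<exists>u v. {u, v} \<in> e \<and> tail G e = orb u \<and> head G e = orb v"
    using quot unfolding quotient_gain_graph_def by (elim conjE)
  then obtain u v where uv: "{u, v} \<in> e" "tail G e = orb u" "head G e = orb v"
    using assms by blast
  have uvE: "u \<in> V" "v \<in> V" "u \<noteq> v" using edge_verts sub uv by blast+
  show t: "tail G e \<in> verts G" and h: "head G e \<in> verts G" using uv uvE orb_vert by auto
  have gains: "\<forall>e\<in>arcs G. \<psi> e \<in> carrier \<Gamma> \<and>
        (tail G e \<in> free_orbits \<Gamma> \<phi> V \<and> head G e \<in> free_orbits \<Gamma> \<phi> V \<longrightarrow>
          {rep (tail G e), \<phi> (\<psi> e) (rep (head G e))} \<in> e)"
    using quot unfolding quotient_gain_graph_def by (elim conjE)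
  then show g: "\<psi> e \<in> carrier \<Gamma>" using assms by simp
  have closed: "{\<phi> g a, \<phi> g b} \<in> e" if ab: "{a, b} \<in> e" and gc: "g \<in> carrier \<Gamma>" for a b g
  proof -
    obtain h where h: "h \<in> carrier \<Gamma>" "{a, b} = \<phi> h ` d" using ab d by auto
    have "d \<subseteq> V" using simple d by (auto simp: simple_graph_def)
    then have "\<phi> (g \<otimes>\<^bsub>\<Gamma>\<^esub> h) ` d = \<phi> g ` \<phi> h ` d"
      using phi_mult[OF gc h(1)] by (auto simp: image_image intro!: image_cong)
    also have "\<dots> = {\<phi> g a, \<phi> g b}" unfolding h(2)[symmetric] by simp
    finally show ?thesis using d(2) gc h by auto
  qed
  show "{rep (tail G e), \<phi> (\<psi> e) (rep (head G e))} \<in> e"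
  proof (cases "fixed (rep (tail G e)) \<or> fixed (rep (head G e))")
    case False
    then have "tail G e \<in> free_orbits \<Gamma> \<phi> V" "head G e \<in> free_orbits \<Gamma> \<phi> V"
      using t h by (auto simp: free_orbits_eq fixed_orbits_eq)
    then show ?thesis using gains assms by simp
  next
    case True
    then show ?thesis
    proof
      assume f: "fixed (rep (tail G e))"
      then have ru: "u = rep (tail G e)"
        using fixed_orb[OF rep_in(2)[OF t] f] rep_in(3)[OF t] uv(2) in_orb[OF uvE(1)] by auto
      obtain k where k: "k \<in> carrier \<Gamma>" "rep (head G e) = \<phi> k v"
        using rep_in(1)[OF h] uv(3) by (auto simp: Group_Action.orbit_def)
      have "\<phi> (\<psi> e) (rep (head G e)) = \<phi> (\<psi> e \<otimes>\<^bsub>\<Gamma>\<^esub> k) v" using phi_mult[OF g k(1) uvE(2)] k(2) by simp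
      moreover have "\<phi> (\<psi> e \<otimes>\<^bsub>\<Gamma>\<^esub> k) u = u" using f ru g k(1) by (simp add: fixed_def)
      ultimately show ?thesis using closed[OF uv(1), of "\<psi> e \<otimes>\<^bsub>\<Gamma>\<^esub> k"] g k(1) ru by simp
    next
      assume f: "fixed (rep (head G e))"
      then have rv: "v = rep (head G e)"
        using fixed_orb[OF rep_in(2)[OF h] f] rep_in(3)[OF h] uv(3) in_orb[OF uvE(2)] by auto
      obtain k where k: "k \<in> carrier \<Gamma>" "rep (tail G e) = \<phi> k u"
        using rep_in(1)[OF t] uv(2) by (auto simp: Group_Action.orbit_def)
      have "\<phi> k v = v" "\<phi> (\<psi> e) v = v" using f rv g k(1) by (simp_all add: fixed_def)
      then show ?thesis using closed[OF uv(1) k(1)] k(2) rv by simp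
    qed
  qed
qed

definition gain_edge_of :: "'v set set \<Rightarrow> 'v set gain_edge" where
  "gain_edge_of e = (tail G e, head G e, character (\<psi> e))"

lemma arc_eqI:
  assumes "e \<in> arcs G" "e' \<in> arcs G" "e \<inter> e' \<noteq> {}"
  shows "e = e'"
proof -
  have img: "\<phi> (g \<otimes>\<^bsub>\<Gamma>\<^esub> h) ` d = \<phi> g ` \<phi> h ` d" if "g \<in> carrier \<Gamma>" "h \<in> carrier \<Gamma>" "d \<in> E" for g h d
  proof -
    have "d \<subseteq> V" using simple that by (auto simp: simple_graph_def)
    then show ?thesis using phi_mult[OF that(1,2)] by (auto simp: image_image intro!: image_cong)
  qed
  have sub: "e \<subseteq> e'" if arcs: "e \<in> arcs G" "e' \<in> arcs G" and c: "c \<in> e" "c \<in> e'" for e e' c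
  proof
    fix b assume b: "b \<in> e"
    obtain d where d: "d \<in> E" "e = {\<phi> g ` d | g. g \<in> carrier \<Gamma>}"
      using arcs(1) by (auto simp: arcs_eq orbits_def Group_Action.orbit_def)
    obtain d' where d': "d' \<in> E" "e' = {\<phi> g ` d' | g. g \<in> carrier \<Gamma>}"
      using arcs(2) by (auto simp: arcs_eq orbits_def Group_Action.orbit_def)
    obtain h where h: "h \<in> carrier \<Gamma>" "c = \<phi> h ` d" using c(1) d(2) by blast
    obtain h' where h': "h' \<in> carrier \<Gamma>" "c = \<phi> h' ` d'" using c(2) d'(2) by blast
    obtain g where g: "g \<in> carrier \<Gamma>" "b = \<phi> g ` d" using b d(2) by blast
    have "d \<subseteq> V" using simple d by (auto simp: simple_graph_def)
    then have "d = \<phi> (inv\<^bsub>\<Gamma>\<^esub> h) ` \<phi> h ` d" using phi_inv[OF h(1)] by (force simp: image_image)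
    also have "\<phi> h ` d = \<phi> h' ` d'" using h h' by simp
    finally have "d = \<phi> (inv\<^bsub>\<Gamma>\<^esub> h \<otimes>\<^bsub>\<Gamma>\<^esub> h') ` d'"
      using img[of "inv\<^bsub>\<Gamma>\<^esub> h" h' d'] h(1) h'(1) d'(1) by simp
    then have "b = \<phi> g ` \<phi> (inv\<^bsub>\<Gamma>\<^esub> h \<otimes>\<^bsub>\<Gamma>\<^esub> h') ` d'" using g(2) by simp
    also have "\<dots> = \<phi> (g \<otimes>\<^bsub>\<Gamma>\<^esub> (inv\<^bsub>\<Gamma>\<^esub> h \<otimes>\<^bsub>\<Gamma>\<^esub> h')) ` d'"
      using img[of g "inv\<^bsub>\<Gamma>\<^esub> h \<otimes>\<^bsub>\<Gamma>\<^esub> h'" d'] h(1) h'(1) g(1) d'(1) by simp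
    finally show "b \<in> e'" using g(1) h(1) h'(1) d'(2) by blast
  qed
  from assms(3) obtain c where "c \<in> e" "c \<in> e'" by blast
  then show ?thesis using sub[OF assms(1,2)] sub[OF assms(2,1)] by blast
qed

text \<open>By \<open>arc_edge\<close> the triple determines one edge of the orbit, and orbits that
  share an edge coincide. So nothing is lost in passing from arcs to sets of triples, not even for
  parallel arcs.\<close>

lemma gain_edge_inj: "inj_on gain_edge_of (arcs G)"
proof (rule inj_onI)
  fix e e' assume e: "e \<in> arcs G" "e' \<in> arcs G" "gain_edge_of e = gain_edge_of e'"
  then have "tail G e = tail G e'" "head G e = head G e'" "\<psi> e = \<psi> e'"
    using arc_edge(3) character_inj by (auto simp: gain_edge_of_def inj_on_def)
  then show "e = e'" using arc_edge(4)[OF e(1)] arc_edge(4)[OF e(2)] arc_eqI[OF e(1,2)] by auto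
qed

text \<open>A loop with identity gain, or at the fixed vertex, would come from an edge whose two
  ends coincide.\<close>

lemma gain_edge_valid:
  assumes "e \<in> arcs G"
  shows "valid_edge q0 (gain_edge_of e)"
proof -
  note a = arc_edge[OF assms]
  have "{rep (tail G e), \<phi> (\<psi> e) (rep (head G e))} \<in> E" using a by blast
  then have neq: "rep (tail G e) \<noteq> \<phi> (\<psi> e) (rep (head G e))" using edge_verts by blast
  have "character (\<psi> e) \<noteq> 1 \<and> tail G e \<noteq> q0" if "tail G e = head G e"
  proof
    show "character (\<psi> e) \<noteq> 1"
      using neq that character_eq_one[OF a(3)] phi_one[OF rep_in(2)[OF a(2)]] by auto
    show "tail G e \<noteq> q0"
      using neq that fixed_iff_q0[OF a(1)] a(3) by (auto simp: fixed_def)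
  qed
  then show ?thesis using character_cube[OF a(3)] by (auto simp: valid_edge_def gain_edge_of_def)
qed

lemma wf_G: "wf_digraph G"
  using arc_edge by (auto simp: wf_digraph_def)

end

lemma separated_subset: "separated q0 U z \<Longrightarrow> U' \<subseteq> U \<Longrightarrow> separated q0 U' z"
  unfolding separated_def by blast

section \<open>Passing between subgraphs and sets of gain edges\<close>

context c3_graph
begin

abbreviation "V0 \<equiv> fixed_orbits \<Gamma> \<phi> V"
abbreviation "V1 \<equiv> free_orbits \<Gamma> \<phi> V"

lemma verts_of_gain_edges: "verts_of (gain_edge_of ` A) = tail G ` A \<union> head G ` A"
  by (auto simp: verts_of_def gain_edge_of_def)

text \<open>The counts are applied to the subgraph \<open>H'\<close> formed by the edges of
  \<open>F\<close> and their ends. A potential makes the gain of every closed walk away from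
  \<open>V0\<close> trivial, so \<open>H'\<close> is then balanced.\<close>

lemma sparse_counts:
  assumes H: "subgraph H G" and sparse: "gain_sparse \<Gamma> V0 V1 (of_bool m) 1 H \<psi>"
    and F: "F \<subseteq> gain_edge_of ` arcs H" "F \<noteq> {}"
  shows "potential q0 \<theta> F \<Longrightarrow> 3 \<le> excess (verts_of F) F"
    and "int (card F) \<le> 2 * int (card (verts_of F - {q0})) + of_bool (m \<and> q0 \<in> verts_of F) - 1"
proof -
  define A where "A = {e\<in>arcs H. gain_edge_of e \<in> F}"
  define H' where "H' = \<lparr>verts = verts_of F, arcs = A, tail = tail G, head = head G\<rparr>"
  have arcs: "arcs H \<subseteq> arcs G" and wfH: "wf_digraph H" and same: "tail H = tail G" "head H = head G"
    using H by (auto simp: subgraph_def compatible_def)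
  have A: "A \<subseteq> arcs H" "A \<subseteq> arcs G" using arcs by (auto simp: A_def)
  have FA: "F = gain_edge_of ` A" using F by (auto simp: A_def)
  have cardA: "card A = card F"
    unfolding FA using gain_edge_inj A by (metis card_image inj_on_subset)
  have VF: "verts_of F \<subseteq> verts H" "verts_of F \<subseteq> verts G"
    using wfH A same arc_edge(1,2) unfolding FA verts_of_gain_edges
    by (auto simp: wf_digraph_def) 
  have ends: "tail G e \<in> verts_of F" "head G e \<in> verts_of F" if "e \<in> A" for e
    using that unfolding FA verts_of_gain_edges by auto
  have wfH': "wf_digraph H'" using ends by (auto simp: wf_digraph_def H'_def)
  have sub: "subgraph H' H"
    using VF A wfH wfH' same by (auto simp: subgraph_def compatible_def H'_def)
  have ne: "arcs H' \<noteq> {}" using F FA by (auto simp: H'_def)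
  have V01: "verts_of F \<inter> V1 = verts_of F - {q0}" "verts_of F \<inter> V0 = verts_of F \<inter> {q0}"
    using VF by (auto simp: free_orbits_q0 fixed_orbits_q0)
  have "int (card (arcs H')) \<le> 2 * int (card (verts H' \<inter> V1)) + of_bool m * int (card (verts H' \<inter> V0)) - 1"
    using sparse sub ne unfolding gain_sparse_def by blast
  moreover have "of_bool m * int (card (verts_of F \<inter> {q0})) = of_bool (m \<and> q0 \<in> verts_of F)"
    by (auto simp: of_bool_def)
  moreover have "arcs H' = A" "verts H' = verts_of F" by (simp_all add: H'_def)
  ultimately show "int (card F) \<le> 2 * int (card (verts_of F - {q0})) + of_bool (m \<and> q0 \<in> verts_of F) - 1"
    unfolding cardA[symmetric] V01[symmetric] by (simp only:)
  assume pot: "potential q0 \<theta> F"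
  have "balanced \<Gamma> V0 \<psi> H'"
    unfolding balanced_def
  proof (intro allI impI)
    fix w let ?H = "H' \<restriction> (verts H' - V0)"
    assume "undirected_cycle ?H w"
    then obtain u where w: "undirected_walk ?H u w u" by (auto simp: undirected_cycle_def)
    have arc: "e \<in> A \<and> tail G e \<noteq> q0 \<and> head G e \<noteq> q0" if "e \<in> arcs ?H" for e
      using that A arc_edge(1,2) by (auto simp: H'_def fixed_orbits_q0)
    have \<psi>c: "\<psi> e \<in> carrier \<Gamma>" if "e \<in> arcs ?H" for e using arc[OF that] A arc_edge(3) by blast
    have p: "\<theta> (tail ?H e) = character (\<psi> e) * \<theta> (head ?H e)" if "e \<in> arcs ?H" for e
    proof -
      have "gain_edge_of e \<in> F" using arc[OF that] FA by blast
      then show ?thesis using arc[OF that] pot by (auto simp: potential_def gain_edge_of_def H'_def)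
    qed
    note wp = walk_potential[OF is_group \<psi>c character_mult character_cube p w]
    have "walk_gain \<Gamma> \<psi> w \<in> carrier \<Gamma>" "\<theta> u = character (walk_gain \<Gamma> \<psi> w) * \<theta> u" by (rule wp; assumption)+
    then show "walk_gain \<Gamma> \<psi> w = \<one>\<^bsub>\<Gamma>\<^esub>"
      using character_eq_one potential_nonzero[OF pot, of u] by simp
  qed
  then have "int (card (arcs H')) \<le> 2 * int (card (verts H')) - 3"
    using sparse sub ne unfolding gain_sparse_def by blast
  then show "3 \<le> excess (verts_of F) F" by (simp add: H'_def cardA excess_def)
qed

lemma sparse_edges_of_gain_sparse:
  assumes H: "subgraph H G" and sparse: "gain_sparse \<Gamma> V0 V1 1 1 H \<psi>"
  shows "sparse_edges q0 (gain_edge_of ` arcs H)"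
proof -
  have arcs: "arcs H \<subseteq> arcs G" using H by (auto simp: subgraph_def)
  have sparse': "gain_sparse \<Gamma> V0 V1 (of_bool True) 1 H \<psi>" using sparse by simp
  show ?thesis
    unfolding sparse_edges_def
  proof (intro conjI allI impI ballI)
    show fin: "finite (gain_edge_of ` arcs H)" using arcs finite_arcs finite_subset by blast
    show "valid_edge q0 e" if "e \<in> gain_edge_of ` arcs H" for e using that arcs gain_edge_valid by auto
    fix F assume F: "F \<subseteq> gain_edge_of ` arcs H" "F \<noteq> {}"
    show "\<exists>\<theta>. potential q0 \<theta> F \<Longrightarrow> 3 \<le> excess (verts_of F) F"
      using sparse_counts(1)[OF H sparse' F] by blast
    have finV: "finite (verts_of F)" using F fin finite_subset by (metis finite_verts_of)
    define n where "n = card (verts_of F - {q0})"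
    have "int (card F) \<le> 2 * int n + of_bool (q0 \<in> verts_of F) - 1"
      using sparse_counts(2)[OF H sparse' F] unfolding n_def by (simp only: simp_thms)
    moreover have "card (verts_of F) = n + of_bool (q0 \<in> verts_of F)"
      unfolding n_def using card_Suc_Diff1[OF finV, of q0] by (cases "q0 \<in> verts_of F") simp_all
    ultimately show "1 + of_bool (q0 \<in> verts_of F) \<le> excess (verts_of F) F"
      by (simp add: excess_def of_bool_def split: if_splits)
  qed
qed

text \<open>A balanced subgraph gets a potential from its cycles away from \<open>V0\<close>. Its
  vertex set may contain isolated vertices, which is why the counts for independent rows allow a
  vertex set \<open>U\<close> larger than \<open>verts_of F\<close>.\<close>

lemma gain_sparse_of_independent:
  assumes A: "A \<subseteq> arcs G" and ind: "independent_rows m q0 z (gain_edge_of ` A)"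
    and sep: "separated q0 (verts G) z"
  shows "gain_sparse \<Gamma> V0 V1 (of_bool m) 1 (with_arcs G A) \<psi>"
proof -
  have main: "(balanced \<Gamma> V0 \<psi> H \<longrightarrow> int (card (arcs H)) \<le> 2 * int (card (verts H)) - 3) \<and>
      int (card (arcs H)) \<le> 2 * int (card (verts H \<inter> V1)) + of_bool m * int (card (verts H \<inter> V0)) - 1"
    if H: "subgraph H (with_arcs G A)" and ne: "arcs H \<noteq> {}" for H
  proof -
    let ?F = "gain_edge_of ` arcs H" and ?U = "verts H"
    have arcs: "arcs H \<subseteq> A" "arcs H \<subseteq> arcs G" and vs: "?U \<subseteq> verts G" and wfH: "wf_digraph H"
      and same: "tail H = tail G" "head H = head G"
      using H A by (auto simp: subgraph_def compatible_def)
    have finU: "finite ?U" using vs finite_verts finite_subset by blast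
    have finA: "finite (arcs H)" using arcs finite_arcs finite_subset by blast
    have card: "card ?F = card (arcs H)" using gain_edge_inj arcs by (metis card_image inj_on_subset)
    have VF: "verts_of ?F \<subseteq> ?U"
      using wfH same unfolding verts_of_gain_edges by (auto simp: wf_digraph_def)
    have indF: "independent_rows m q0 z ?F"
      using ind arcs(1) unfolding independent_rows_def by (metis image_mono subsetD)
    have valid: "\<forall>e\<in>?F. valid_edge q0 e" using gain_edge_valid arcs by auto
    have sepU: "separated q0 ?U z" using sep vs by (rule separated_subset)
    note counts = independent_rows_counts[OF finU VF _ _ indF valid sepU]
    have V01: "?U \<inter> V1 = ?U - {q0}" "?U \<inter> V0 = ?U \<inter> {q0}"
      using vs by (auto simp: free_orbits_q0 fixed_orbits_q0)
    have "of_bool m * int (card (?U \<inter> V0)) = of_bool (m \<and> q0 \<in> ?U)"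
      unfolding V01 by (auto simp: of_bool_def)
    then have le: "int (card (arcs H)) \<le> 2 * int (card (?U \<inter> V1)) + of_bool m * int (card (?U \<inter> V0)) - 1"
      using counts(1) ne finA unfolding V01(1) card by simp
    have "int (card (arcs H)) \<le> 2 * int (card ?U) - 3" if bal: "balanced \<Gamma> V0 \<psi> H"
    proof -
      let ?H = "H \<restriction> (?U - V0)"
      have "wf_digraph ?H" using wfH by (auto simp: wf_digraph_def)
      moreover have "finite (arcs ?H)" using finA by simp
      moreover have "\<psi> e \<in> carrier \<Gamma>" if "e \<in> arcs ?H" for e using that arcs arc_edge(3) by auto
      moreover have "walk_gain \<Gamma> \<psi> w = \<one>\<^bsub>\<Gamma>\<^esub>" if "undirected_cycle ?H w" for w
        using bal that by (auto simp: balanced_def)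
      ultimately have "\<exists>\<theta>. (\<forall>x. \<theta> x ^ 3 = 1) \<and>
          (\<forall>e\<in>arcs ?H. \<theta> (tail ?H e) = character (\<psi> e) * \<theta> (head ?H e))"
        by (intro potential_of_cycles[OF is_group _ _ _ character_mult character_cube])
      then obtain \<theta> where \<theta>: "\<forall>x. \<theta> x ^ 3 = 1"
        "\<forall>e\<in>arcs ?H. \<theta> (tail G e) = character (\<psi> e) * \<theta> (head G e)" using same by auto
      have "potential q0 \<theta> ?F"
        unfolding potential_def
      proof (intro conjI \<theta>(1) ballI)
        fix d assume "d \<in> ?F"
        then obtain e where e: "e \<in> arcs H" "d = gain_edge_of e" by auto
        have "tail G e \<in> ?U" "head G e \<in> ?U" using wfH e same by (auto simp: wf_digraph_def)
        then have "e \<in> arcs ?H" if "tail G e \<noteq> q0" "head G e \<noteq> q0"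
          using that e same by (auto simp: fixed_orbits_q0)
        then show "case d of (u, v, g) \<Rightarrow> u \<noteq> q0 \<and> v \<noteq> q0 \<longrightarrow> \<theta> u = g * \<theta> v"
          using \<theta>(2) e by (auto simp: gain_edge_of_def simp del: induce_subgraph_arcs)
      qed
      then show ?thesis using counts(2) ne finA unfolding card by simp
    qed
    with le show ?thesis by blast
  qed
  then show ?thesis unfolding gain_sparse_def by blast
qed

lemma spanning_with_arcs: "A \<subseteq> arcs G \<Longrightarrow> spanning (with_arcs G A) G"
  using wf_G by (auto simp: spanning_def subgraph_def compatible_def wf_digraph_def)

end

section \<open>Systems of corank one\<close>

lemma row_diff:
  "row m z e (\<lambda>w. a w - k * a' w) (\<lambda>w. b w - k * b' w) = row m z e a b - k * row m z e a' b'"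
  by (cases e) (simp add: algebra_simps)

text \<open>A kernel vector that is not proportional to the given one, made to vanish at
  \<open>p0\<close>, would give arbitrary values on two coordinates and so force
  \<open>card F + 2 \<le> card (coords m q0 U)\<close>.\<close>

lemma kernel_unique:
  assumes U: "finite U" "verts_of F \<subseteq> U" and fin: "finite F" and ind: "independent_rows m q0 z F"
    and card: "card (coords m q0 U) \<le> card F + 1"
    and k: "admissible m q0 a b" "\<forall>e\<in>F. row m z e a b = 0"
    and k': "admissible m q0 a' b'" "\<forall>e\<in>F. row m z e a' b' = 0"
    and p0: "p0 \<in> coords m q0 U" "component a' b' p0 \<noteq> 0" and p: "p \<in> coords m q0 U"
  shows "component a b p = component a b p0 / component a' b' p0 * component a' b' p"
proof (rule ccontr)
  assume neq: "\<not> ?thesis"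
  define k where "k = component a b p0 / component a' b' p0"
  define d where "d = (\<lambda>w. a w - k * a' w)"
  define d' where "d' = (\<lambda>w. b w - k * b' w)"
  have comp: "component d d' q = component a b q - k * component a' b' q" for q
    by (simp add: component_def d_def d'_def)
  have D: "admissible m q0 d d'" "\<forall>e\<in>F. row m z e d d' = 0"
    using assms(6-9) by (auto simp: admissible_def d_def d'_def row_diff simp del: row.simps)
  have d0: "component d d' p0 = 0" "component d d' p \<noteq> 0"
    using neq p0(2) by (simp_all add: comp k_def)
  then have pp: "p \<noteq> p0" by auto
  have "card F + card {p0, p} \<le> card (coords m q0 U)"
  proof (rule independent_rows_card[OF U fin ind])
    show "{p0, p} \<subseteq> coords m q0 U" using p0 p by simp
    fix r
    define s where "s = r p0 / component a' b' p0"
    define t where "t = (r p - s * component a' b' p) / component d d' p"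
    define x where "x = (\<lambda>w. s * a' w + t * d w)"
    define y where "y = (\<lambda>w. s * b' w + t * d' w)"
    have comp': "component x y q = s * component a' b' q + t * component d d' q" for q
      by (simp add: component_def x_def y_def)
    have "admissible m q0 x y" using D(1) k'(1) by (auto simp: admissible_def x_def y_def)
    moreover have "\<forall>e\<in>F. row m z e x y = 0"
      using D(2) k'(2) by (simp add: x_def y_def row_linear del: row.simps)
    moreover have "\<forall>q\<in>{p0, p}. component x y q = r q"
      using p0(2) d0 by (simp add: comp' s_def t_def)
    ultimately show "\<exists>a b. admissible m q0 a b \<and> (\<forall>e\<in>F. row m z e a b = 0) \<and> (\<forall>p\<in>{p0, p}. component a b p = r p)"
      by blast
  qed
  then show False using card pp by simp
qed

lemma independent_rows_insert:
  assumes ind: "independent_rows m q0 z F" and ab: "admissible m q0 a b" "\<forall>d\<in>F. row m z d a b = 0"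
    and e: "row m z e a b \<noteq> 0"
  shows "independent_rows m q0 z (insert e F)"
  unfolding independent_rows_def
proof
  fix c
  obtain a' b' where ab': "admissible m q0 a' b'" "\<forall>d\<in>F. row m z d a' b' = c d"
    using ind unfolding independent_rows_def by metis
  define t where "t = (c e - row m z e a' b') / row m z e a b"
  define x where "x = (\<lambda>w. 1 * a' w + t * a w)"
  define y where "y = (\<lambda>w. 1 * b' w + t * b w)"
  have "row m z d x y = row m z d a' b' + t * row m z d a b" for d
    unfolding x_def y_def row_linear by simp
  then have "\<forall>d\<in>insert e F. row m z d x y = c d"
    using ab(2) ab'(2) e by (auto simp: t_def simp del: row.simps)
  moreover have "admissible m q0 x y" using ab(1) ab'(1) by (auto simp: admissible_def x_def y_def)
  ultimately show "\<exists>a b. admissible m q0 a b \<and> (\<forall>e\<in>insert e F. row m z e a b = c e)" by blast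
qed

text \<open>If a maximal independent set had at least two rows fewer than columns, a nonzero vector
  would be annihilated by its rows and by the coordinate \<open>p0\<close>. By hypothesis some row
  of \<open>A\<close> does not vanish on that vector, and it could be added.\<close>

lemma maximal_independent:
  assumes U: "finite U" "verts_of A \<subseteq> U" and fin: "finite A"
    and kernel: "\<And>a b. admissible m q0 a b \<Longrightarrow> \<forall>e\<in>A. row m z e a b = 0 \<Longrightarrow> component a b p0 = 0 \<Longrightarrow>
      \<forall>p\<in>coords m q0 U. component a b p = 0"
  shows "\<exists>F\<subseteq>A. independent_rows m q0 z F \<and> card (coords m q0 U) \<le> card F + 1"
proof -
  define P where "P = (\<lambda>F. F \<subseteq> A \<and> independent_rows m q0 z F)"
  have "P {}"
    unfolding P_def independent_rows_def admissible_def
    by (intro conjI allI exI[of _ "\<lambda>_. 0"]) auto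
  moreover have "card F \<le> card A" if "P F" for F using that fin by (auto simp: P_def intro: card_mono)
  ultimately obtain F where F: "P F" "\<And>F'. P F' \<Longrightarrow> card F' \<le> card F"
    using ex_has_greatest_nat[of P "{}" card "Suc (card A)"] by (meson le_imp_less_Suc)
  have finF: "finite F" and FA: "F \<subseteq> A" using F fin finite_subset by (auto simp: P_def)
  let ?X = "coords m q0 U"
  have finX: "finite ?X" using U by simp
  have "card ?X \<le> card F + 1"
  proof (rule ccontr)
    assume "\<not> ?thesis"
    then have lt: "card F + 1 < card ?X" by simp
    define M where "M = (\<lambda>y i. case y of Inl e \<Rightarrow> coefficient m z e i | Inr (_::unit) \<Rightarrow> of_bool (i = p0))"
    have "card (Inl ` F \<union> {Inr ()}) = card F + 1"
      using finF by (subst card_Un_disjoint) (auto simp: card_image)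
    then obtain x where x: "\<exists>i\<in>?X. x i \<noteq> 0" "\<forall>y\<in>Inl ` F \<union> {Inr ()}. (\<Sum>i\<in>?X. M y i * x i) = 0"
      using homogeneous_solution[of "Inl ` F \<union> {Inr ()}" ?X M] finF finX lt by auto
    define a where "a = (\<lambda>w. if (w, True) \<in> ?X then x (w, True) else 0)"
    define b where "b = (\<lambda>w. if (w, False) \<in> ?X then x (w, False) else 0)"
    have comp: "component a b i = x i" if "i \<in> ?X" for i
      using that by (cases i; cases "snd i") (auto simp: component_def a_def b_def)
    have ab: "admissible m q0 a b" by (auto simp: admissible_def a_def b_def coords_def)
    have row: "row m z e a b = 0" if "e \<in> F" for e
    proof -
      have sub: "verts_of {e} \<subseteq> U" using that FA U(2) verts_of_mono[of "{e}" A] by blast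
      have "row m z e a b = (\<Sum>i\<in>?X. coefficient m z e i * component a b i)"
        unfolding row_eq_sum[OF U(1) sub ab] component_def ..
      also have "\<dots> = (\<Sum>i\<in>?X. M (Inl e) i * x i)" by (rule sum.cong) (simp_all add: comp M_def)
      finally show ?thesis using x(2) that by simp
    qed
    have p0: "component a b p0 = 0"
    proof (cases "p0 \<in> ?X")
      case True
      have "0 = (\<Sum>i\<in>?X. M (Inr ()) i * x i)" using x(2) by simp
      also have "\<dots> = x p0"
        using True finX by (simp add: M_def of_bool_def if_distrib[of "\<lambda>x. x * _"] cong: if_cong)
      finally show ?thesis using comp True by simp
    next
      case False
      then show ?thesis by (cases p0; cases "snd p0") (auto simp: component_def a_def b_def)
    qed
    have "\<exists>e\<in>A. row m z e a b \<noteq> 0"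
      using kernel[OF ab _ p0] x(1) comp by auto
    then obtain e where e: "e \<in> A" "row m z e a b \<noteq> 0" by blast
    then have "e \<notin> F" using row by metis
    moreover have "P (insert e F)"
      using independent_rows_insert[OF _ ab _ e(2), of F] row F(1) e(1) by (auto simp: P_def)
    from F(2)[OF this] have "card (insert e F) \<le> card F" .
    ultimately show False using finF by simp
  qed
  then show ?thesis using F(1) by (auto simp: P_def)
qed

section \<open>Isotypic components of a motion\<close>

context c3_graph
begin

text \<open>If there is no fixed vertex, then \<open>q0\<close> is not an orbit and \<open>rep q0\<close> is arbitrary.\<close>

definition position :: "('v \<Rightarrow> real^2) \<Rightarrow> 'v set \<Rightarrow> complex" where
  "position q x = (if x = q0 then 0 else to_complex (q (rep x)))"

lemma symmetric_position:
  assumes "C3_symmetric \<Gamma> \<tau> \<phi> V q"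
  shows "\<lbrakk>g \<in> carrier \<Gamma>; v \<in> V\<rbrakk> \<Longrightarrow> to_complex (q (\<phi> g v)) = character g * to_complex (q v)"
    and "x \<in> verts G \<Longrightarrow> to_complex (q (rep x)) = position q x"
proof -
  show *: "to_complex (q (\<phi> g v)) = character g * to_complex (q v)" if "g \<in> carrier \<Gamma>" "v \<in> V" for g v
    using assms that tau_character[OF that(1), of "q v"] by (simp add: C3_symmetric_def)
  assume x: "x \<in> verts G"
  show "to_complex (q (rep x)) = position q x"
  proof (cases "x = q0")
    case True
    then have "\<phi> \<gamma> (rep x) = rep x" using fixed_iff_q0[OF x] gen(1) by (simp add: fixed_def)
    then have "to_complex (q (rep x)) = cis (2 * pi / 3) * to_complex (q (rep x))"
      using *[OF gen(1) rep_in(2)[OF x]] character_gamma by simp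
    then have "to_complex (q (rep x)) = 0" using cis_cube(2) by simp
    then show ?thesis using True by (simp add: position_def)
  qed (simp add: position_def)
qed

lemma arc_vector:
  assumes q: "C3_symmetric \<Gamma> \<tau> \<phi> V q" and e: "e \<in> arcs G"
  shows "to_complex (q (rep (tail G e))) - to_complex (q (\<phi> (\<psi> e) (rep (head G e)))) =
    position q (tail G e) - character (\<psi> e) * position q (head G e)"
  using symmetric_position[OF q] arc_edge(1-3)[OF e] rep_in(2)[OF arc_edge(2)[OF e]] by simp

text \<open>Three times the projection onto the functions that are multiplied by
  \<open>inverse (character h ^ i)\<close> under \<open>\<phi> h\<close>.\<close>

definition isotypic :: "nat \<Rightarrow> ('v \<Rightarrow> complex) \<Rightarrow> 'v \<Rightarrow> complex" where
  "isotypic i a v = (\<Sum>g\<in>carrier \<Gamma>. character g ^ i * a (\<phi> g v))"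

lemma isotypic_shift:
  assumes "h \<in> carrier \<Gamma>" "v \<in> V"
  shows "character h ^ i * isotypic i a (\<phi> h v) = isotypic i a v"
proof -
  have "isotypic i a v = (\<Sum>g\<in>carrier \<Gamma>. character (g \<otimes>\<^bsub>\<Gamma>\<^esub> h) ^ i * a (\<phi> (g \<otimes>\<^bsub>\<Gamma>\<^esub> h) v))"
    unfolding isotypic_def by (rule sum_translate[OF assms(1), symmetric])
  also have "\<dots> = character h ^ i * isotypic i a (\<phi> h v)"
    unfolding isotypic_def sum_distrib_left
    by (rule sum.cong) (use assms in \<open>simp_all add: character_mult phi_mult power_mult_distrib\<close>)
  finally show ?thesis by simp
qed

lemma isotypic_sum: "v \<in> V \<Longrightarrow> isotypic 0 a v + isotypic 1 a v + isotypic 2 a v = 3 * a v"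
proof -
  assume v: "v \<in> V"
  have filt: "1 + character g + character g ^ 2 = (if g = \<one>\<^bsub>\<Gamma>\<^esub> then 3 else 0)" if g: "g \<in> carrier \<Gamma>" for g
  proof (cases "g = \<one>\<^bsub>\<Gamma>\<^esub>")
    case False
    have "(character g - 1) * (1 + character g + character g ^ 2) = character g ^ 3 - 1"
      by (simp add: algebra_simps power2_eq_square power3_eq_cube)
    then show ?thesis using character_cube[OF g] character_eq_one[OF g] False by simp
  qed (simp add: character_one)
  have "isotypic 0 a v + isotypic 1 a v + isotypic 2 a v =
      (\<Sum>g\<in>carrier \<Gamma>. (if g = \<one>\<^bsub>\<Gamma>\<^esub> then 3 else 0) * a (\<phi> g v))"
    unfolding isotypic_def sum.distrib[symmetric]
  proof (rule sum.cong)
    fix g assume g: "g \<in> carrier \<Gamma>"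
    have "character g ^ 0 * a (\<phi> g v) + character g ^ 1 * a (\<phi> g v) + character g ^ 2 * a (\<phi> g v) =
        (1 + character g + character g ^ 2) * a (\<phi> g v)" by (simp add: algebra_simps)
    then show "character g ^ 0 * a (\<phi> g v) + character g ^ 1 * a (\<phi> g v) + character g ^ 2 * a (\<phi> g v) =
        (if g = \<one>\<^bsub>\<Gamma>\<^esub> then 3 else 0) * a (\<phi> g v)"
      by (simp only: filt[OF g])
  qed simp
  also have "\<dots> = (\<Sum>g\<in>carrier \<Gamma>. if g = \<one>\<^bsub>\<Gamma>\<^esub> then 3 * a v else 0)"
    by (rule sum.cong) (use phi_one[OF v] in auto)
  finally show ?thesis using finite_carrier by simp
qed

lemma isotypic_fixed:
  assumes "fixed v" "i = 1 \<or> i = 2"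
  shows "isotypic i a v = 0"
proof -
  have "isotypic i a v = (\<Sum>g\<in>carrier \<Gamma>. character g ^ i) * a v"
    unfolding isotypic_def sum_distrib_right using assms(1) by (intro sum.cong) (auto simp: fixed_def)
  then show ?thesis using assms(2) character_sums by auto
qed

text \<open>The equations at the images of one edge are multiplied by powers of the character and
  added. Conjugation changes the type of a component: the block of the trivial character receives
  component 2 with its own conjugate, the other one component 1 with the conjugate of component
  0.\<close>

lemma motion_kernel:
  assumes q: "C3_symmetric \<Gamma> \<tau> \<phi> V q" and mot: "infinitesimal_motion E q mt" and e: "e \<in> arcs G"
  defines "a \<equiv> \<lambda>v. to_complex (mt v)"
  defines "\<alpha> \<equiv> \<lambda>i x. if x = q0 then 0 else isotypic i a (rep x)"
  shows "row False (position q) (gain_edge_of e) (\<alpha> 2) (\<lambda>x. cnj (\<alpha> 2 x)) = 0"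
    "row True (position q) (gain_edge_of e) (\<alpha> 1) (\<lambda>x. cnj (isotypic 0 a (rep x))) = 0"
proof -
  note ae = arc_edge[OF e]
  define k where "k = \<psi> e"
  define u where "u = rep (tail G e)"
  define v where "v = rep (head G e)"
  define D where "D = position q (tail G e) - character k * position q (head G e)"
  have k: "k \<in> carrier \<Gamma>" and uV: "u \<in> V" and vV: "v \<in> V"
    using ae rep_in(2) by (auto simp: k_def u_def v_def)
  have ck: "character k ^ 3 = 1" by (rule character_cube[OF k])
  note K = cube_root_facts[OF ck]
  have uw: "{u, \<phi> k v} \<in> E" using ae by (auto simp: k_def u_def v_def)
  have wV: "\<phi> k v \<in> V" using phi_in k vV by simp
  define \<Delta> where "\<Delta> = (\<lambda>g. a (\<phi> g u) - a (\<phi> g (\<phi> k v)))"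
  \<comment> \<open>Both are the motion equation at the image of the edge under \<open>g\<close>, as
    it stands or multiplied by \<open>character g ^ 2\<close>; conjugation squares a cube root of
    unity.\<close>
  have eq: "cnj D * (character g ^ 2 * \<Delta> g) + D * cnj (character g ^ 2 * \<Delta> g) = 0"
    "cnj D * (character g * \<Delta> g) + D * cnj (\<Delta> g) = 0" if g: "g \<in> carrier \<Gamma>" for g
  proof -
    note Cg = cube_root_facts[OF character_cube[OF g]]
    have cc: "cnj (character g) = character g ^ 2" using Cg by simp
    have "to_complex (q (\<phi> g u)) - to_complex (q (\<phi> g (\<phi> k v))) =
        character g * (to_complex (q u) - to_complex (q (\<phi> k v)))"
      using symmetric_position(1)[OF q g uV] symmetric_position(1)[OF q g wV] by (simp add: right_diff_distrib)
    then have DD: "to_complex (q (\<phi> g u)) - to_complex (q (\<phi> g (\<phi> k v))) = character g * D"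
      using arc_vector[OF q e] by (simp only: D_def k_def u_def v_def)
    have m: "cnj (character g * D) * \<Delta> g + (character g * D) * cnj (\<Delta> g) = 0"
      using mot phi_edge[OF g uw] unfolding infinitesimal_motion_iff DD[symmetric] \<Delta>_def a_def by blast
    have "cnj (character g ^ 2) = character g"
    proof -
      have "cnj (character g ^ 2) = character g ^ 3 * character g"
        by (simp add: cc power2_eq_square power3_eq_cube)
      then show ?thesis using character_cube[OF g] by simp
    qed
    then show "cnj D * (character g ^ 2 * \<Delta> g) + D * cnj (character g ^ 2 * \<Delta> g) = 0"
      using m by (simp add: cc mult_ac)
    have "character g ^ 2 * (cnj (character g * D) * \<Delta> g + (character g * D) * cnj (\<Delta> g)) =
        character g ^ 3 * (cnj D * (character g * \<Delta> g) + D * cnj (\<Delta> g))"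
      by (simp add: cc power2_eq_square power3_eq_cube algebra_simps)
    then show "cnj D * (character g * \<Delta> g) + D * cnj (\<Delta> g) = 0"
      using m character_cube[OF g] by simp
  qed
  have diff: "isotypic i a u - isotypic i a (\<phi> k v) = (\<Sum>g\<in>carrier \<Gamma>. character g ^ i * \<Delta> g)" for i
    unfolding isotypic_def \<Delta>_def by (simp add: algebra_simps sum_subtractf)
  have al: "\<alpha> i x = isotypic i a (rep x)" if "i = 1 \<or> i = 2" "x \<in> verts G" for i x
    using isotypic_fixed[of "rep x" i a] fixed_iff_q0[OF that(2)] that(1) by (auto simp: \<alpha>_def)
  have k4: "character k ^ 2 * character k ^ 2 = character k"
    using ck by (simp add: power2_eq_square power3_eq_cube mult_ac)
  have sh2: "isotypic 2 a (\<phi> k v) = character k * isotypic 2 a v"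
  proof -
    have "character k * (character k ^ 2 * isotypic 2 a (\<phi> k v)) = character k * isotypic 2 a v"
      using isotypic_shift[OF k vV, of 2 a] by simp
    moreover have "character k * (character k ^ 2 * isotypic 2 a (\<phi> k v)) = character k ^ 3 * isotypic 2 a (\<phi> k v)"
      by (simp add: power2_eq_square power3_eq_cube)
    ultimately show ?thesis using ck by (metis mult_1)
  qed
  have sh1: "isotypic 1 a (\<phi> k v) = character k ^ 2 * isotypic 1 a v"
  proof -
    have "character k ^ 2 * (character k * isotypic 1 a (\<phi> k v)) = character k ^ 2 * isotypic 1 a v"
      using isotypic_shift[OF k vV, of 1 a] by simp
    moreover have "character k ^ 2 * (character k * isotypic 1 a (\<phi> k v)) = character k ^ 3 * isotypic 1 a (\<phi> k v)"
      by (simp add: power2_eq_square power3_eq_cube)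
    ultimately show ?thesis using ck by (metis mult_1)
  qed
  have sh0: "isotypic 0 a (\<phi> k v) = isotypic 0 a v"
    using isotypic_shift[OF k vV, of 0 a] by simp
  have fac: "a_factor False (character k) = character k" "b_factor False (character k) = cnj (character k)"
    "a_factor True (character k) = character k ^ 2" "b_factor True (character k) = 1"
    using K k4 by (simp_all add: a_factor_def b_factor_def)
  have "row False (position q) (gain_edge_of e) (\<alpha> 2) (\<lambda>x. cnj (\<alpha> 2 x)) =
      cnj D * (isotypic 2 a u - isotypic 2 a (\<phi> k v)) + D * cnj (isotypic 2 a u - isotypic 2 a (\<phi> k v))"
    unfolding gain_edge_of_def row.simps k_def[symmetric] D_def[symmetric] fac sh2
    by (simp add: al ae u_def v_def)
  also have "\<dots> = (\<Sum>g\<in>carrier \<Gamma>. cnj D * (character g ^ 2 * \<Delta> g) + D * cnj (character g ^ 2 * \<Delta> g))"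
    unfolding diff sum.distrib sum_distrib_left[symmetric] cnj_sum ..
  also have "\<dots> = 0" using eq(1) by (intro sum.neutral ballI)
  finally show "row False (position q) (gain_edge_of e) (\<alpha> 2) (\<lambda>x. cnj (\<alpha> 2 x)) = 0" .
  have "row True (position q) (gain_edge_of e) (\<alpha> 1) (\<lambda>x. cnj (isotypic 0 a (rep x))) =
      cnj D * (isotypic 1 a u - isotypic 1 a (\<phi> k v)) + D * cnj (isotypic 0 a u - isotypic 0 a (\<phi> k v))"
    unfolding gain_edge_of_def row.simps k_def[symmetric] D_def[symmetric] fac sh1 sh0
    by (simp add: al ae u_def v_def)
  also have "\<dots> = (\<Sum>g\<in>carrier \<Gamma>. cnj D * (character g * \<Delta> g) + D * cnj (\<Delta> g))"
    unfolding diff sum.distrib sum_distrib_left[symmetric] cnj_sum by simp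
  also have "\<dots> = 0" using eq(2) by (intro sum.neutral ballI)
  finally show "row True (position q) (gain_edge_of e) (\<alpha> 1) (\<lambda>x. cnj (isotypic 0 a (rep x))) = 0" .
qed

end

section \<open>Rank and rigidity\<close>

lemma rigidity_row_sum:
  assumes "finite V" "u \<in> V" "v \<in> V" "u \<noteq> v"
  shows "(\<Sum>i\<in>V \<times> UNIV. rigidity_matrix p {u, v} i * m (fst i) $ snd i) = (p u - p v) \<bullet> (m u - m v)"
proof -
  have uv: "{u, v} - {u} = {v}" "{u, v} - {v} = {u}" using assms by auto
  have "(\<Sum>i\<in>V \<times> UNIV. rigidity_matrix p {u, v} i * m (fst i) $ snd i) =
      (\<Sum>w\<in>V. \<Sum>i\<in>UNIV. rigidity_matrix p {u, v} (w, i) * m w $ i)"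
    unfolding sum.cartesian_product by (rule sum.cong) auto
  also have "\<dots> = (\<Sum>w\<in>{u, v}. \<Sum>i\<in>UNIV. rigidity_matrix p {u, v} (w, i) * m w $ i)"
    by (rule sum.mono_neutral_right) (use assms in \<open>auto simp: rigidity_matrix_def\<close>)
  also have "\<dots> = (p u - p v) \<bullet> m u + (p v - p u) \<bullet> m v"
    using assms by (simp add: rigidity_matrix_def uv inner_vec_def)
  also have "\<dots> = (p u - p v) \<bullet> (m u - m v)" by (simp add: inner_diff_left inner_diff_right)
  finally show ?thesis .
qed

lemma motion_iff_rows:
  assumes "simple_graph V E"
  shows "infinitesimal_motion E p m \<longleftrightarrow>
    (\<forall>r\<in>rigidity_matrix p ` E. (\<Sum>i\<in>V \<times> UNIV. r i * m (fst i) $ snd i) = 0)"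
proof -
  have uv: "u \<in> V \<and> v \<in> V \<and> u \<noteq> v" if "{u, v} \<in> E" for u v
    using assms that by (auto simp: simple_graph_def card_insert_if split: if_splits)
  have fin: "finite V" using assms by (simp add: simple_graph_def)
  have ex: "\<exists>u v. e = {u, v}" if "e \<in> E" for e
  proof -
    have "card e = 2" using assms that by (simp add: simple_graph_def)
    then show ?thesis by (meson card_2_iff)
  qed
  show ?thesis
    unfolding infinitesimal_motion_def
  proof (intro iffI ballI allI impI)
    fix r assume m: "\<forall>u v. {u, v} \<in> E \<longrightarrow> (p u - p v) \<bullet> (m u - m v) = 0" and r: "r \<in> rigidity_matrix p ` E"
    from r obtain d where d: "d \<in> E" "r = rigidity_matrix p d" by blast
    from ex[OF d(1)] obtain u v where "d = {u, v}" by blast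
    with d have e: "{u, v} \<in> E" "r = rigidity_matrix p {u, v}" by auto
    then show "(\<Sum>i\<in>V \<times> UNIV. r i * m (fst i) $ snd i) = 0"
      using rigidity_row_sum[OF fin, of u v p m] uv[OF e(1)] m by simp
  next
    fix u v assume m: "\<forall>r\<in>rigidity_matrix p ` E. (\<Sum>i\<in>V \<times> UNIV. r i * m (fst i) $ snd i) = 0" and e: "{u, v} \<in> E"
    then show "(p u - p v) \<bullet> (m u - m v) = 0"
      using rigidity_row_sum[OF fin, of u v p m] uv[OF e] by auto
  qed
qed

interpretation fun_space: vector_space fun_scale
  by (rule vector_space_fun_scale)

lemma sum_function_apply: "(\<Sum>b\<in>B. f b) i = (\<Sum>b\<in>B. f b i)"
  by (induction B rule: infinite_finite_induct) auto

lemma span_annihilator: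
  assumes "r \<in> fun_space.span B" "\<forall>b\<in>B. (\<Sum>i\<in>X. b i * x i) = 0"
  shows "(\<Sum>i\<in>X. r i * x i) = 0"
  using assms(1)
proof (induction rule: fun_space.span_induct_alt)
  case base
  show ?case by simp
next
  case (step c b r)
  have "(\<Sum>i\<in>X. (fun_scale c b + r) i * x i) = c * (\<Sum>i\<in>X. b i * x i) + (\<Sum>i\<in>X. r i * x i)"
    by (simp add: fun_scale_def algebra_simps sum.distrib sum_distrib_left)
  then show ?case using step assms(2) by simp
qed

lemma two_points:
  assumes "framework V E p"
  obtains u v where "u \<in> V" "v \<in> V" "p u \<noteq> p v"
proof -
  have "\<exists>u\<in>V. \<exists>v\<in>V. p u \<noteq> p v"
  proof (rule ccontr)
    assume "\<not> ?thesis"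
    then have same: "p u = p v" if "u \<in> V" "v \<in> V" for u v using that by blast
    obtain x where "p ` V \<subseteq> {x}"
    proof (cases "V = {}")
      case False
      then obtain w where "w \<in> V" by blast
      then have "p ` V \<subseteq> {p w}" using same by blast
      then show thesis by (rule that)
    qed (use that in simp)
    then have "affine hull (p ` V) \<subseteq> {x}" using hull_mono[of "p ` V" "{x}" affine] by simp
    moreover have "affine hull (p ` V) = UNIV" using assms by (simp add: framework_def)
    moreover have "axis 1 1 \<noteq> (0 :: real^2)" by simp
    ultimately have "axis 1 1 = x" "0 = x" by auto
    with \<open>axis 1 1 \<noteq> (0 :: real^2)\<close> show False by simp
  qed
  then show thesis using that by blast
qed

text \<open>
  Fixing one vertex and the direction of the motion of another one kills the trivial motions.
\<close>

lemma rank_of_rigid: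
  fixes V :: "'v set"
  assumes fw: "framework V E q" and rigid: "infinitesimally_rigid V E q"
  shows "2 * card V \<le> row_rank E (rigidity_matrix q) + 3"
proof (rule ccontr)
  assume lt: "\<not> ?thesis"
  have simple: "simple_graph V E" and fin: "finite V" using fw by (auto simp: framework_def simple_graph_def)
  obtain B where B: "B \<subseteq> rigidity_matrix q ` E" "rigidity_matrix q ` E \<subseteq> fun_space.span B"
    "card B = row_rank E (rigidity_matrix q)"
    unfolding row_rank_def by (rule fun_space.basis_exists)
  have "finite E" using simple fin finite_subset[of E "Pow V"] by (auto simp: simple_graph_def)
  then have finB: "finite B" using B(1) finite_subset by blast
  obtain v0 v1 where v: "v0 \<in> V" "v1 \<in> V" "q v0 \<noteq> q v1" by (rule two_points[OF fw])
  then have v01: "v0 \<noteq> v1" by auto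
  define d where "d = q v1 - q v0"
  \<comment> \<open>Rows 0 and 1 pin \<open>v0\<close>; row 2 makes the velocity of
    \<open>v1\<close> parallel to \<open>d\<close>, whereas a rotation about \<open>v0\<close> moves
    \<open>v1\<close> perpendicularly to \<open>d\<close>.\<close>
  define M :: "('v \<times> 2 \<Rightarrow> real) + nat \<Rightarrow> 'v \<times> 2 \<Rightarrow> real" where
    "M = (\<lambda>y i. case y of Inl b \<Rightarrow> b i | Inr n \<Rightarrow>
      if n = 0 then of_bool (i = (v0, 1)) else if n = 1 then of_bool (i = (v0, 2))
      else - d $ 2 * of_bool (i = (v1, 1)) + d $ 1 * of_bool (i = (v1, 2)))"
  let ?X = "V \<times> (UNIV :: 2 set)" and ?Y = "Inl ` B \<union> Inr ` {0, 1, 2 :: nat}"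
  have "card ?Y = card B + 3" using finB by (subst card_Un_disjoint) (auto simp: card_image)
  moreover have "card ?X = 2 * card V" by (simp add: card_cartesian_product)
  ultimately obtain x where x: "\<exists>i\<in>?X. x i \<noteq> 0" "\<forall>y\<in>?Y. (\<Sum>i\<in>?X. M y i * x i) = 0"
    using homogeneous_solution[of ?Y ?X M] finB fin lt B(3) by auto
  define m :: "'v \<Rightarrow> real^2" where "m = (\<lambda>v. vector [x (v, 1), x (v, 2)])"
  have mx: "m (fst i) $ snd i = x i" for i
  proof (cases i)
    case (Pair w k)
    then show ?thesis using exhaust_2[of k] by (auto simp: m_def)
  qed
  have "\<forall>b\<in>B. (\<Sum>i\<in>?X. b i * x i) = 0"
    using x(2) by (auto simp: M_def)
  then have "infinitesimal_motion E q m"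
    unfolding motion_iff_rows[OF simple] mx using span_annihilator[of _ B x ?X] B(2) by blast
  then obtain s t where st: "\<forall>v\<in>V. to_complex (m v) = \<i> * of_real s * to_complex (q v) + t"
    using rigid unfolding infinitesimally_rigid_def trivial_motion_iff by blast
  have pick: "(\<Sum>i\<in>?X. of_bool (i = j) * x i) = x j" if "j \<in> ?X" for j
    using that fin by (simp add: of_bool_def if_distrib[of "\<lambda>c. c * _"] cong: if_cong)
  have 0: "x (v0, 1) = 0" "x (v0, 2) = 0" "- d $ 2 * x (v1, 1) + d $ 1 * x (v1, 2) = 0"
  proof -
    have "(\<Sum>i\<in>?X. M (Inr 0) i * x i) = 0" "(\<Sum>i\<in>?X. M (Inr 1) i * x i) = 0" "(\<Sum>i\<in>?X. M (Inr 2) i * x i) = 0"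
      using x(2) by blast+
    then show "x (v0, 1) = 0" "x (v0, 2) = 0"
      using pick[of "(v0, 1)"] pick[of "(v0, 2)"] v by (simp_all add: M_def)
    have "0 = (\<Sum>i\<in>?X. - d $ 2 * (of_bool (i = (v1, 1)) * x i) + d $ 1 * (of_bool (i = (v1, 2)) * x i))"
      using \<open>(\<Sum>i\<in>?X. M (Inr 2) i * x i) = 0\<close> by (simp add: M_def algebra_simps)
    also have "\<dots> = - d $ 2 * x (v1, 1) + d $ 1 * x (v1, 2)"
      using pick[of "(v1, 1)"] pick[of "(v1, 2)"] v
      unfolding sum.distrib sum_distrib_left[symmetric] by simp
    finally show "- d $ 2 * x (v1, 1) + d $ 1 * x (v1, 2) = 0" by simp
  qed
  have "to_complex (m v0) = 0" using 0 by (simp add: to_complex_def m_def complex_eq_iff)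
  then have "to_complex (m v1) = \<i> * of_real s * to_complex d"
    using st v by (simp add: d_def algebra_simps)
  then have "x (v1, 1) = - s * d $ 2" "x (v1, 2) = s * d $ 1"
    by (simp_all add: to_complex_def m_def complex_eq_iff)
  then have "s * ((d $ 1)\<^sup>2 + (d $ 2)\<^sup>2) = 0" using 0(3) by (simp add: algebra_simps power2_eq_square)
  moreover have "(d $ 1)\<^sup>2 + (d $ 2)\<^sup>2 \<noteq> 0"
    using v(3) by (auto simp: d_def vec_eq_iff forall_2 sum_power2_eq_zero_iff)
  ultimately have s: "s = 0" by (metis mult_eq_0_iff)
  then have "t = 0" using st v \<open>to_complex (m v0) = 0\<close> by simp
  then have "m w = 0" if "w \<in> V" for w
    using st that s by (metis to_complex_inject to_complex_zero mult_zero_left mult_zero_right of_real_0 add_0)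
  then show False using x(1) mx by (metis mem_Times_iff zero_index)
qed

text \<open>A row basis, three trivial motions and \<open>m\<close> are more vectors than the
  dimension \<open>2 * card V\<close>, so they are linearly dependent. The part of the relation made
  of motions lies in the row space and is orthogonal to it, so it vanishes; this expresses
  \<open>m\<close> by trivial motions.\<close>

lemma rigid_of_rank:
  fixes V :: "'v set"
  assumes fw: "framework V E p" and rank: "2 * card V \<le> row_rank E (rigidity_matrix p) + 3"
  shows "infinitesimally_rigid V E p"
  unfolding infinitesimally_rigid_def
proof (intro allI impI)
  fix m assume mot: "infinitesimal_motion E p m"
  have simple: "simple_graph V E" and fin: "finite V" using fw by (auto simp: framework_def simple_graph_def)
  obtain B where B: "B \<subseteq> rigidity_matrix p ` E" "fun_space.independent B"
    "card B = row_rank E (rigidity_matrix p)"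
    unfolding row_rank_def by (rule fun_space.basis_exists)
  have "finite E" using simple fin finite_subset[of E "Pow V"] by (auto simp: simple_graph_def)
  then have finB: "finite B" using B(1) finite_subset by blast
  obtain v0 v1 where v: "v0 \<in> V" "v1 \<in> V" "p v0 \<noteq> p v1" by (rule two_points[OF fw])
  define T :: "nat \<Rightarrow> 'v \<Rightarrow> real^2" where
    "T = (\<lambda>n v. if n = 0 then of_complex 1 else if n = 1 then of_complex \<i>
      else if n = 2 then of_complex (\<i> * to_complex (p v)) else m v)"
  define M :: "'v \<times> 2 \<Rightarrow> ('v \<times> 2 \<Rightarrow> real) + nat \<Rightarrow> real" where
    "M = (\<lambda>i y. case y of Inl b \<Rightarrow> b i | Inr n \<Rightarrow> T n (fst i) $ snd i)"
  let ?X = "V \<times> (UNIV :: 2 set)" and ?Y = "Inl ` B \<union> Inr ` {..<4 :: nat}"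
  have cY: "card ?Y = card B + 4" using finB by (subst card_Un_disjoint) (auto simp: card_image)
  have cX: "card ?X = 2 * card V" by (simp add: card_cartesian_product)
  obtain l where l: "\<exists>y\<in>?Y. l y \<noteq> 0" "\<forall>i\<in>?X. (\<Sum>y\<in>?Y. M i y * l y) = 0"
    using homogeneous_solution[of ?X ?Y M] finB fin rank B(3) cY cX by auto
  define n where "n = (\<lambda>v. \<Sum>k<4. l (Inr k) *\<^sub>R T k v)"
  have sp: "(\<Sum>b\<in>B. b i * l (Inl b)) + n (fst i) $ snd i = 0" if "i \<in> ?X" for i
  proof -
    have "(\<Sum>y\<in>?Y. M i y * l y) = (\<Sum>y\<in>Inl ` B. M i y * l y) + (\<Sum>y\<in>Inr ` {..<4}. M i y * l y)"
      using finB by (intro sum.union_disjoint) auto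
    also have "(\<Sum>y\<in>Inl ` B. M i y * l y) = (\<Sum>b\<in>B. b i * l (Inl b))"
      by (subst sum.reindex) (auto simp: M_def)
    also have "(\<Sum>y\<in>Inr ` {..<4}. M i y * l y) = n (fst i) $ snd i"
      by (subst sum.reindex) (auto simp: M_def n_def mult.commute)
    finally show ?thesis using l(2) that by simp
  qed
  have nc: "to_complex (n v) = l (Inr 0) + l (Inr 1) * \<i> + l (Inr 2) * (\<i> * to_complex (p v)) +
      l (Inr 3) * to_complex (m v)" for v
    by (simp add: n_def T_def eval_nat_numeral)
  have "infinitesimal_motion E p n"
    unfolding infinitesimal_motion_iff
  proof (intro allI impI)
    fix u w assume e: "{u, w} \<in> E"
    let ?d = "to_complex (p u) - to_complex (p w)" and ?m = "to_complex (m u) - to_complex (m w)"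
    have "cnj ?d * ?m + ?d * cnj ?m = 0" using mot e unfolding infinitesimal_motion_iff by blast
    moreover have "to_complex (n u) - to_complex (n w) = l (Inr 2) * (\<i> * ?d) + l (Inr 3) * ?m"
      unfolding nc by (simp add: algebra_simps)
    then have "cnj ?d * (to_complex (n u) - to_complex (n w)) + ?d * cnj (to_complex (n u) - to_complex (n w)) =
        l (Inr 3) * (cnj ?d * ?m + ?d * cnj ?m)"
      by (simp only:) (simp add: algebra_simps)
    ultimately show "cnj ?d * (to_complex (n u) - to_complex (n w)) + ?d * cnj (to_complex (n u) - to_complex (n w)) = 0"
      by simp
  qed
  then have ann: "(\<Sum>i\<in>?X. b i * n (fst i) $ snd i) = 0" if "b \<in> B" for b
    using that B(1) unfolding motion_iff_rows[OF simple] by blast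
  \<comment> \<open>\<open>n\<close> is a motion, hence orthogonal to the rows, and by
    \<open>sp\<close> it lies in their span.\<close>
  have "(\<Sum>i\<in>?X. (n (fst i) $ snd i)\<^sup>2) = - (\<Sum>i\<in>?X. (\<Sum>b\<in>B. b i * l (Inl b)) * n (fst i) $ snd i)"
  proof -
    have "(n (fst i) $ snd i)\<^sup>2 = - ((\<Sum>b\<in>B. b i * l (Inl b)) * n (fst i) $ snd i)" if "i \<in> ?X" for i
      using sp[OF that] by (simp add: power2_eq_square eq_neg_iff_add_eq_0 flip: distrib_right)
    then show ?thesis by (simp add: sum_negf)
  qed
  also have "(\<Sum>i\<in>?X. (\<Sum>b\<in>B. b i * l (Inl b)) * n (fst i) $ snd i) =
      (\<Sum>b\<in>B. l (Inl b) * (\<Sum>i\<in>?X. b i * n (fst i) $ snd i))"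
    unfolding sum_distrib_right sum_distrib_left by (subst sum.swap) (simp add: mult_ac)
  also have "\<dots> = 0" using ann by simp
  finally have "(\<Sum>i\<in>?X. (n (fst i) $ snd i)\<^sup>2) = 0" by simp
  then have "\<forall>i\<in>?X. (n (fst i) $ snd i)\<^sup>2 = 0" using fin by (subst (asm) sum_nonneg_eq_0_iff) auto
  then have n0: "n w $ i = 0" if "w \<in> V" for w i using that by auto
  have lB: "l (Inl b) = 0" if "b \<in> B" for b
  proof -
    have "(\<Sum>b\<in>B. fun_scale (l (Inl b)) b) i = 0" for i
    proof (cases "i \<in> ?X")
      case True
      then have "(\<Sum>b\<in>B. b i * l (Inl b)) = 0" using sp[OF True] n0[of "fst i" "snd i"] by auto
      then show ?thesis by (simp add: fun_scale_def sum_function_apply mult.commute)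
    next
      case False
      have "b i = 0" if b: "b \<in> B" for b
      proof -
        obtain d where d: "d \<in> E" "b = rigidity_matrix p d" using b B(1) by auto
        have "d \<subseteq> V" using simple d by (auto simp: simple_graph_def)
        then show ?thesis using False d by (cases i) (auto simp: rigidity_matrix_def)
      qed
      then show ?thesis unfolding sum_function_apply fun_scale_def by (intro sum.neutral) simp
    qed
    then have "(\<Sum>b\<in>B. fun_scale (l (Inl b)) b) = 0" by (simp add: fun_eq_iff)
    then show ?thesis
      using fun_space.independentD[OF B(2) finB subset_refl, of "\<lambda>b. l (Inl b)" b] that by blast
  qed
  then obtain k where k: "k < 4" "l (Inr k) \<noteq> 0" using l(1) by auto
  have zero: "l (Inr 0) + l (Inr 1) * \<i> + l (Inr 2) * (\<i> * to_complex (p w)) + l (Inr 3) * to_complex (m w) = 0"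
    if "w \<in> V" for w
  proof -
    have "n w = 0" using n0[OF that] by (simp add: vec_eq_iff)
    then show ?thesis using nc[of w] by simp
  qed
  \<comment> \<open>The three trivial motions are independent because
    \<open>p v0 \<noteq> p v1\<close>, so the relation must involve \<open>m\<close>.\<close>
  have l3: "l (Inr 3) \<noteq> 0"
  proof
    assume l3: "l (Inr 3) = 0"
    let ?f = "\<lambda>w. complex_of_real (l (Inr 0)) + l (Inr 1) * \<i> + l (Inr 2) * (\<i> * to_complex (p w)) +
      l (Inr 3) * to_complex (m w)"
    have "?f v0 - ?f v1 = complex_of_real (l (Inr 2)) * (\<i> * (to_complex (p v0) - to_complex (p v1)))"
      using l3 by (simp add: algebra_simps)
    then have "complex_of_real (l (Inr 2)) * (\<i> * (to_complex (p v0) - to_complex (p v1))) = 0"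
      using zero[OF v(1)] zero[OF v(2)] by (simp only: diff_self)
    then have l2: "l (Inr 2) = 0" using v(3) by simp
    then have "complex_of_real (l (Inr 0)) + l (Inr 1) * \<i> = 0" using zero[OF v(1)] l3 by simp
    then have "l (Inr 0) = 0" "l (Inr 1) = 0" by (simp_all add: complex_eq_iff)
    moreover have "k = 0 \<or> k = 1 \<or> k = 2 \<or> k = 3" using k(1) by auto
    ultimately show False using k(2) l2 l3 by auto
  qed
  show "trivial_motion V p m"
    unfolding trivial_motion_iff
  proof (intro exI ballI)
    fix w assume w: "w \<in> V"
    have key: "M = \<i> * (- c2 / c3) * P + - (c0 + c1 * \<i>) / c3"
      if "c0 + c1 * \<i> + c2 * (\<i> * P) + c3 * M = 0" "c3 \<noteq> 0" for c0 c1 c2 c3 P M :: complex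
    proof -
      have "c3 * M = - (c0 + c1 * \<i> + c2 * (\<i> * P))" using that(1) by (simp only: add_eq_0_iff)
      then have "M = - (c0 + c1 * \<i> + c2 * (\<i> * P)) / c3"
        using that(2) by (metis nonzero_mult_div_cancel_left)
      then show ?thesis by (simp add: add_divide_distrib diff_divide_distrib)
    qed
    show "to_complex (m w) = \<i> * of_real (- l (Inr 2) / l (Inr 3)) * to_complex (p w) +
        (- (l (Inr 0) + l (Inr 1) * \<i>) / l (Inr 3))"
      unfolding of_real_minus of_real_divide by (rule key[OF zero[OF w]]) (use l3 in simp)
  qed
qed

section \<open>The characterisation\<close>

context c3_graph
begin

lemma decompose:
  assumes "v \<in> V"
  obtains g where "g \<in> carrier \<Gamma>" "v = \<phi> g (rep (orb v))"
proof -
  have "rep (orb v) \<in> orb v" using rep_in(1) orb_vert[OF assms] by blast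
  then have "v \<in> orb (rep (orb v))" using act.orbit_sym[of v "rep (orb v)"] orb_eq(2)[OF assms] assms by blast
  then show thesis using that by (auto simp: Group_Action.orbit_def)
qed

lemma verts_of_arcs: "A \<subseteq> arcs G \<Longrightarrow> verts_of (gain_edge_of ` A) \<subseteq> verts G"
  unfolding verts_of_gain_edges using arc_edge(1,2) by blast

lemma isotypic_values:
  assumes "v \<in> V" "g \<in> carrier \<Gamma>"
  shows "isotypic 2 a (\<phi> g v) = character g * isotypic 2 a v"
    "isotypic 1 a v = 0 \<Longrightarrow> isotypic 1 a (\<phi> g v) = 0"
    "isotypic 0 a (\<phi> g v) = isotypic 0 a v"
proof -
  note sh = isotypic_shift[OF assms(2,1), of _ a]
  have "character g * (character g ^ 2 * isotypic 2 a (\<phi> g v)) = character g ^ 3 * isotypic 2 a (\<phi> g v)"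
    by (simp add: power2_eq_square power3_eq_cube)
  then show "isotypic 2 a (\<phi> g v) = character g * isotypic 2 a v"
    unfolding sh character_cube[OF assms(2)] by simp
  show "isotypic 1 a v = 0 \<Longrightarrow> isotypic 1 a (\<phi> g v) = 0"
    using sh[of 1] character_nonzero[OF assms(2)] by simp
  show "isotypic 0 a (\<phi> g v) = isotypic 0 a v" using sh[of 0] by simp
qed

text \<open>Corank one leaves only the trivial motion in the kernel of each block. So component 2 of
  a motion is a multiple of the positions, component 1 vanishes and component 0 is constant; their
  sum is three times the motion.\<close>

lemma rigid_of_independent:
  assumes q: "C3_symmetric \<Gamma> \<tau> \<phi> V q" and sep: "separated q0 (verts G) (position q)"
    and x1: "x1 \<in> verts G" "x1 \<noteq> q0"
    and F: "\<And>m. F m \<subseteq> gain_edge_of ` arcs G" "\<And>m. independent_rows m q0 (position q) (F m)"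
      "\<And>m. card (coords m q0 (verts G)) \<le> card (F m) + 1"
  shows "infinitesimally_rigid V E q"
  unfolding infinitesimally_rigid_def
proof (intro allI impI)
  fix mt assume mot: "infinitesimal_motion E q mt"
  let ?z = "position q"
  define a where "a = (\<lambda>v. to_complex (mt v))"
  define \<alpha> where "\<alpha> = (\<lambda>i x. if x = q0 then 0 else isotypic i a (rep x))"
  have finF: "finite (F m)" and VF: "verts_of (F m) \<subseteq> verts G" for m
    using F(1)[of m] finite_arcs finite_subset verts_of_mono[OF F(1)[of m]] verts_of_arcs[OF subset_refl] by blast+
  have z0: "?z q0 = 0" by (simp add: position_def)
  have zx: "?z x \<noteq> 0" if "x \<in> verts G" "x \<noteq> q0" for x by (rule separated_nonzero[OF sep that])
  have al: "\<alpha> i x = isotypic i a (rep x)" if "i = 1 \<or> i = 2" "x \<in> verts G" for i x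
    using isotypic_fixed[of "rep x" i a] fixed_iff_q0[OF that(2)] that(1) by (auto simp: \<alpha>_def)
  have valid: "valid_edge q0 d" if "d \<in> F m" for d m using F(1) that gain_edge_valid by blast
  have mk: "row False ?z (gain_edge_of e) (\<alpha> 2) (\<lambda>x. cnj (\<alpha> 2 x)) = 0"
    "row True ?z (gain_edge_of e) (\<alpha> 1) (\<lambda>x. cnj (isotypic 0 a (rep x))) = 0" if "e \<in> arcs G" for e
    unfolding \<alpha>_def a_def by (rule motion_kernel[OF q mot that])+
  have kerF: "\<forall>d\<in>F False. row False ?z d (\<alpha> 2) (\<lambda>x. cnj (\<alpha> 2 x)) = 0"
    "\<forall>d\<in>F True. row True ?z d (\<alpha> 1) (\<lambda>x. cnj (isotypic 0 a (rep x))) = 0"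
    using mk F(1) by blast+
  have adm: "admissible False q0 (\<alpha> 2) (\<lambda>x. cnj (\<alpha> 2 x))"
    "admissible True q0 (\<alpha> 1) (\<lambda>x. cnj (isotypic 0 a (rep x)))"
    by (simp_all add: admissible_def \<alpha>_def)
  have rot: "admissible False q0 ?z (\<lambda>w. - cnj (?z w))"
    "\<forall>d\<in>F False. row False ?z d ?z (\<lambda>w. - cnj (?z w)) = 0"
  proof -
    show "admissible False q0 ?z (\<lambda>w. - cnj (?z w))" using z0 by (simp add: admissible_def)
    have "row False ?z d ?z (\<lambda>w. - cnj (?z w)) = 0" if "d \<in> F False" for d
      using row_rotation[OF valid[OF that], of ?z 1] by (simp del: row.simps)
    then show "\<forall>d\<in>F False. row False ?z d ?z (\<lambda>w. - cnj (?z w)) = 0" by blast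
  qed
  have trans: "admissible True q0 (\<lambda>_. 0) (\<lambda>_. 1)" "\<forall>d\<in>F True. row True ?z d (\<lambda>_. 0) (\<lambda>_. 1) = 0"
    using row_translation by (auto simp: admissible_def simp del: row.simps)
  define t where "t = \<alpha> 2 x1 / ?z x1"
  have t: "\<alpha> 2 x = t * ?z x" "cnj (\<alpha> 2 x) = - t * cnj (?z x)" if x: "x \<in> verts G" for x
  proof -
    have "\<alpha> 2 x = t * ?z x \<and> cnj (\<alpha> 2 x) = - t * cnj (?z x)"
    proof (cases "x = q0")
      case True
      then show ?thesis using z0 by (simp add: \<alpha>_def)
    next
      case False
      have "component (\<alpha> 2) (\<lambda>x. cnj (\<alpha> 2 x)) p = t * component ?z (\<lambda>w. - cnj (?z w)) p"
        if "p \<in> coords False q0 (verts G)" for p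
        using kernel_unique[OF finite_verts VF finF F(2,3) adm(1) kerF(1) rot, of "(x1, True)" p] that x1 zx[OF x1]
        by (simp add: coords_def component_def t_def)
      from this[of "(x, True)"] this[of "(x, False)"] show ?thesis
        using x False by (simp add: coords_def component_def)
    qed
    then show "\<alpha> 2 x = t * ?z x" "cnj (\<alpha> 2 x) = - t * cnj (?z x)" by auto
  qed
  define c where "c = cnj (isotypic 0 a (rep x1))"
  have c: "component (\<alpha> 1) (\<lambda>x. cnj (isotypic 0 a (rep x))) p = c * component (\<lambda>_. 0) (\<lambda>_. 1) p"
    if "p \<in> coords True q0 (verts G)" for p
    using kernel_unique[OF finite_verts VF finF F(2,3) adm(2) kerF(2) trans, of "(x1, False)" p] that x1
    by (simp add: coords_def component_def c_def)
  have c1: "isotypic 1 a (rep x) = 0" if "x \<in> verts G" for x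
    using c[of "(x, True)"] that al[of 1 x] by (cases "x = q0") (simp_all add: coords_def component_def \<alpha>_def)
  have c0: "isotypic 0 a (rep x) = cnj c" if "x \<in> verts G" for x
  proof -
    have "cnj (isotypic 0 a (rep x)) = c"
      using c[of "(x, False)"] that by (simp add: coords_def component_def)
    then show ?thesis by (metis complex_cnj_cnj)
  qed
  \<comment> \<open>The relations for \<open>\<alpha> 2\<close> and for its conjugate together give
    \<open>cnj t = - t\<close>, so component 2 is a rotation and not a dilation.\<close>
  have "cnj t * cnj (?z x1) = - t * cnj (?z x1)" using t[OF x1(1)] by (metis complex_cnj_mult)
  then have "cnj t = - t" using zx[OF x1] by (metis complex_cnj_zero_iff mult_cancel_right)
  then have "Re t = 0" by (simp add: complex_eq_iff)
  then have ti: "t = \<i> * of_real (Im t)" by (simp add: complex_eq_iff)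
  show "trivial_motion V q mt"
    unfolding trivial_motion_iff
  proof (intro exI ballI)
    fix v assume v: "v \<in> V"
    define x where "x = orb v"
    have x: "x \<in> verts G" "rep x \<in> V" using orb_vert[OF v] rep_in(2) by (auto simp: x_def)
    obtain g where g: "g \<in> carrier \<Gamma>" "v = \<phi> g (rep x)" using decompose[OF v] x_def by blast
    have i2: "isotypic 2 a v = character g * (t * ?z x)"
      using isotypic_values(1)[OF x(2) g(1), of a] al[of 2 x] x(1) t(1)[OF x(1)] g(2) by simp
    have i1: "isotypic 1 a v = 0"
      using isotypic_values(2)[OF x(2) g(1) c1[OF x(1)]] g(2) by simp
    have i0: "isotypic 0 a v = cnj c"
      using isotypic_values(3)[OF x(2) g(1), of a] c0[OF x(1)] g(2) by simp
    have Qv: "to_complex (q v) = character g * ?z x"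
      using symmetric_position(1)[OF q g(1) x(2)] symmetric_position(2)[OF q x(1)] g(2) by simp
    have "3 * a v = cnj c + t * to_complex (q v)"
      unfolding isotypic_sum[OF v, symmetric] i2 i1 i0 Qv by simp
    then have "a v = (cnj c + t * to_complex (q v)) / 3" by (simp add: eq_divide_eq mult.commute)
    then have "a v = t / 3 * to_complex (q v) + cnj c / 3" by (simp add: add_divide_distrib)
    then show "to_complex (mt v) = \<i> * of_real (Im t / 3) * to_complex (q v) + cnj c / 3"
      unfolding a_def using ti by (metis of_real_divide of_real_numeral times_divide_eq_right)
  qed
qed

lemma sum_orbit_character:
  assumes "i = 1 \<or> i = 2"
  shows "(\<Sum>g\<in>carrier \<Gamma>. character g ^ i * k + c) = 3 * (c :: complex)"
proof -
  have "(\<Sum>g\<in>carrier \<Gamma>. character g ^ i * k + c) = (\<Sum>g\<in>carrier \<Gamma>. character g ^ i) * k + of_nat (card (carrier \<Gamma>)) * c"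
    by (simp add: sum.distrib sum_distrib_right)
  also have "(\<Sum>g\<in>carrier \<Gamma>. character g ^ i) = 0" using assms character_sums by auto
  finally show ?thesis using order3 by simp
qed

text \<open>The values at the representatives are spread over the orbits by the factors. This is
  well defined: at a free vertex the group element is unique, and at the fixed one an admissible
  value is zero or has factor 1.\<close>

lemma lift_kernel:
  assumes q: "C3_symmetric \<Gamma> \<tau> \<phi> V q" and adm: "admissible m q0 \<alpha> \<beta>"
    and ker: "\<forall>e\<in>arcs G. row m (position q) (gain_edge_of e) \<alpha> \<beta> = 0"
  shows "\<exists>a b. (\<forall>x\<in>verts G. a (rep x) = \<alpha> x \<and> b (rep x) = \<beta> x) \<and>
    (\<forall>g\<in>carrier \<Gamma>. \<forall>v\<in>V. a (\<phi> g v) = a_factor m (character g) * a v \<and>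
      b (\<phi> g v) = b_factor m (character g) * b v) \<and>
    (\<forall>u v. {u, v} \<in> E \<longrightarrow> cnj (to_complex (q u) - to_complex (q v)) * (a u - a v) +
       (to_complex (q u) - to_complex (q v)) * (b u - b v) = 0)"
proof -
  define sel where "sel = (\<lambda>v. SOME g. g \<in> carrier \<Gamma> \<and> v = \<phi> g (rep (orb v)))"
  have sel: "sel v \<in> carrier \<Gamma>" "\<phi> (sel v) (rep (orb v)) = v" if "v \<in> V" for v
    using someI_ex[of "\<lambda>g. g \<in> carrier \<Gamma> \<and> v = \<phi> g (rep (orb v))"] decompose[OF that] unfolding sel_def by metis+
  define a where "a = (\<lambda>v. a_factor m (character (sel v)) * \<alpha> (orb v))"
  define b where "b = (\<lambda>v. b_factor m (character (sel v)) * \<beta> (orb v))"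
  have ab: "a (\<phi> g (rep x)) = a_factor m (character g) * \<alpha> x \<and> b (\<phi> g (rep x)) = b_factor m (character g) * \<beta> x"
    if x: "x \<in> verts G" and g: "g \<in> carrier \<Gamma>" for x g
  proof -
    let ?v = "\<phi> g (rep x)"
    have rV: "rep x \<in> V" using rep_in(2)[OF x] .
    have vV: "?v \<in> V" using phi_in[OF g rV] .
    have ox: "orb ?v = x"
      using orb_eq(1)[OF rV, of ?v] rep_in(3)[OF x] g by (auto simp: Group_Action.orbit_def)
    have s: "sel ?v \<in> carrier \<Gamma>" "\<phi> (sel ?v) (rep x) = ?v" using sel[OF vV] ox by auto
    show ?thesis
    proof (cases "x = q0")
      case True
      then show ?thesis using adm ox by (auto simp: a_def b_def admissible_def b_factor_def)
    next
      case False
      have "\<phi> (inv\<^bsub>\<Gamma>\<^esub> g \<otimes>\<^bsub>\<Gamma>\<^esub> sel ?v) (rep x) = rep x"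
        using phi_mult[of "inv\<^bsub>\<Gamma>\<^esub> g" "sel ?v" "rep x"] s g rV phi_inv[OF g rV] by simp
      then have "inv\<^bsub>\<Gamma>\<^esub> g \<otimes>\<^bsub>\<Gamma>\<^esub> sel ?v = \<one>\<^bsub>\<Gamma>\<^esub>"
        using not_fixed[OF rV] fixed_iff_q0[OF x] False g s(1) by (metis inv_closed m_closed)
      then have "sel ?v = g" using g s(1) by (metis inv_closed inv_equality inv_inv)
      then show ?thesis using ox by (simp add: a_def b_def)
    qed
  qed
  have rep: "a (rep x) = \<alpha> x \<and> b (rep x) = \<beta> x" if x: "x \<in> verts G" for x
    using ab[OF x one_closed] phi_one[OF rep_in(2)[OF x]] character_one
    by (simp add: a_factor_def b_factor_def)
  have equi: "a (\<phi> h v) = a_factor m (character h) * a v \<and> b (\<phi> h v) = b_factor m (character h) * b v"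
    if h: "h \<in> carrier \<Gamma>" and v: "v \<in> V" for h v
  proof -
    let ?x = "orb v"
    have x: "?x \<in> verts G" by (rule orb_vert[OF v])
    obtain g where g: "g \<in> carrier \<Gamma>" "v = \<phi> g (rep ?x)" by (rule decompose[OF v])
    have "\<phi> h v = \<phi> (h \<otimes>\<^bsub>\<Gamma>\<^esub> g) (rep ?x)" using phi_mult[OF h g(1) rep_in(2)[OF x]] g(2) by simp
    then show ?thesis
      using ab[OF x, of "h \<otimes>\<^bsub>\<Gamma>\<^esub> g"] ab[OF x g(1)] g h
      by (simp add: character_mult a_factor_mult b_factor_mult)
  qed
  have edge: "cnj (to_complex (q u) - to_complex (q v)) * (a u - a v) +
       (to_complex (q u) - to_complex (q v)) * (b u - b v) = 0" if uv: "{u, v} \<in> E" for u v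
  proof -
    define e where "e = Group_Action.orbit \<Gamma> (\<lambda>g e. \<phi> g ` e) {u, v}"
    have e: "e \<in> arcs G" using uv by (auto simp: e_def arcs_eq orbits_def)
    note ae = arc_edge[OF e]
    let ?u = "rep (tail G e)" and ?w = "\<phi> (\<psi> e) (rep (head G e))"
    have V: "?u \<in> V" "rep (head G e) \<in> V" "?w \<in> V" "u \<in> V" "v \<in> V"
      using rep_in(2) ae phi_in edge_verts[OF uv] by auto
    obtain g where g: "g \<in> carrier \<Gamma>" "{?u, ?w} = {\<phi> g u, \<phi> g v}"
      using ae(4) by (auto simp: e_def Group_Action.orbit_def)
    define R where "R = (\<lambda>u v. cnj (to_complex (q u) - to_complex (q v)) * (a u - a v) +
       (to_complex (q u) - to_complex (q v)) * (b u - b v))"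
    have sym: "R u v = R v u" for u v by (simp add: R_def algebra_simps)
    have "R ?u ?w = row m (position q) (gain_edge_of e) \<alpha> \<beta>"
      unfolding R_def arc_vector[OF q e] gain_edge_of_def row.simps
      using equi[OF ae(3) V(2)] rep[OF ae(1)] rep[OF ae(2)] by simp
    then have "R ?u ?w = 0" using ker e by simp
    then have "R (\<phi> g u) (\<phi> g v) = 0" using g(2) sym by (auto simp: doubleton_eq_iff)
    moreover have "R (\<phi> g u) (\<phi> g v) = character g * b_factor m (character g) * R u v"
    proof -
      note C = cube_root_facts[OF character_cube[OF g(1)]]
      have D: "to_complex (q (\<phi> g u)) - to_complex (q (\<phi> g v)) = character g * (to_complex (q u) - to_complex (q v))"
        using symmetric_position(1)[OF q g(1)] V by (simp add: right_diff_distrib)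
      have "cnj (character g) * a_factor m (character g) = character g * b_factor m (character g)"
      proof -
        have "cnj (character g) * character g ^ 2 = character g"
          using C(4) by (simp add: power2_eq_square mult.assoc[symmetric])
        then show ?thesis by (simp add: a_factor_def mult.assoc[symmetric])
      qed
      then have "cnj (character g * d) * (a_factor m (character g) * s) + character g * d * (b_factor m (character g) * t)
          = character g * b_factor m (character g) * (cnj d * s + d * t)" for d s t
        by (simp add: algebra_simps)
      from this[of "to_complex (q u) - to_complex (q v)" "a u - a v" "b u - b v"] show ?thesis
        unfolding R_def D using equi[OF g(1) V(4)] equi[OF g(1) V(5)] by (simp add: right_diff_distrib)
    qed
    moreover have "character g * b_factor m (character g) \<noteq> 0"
      using character_nonzero[OF g(1)] factor_nonzero(1) by simp
    ultimately have "R u v = 0" by simp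
    then show ?thesis by (simp add: R_def)
  qed
  show ?thesis using rep equi edge by (intro exI[of _ a] exI[of _ b]) simp
qed

text \<open>The lifted kernel vector is a complex combination of real motions, hence by rigidity a
  complex rotation with a translation in each coordinate. Equivariance leaves only the trivial
  motion of the block, and \<open>(x1, \<not> m)\<close> detects it: the rotation through
  \<open>a\<close> for the trivial character, the translation through \<open>b\<close>
  otherwise.\<close>

lemma kernel_of_rigid:
  assumes q: "C3_symmetric \<Gamma> \<tau> \<phi> V q" and rigid: "infinitesimally_rigid V E q"
    and sep: "separated q0 (verts G) (position q)" and x1: "x1 \<in> verts G" "x1 \<noteq> q0"
    and adm: "admissible m q0 \<alpha> \<beta>"
    and ker: "\<forall>e\<in>arcs G. row m (position q) (gain_edge_of e) \<alpha> \<beta> = 0"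
    and p0: "component \<alpha> \<beta> (x1, \<not> m) = 0" and p: "p \<in> coords m q0 (verts G)"
  shows "component \<alpha> \<beta> p = 0"
proof -
  let ?Q = "\<lambda>v. to_complex (q v)" and ?z = "position q"
  obtain a b where rep: "\<forall>x\<in>verts G. a (rep x) = \<alpha> x \<and> b (rep x) = \<beta> x"
    and eab: "\<forall>g\<in>carrier \<Gamma>. \<forall>v\<in>V. a (\<phi> g v) = a_factor m (character g) * a v \<and>
      b (\<phi> g v) = b_factor m (character g) * b v"
    and edge: "\<forall>u v. {u, v} \<in> E \<longrightarrow> cnj (?Q u - ?Q v) * (a u - a v) + (?Q u - ?Q v) * (b u - b v) = 0"
    using lift_kernel[OF q adm ker] by blast
  have ea: "a (\<phi> g v) = a_factor m (character g) * a v" and eb: "b (\<phi> g v) = b_factor m (character g) * b v"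
    if "g \<in> carrier \<Gamma>" "v \<in> V" for g v using eab that by auto
  text \<open>Both \<open>(a, b)\<close> and \<open>(\<i> a, \<i> b)\<close> have a real part, which is a motion.\<close>
  have real: "\<exists>s t. \<forall>v\<in>V. k * a v + cnj (k * b v) = \<i> * of_real s * ?Q v + t" for k
  proof -
    have "infinitesimal_motion E q (\<lambda>v. of_complex (k * a v + cnj (k * b v)))"
      unfolding infinitesimal_motion_iff to_of_complex
    proof (intro allI impI)
      fix u v assume "{u, v} \<in> E"
      define D A B where "D = ?Q u - ?Q v" and "A = a u - a v" and "B = b u - b v"
      have "cnj D * A + D * B = 0" using edge \<open>{u, v} \<in> E\<close> unfolding D_def A_def B_def by blast
      then have "k * (cnj D * A + D * B) + cnj (k * (cnj D * A + D * B)) = 0" by simp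
      then have "cnj D * (k * A + cnj (k * B)) + D * cnj (k * A + cnj (k * B)) = 0"
        by (simp add: algebra_simps)
      moreover have "k * a u + cnj (k * b u) - (k * a v + cnj (k * b v)) = k * A + cnj (k * B)"
        by (simp add: A_def B_def algebra_simps)
      ultimately show "cnj (?Q u - ?Q v) * (k * a u + cnj (k * b u) - (k * a v + cnj (k * b v))) +
          (?Q u - ?Q v) * cnj (k * a u + cnj (k * b u) - (k * a v + cnj (k * b v))) = 0"
        unfolding D_def[symmetric] by (simp only:)
    qed
    then show ?thesis using rigid unfolding infinitesimally_rigid_def trivial_motion_iff by fastforce
  qed
  obtain s1 t1 where r1: "\<forall>v\<in>V. 1 * a v + cnj (1 * b v) = \<i> * of_real s1 * ?Q v + t1" using real by blast
  obtain s2 t2 where r2: "\<forall>v\<in>V. \<i> * a v + cnj (\<i> * b v) = \<i> * of_real s2 * ?Q v + t2" using real by blast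
  \<comment> \<open>The two relations for \<open>a\<close> and \<open>cnj b\<close> are solved:
    \<open>\<mu>\<close> is the coefficient of the rotation, \<open>c\<close> and \<open>d\<close>
    are the translations of \<open>a\<close> and \<open>b\<close>.\<close>
  define \<mu> where "\<mu> = (\<i> * of_real s1 + of_real s2) / 2"
  define c where "c = (t1 - \<i> * t2) / 2"
  define d where "d = (cnj t1 - \<i> * cnj t2) / 2"
  have av: "a v = \<mu> * ?Q v + c" and bv: "b v = - \<mu> * cnj (?Q v) + d" if v: "v \<in> V" for v
  proof -
    have 1: "a v + cnj (b v) = \<i> * of_real s1 * ?Q v + t1" using r1 v by simp
    have 2: "\<i> * a v - \<i> * cnj (b v) = \<i> * of_real s2 * ?Q v + t2" using r2 v by simp
    have "2 * a v = (a v + cnj (b v)) - \<i> * (\<i> * a v - \<i> * cnj (b v))" by (simp add: algebra_simps)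
    also have "\<dots> = 2 * (\<mu> * ?Q v + c)" unfolding 1 2 by (simp add: \<mu>_def c_def field_simps)
    finally show "a v = \<mu> * ?Q v + c" by (metis mult_cancel_left zero_neq_numeral)
    have "2 * cnj (b v) = (a v + cnj (b v)) + \<i> * (\<i> * a v - \<i> * cnj (b v))" by (simp add: algebra_simps)
    also have "\<dots> = 2 * cnj (- \<mu> * cnj (?Q v) + d)" unfolding 1 2 by (simp add: \<mu>_def d_def field_simps)
    finally have "cnj (b v) = cnj (- \<mu> * cnj (?Q v) + d)" by (metis mult_cancel_left zero_neq_numeral)
    then show "b v = - \<mu> * cnj (?Q v) + d" by (simp only: complex_cnj_cancel_iff)
  qed
  define r where "r = rep x1"
  have r: "r \<in> V" using rep_in(2)[OF x1(1)] by (simp add: r_def)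
  have Qr: "?Q r = ?z x1" using symmetric_position(2)[OF q x1(1)] by (simp add: r_def)
  have zx1: "?z x1 \<noteq> 0" by (rule separated_nonzero[OF sep x1])
  have Qg: "?Q (\<phi> g r) = character g * ?Q r" if "g \<in> carrier \<Gamma>" for g
    by (rule symmetric_position(1)[OF q that r])
  have af: "a_factor m (character g) = (if m then character g ^ 2 else character g ^ 1)"
    "b_factor m (character g) = (if m then 1 else character g ^ 2)" if "g \<in> carrier \<Gamma>" for g
    using cube_root_facts[OF character_cube[OF that]] character_cube[OF that]
    by (simp_all add: a_factor_def b_factor_def power2_eq_square power3_eq_cube mult_ac)
  have c0: "c = 0"
  proof -
    \<comment> \<open>Of the two expressions for the sum of \<open>a\<close> over the orbit, one
      leaves \<open>3 * c\<close> and the other 0, as all other terms carry a nontrivial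
      character.\<close>
    have "3 * c = (\<Sum>g\<in>carrier \<Gamma>. character g ^ 1 * (\<mu> * ?Q r) + c)" by (rule sum_orbit_character[symmetric]) simp
    also have "\<dots> = (\<Sum>g\<in>carrier \<Gamma>. character g ^ (if m then 2 else 1) * a r + 0)"
    proof (rule sum.cong)
      fix g assume g: "g \<in> carrier \<Gamma>"
      have "character g ^ 1 * (\<mu> * ?Q r) + c = a (\<phi> g r)"
        using av[OF phi_in[OF g r]] Qg[OF g] by simp
      also have "\<dots> = character g ^ (if m then 2 else 1) * a r" using ea[OF g r] af(1)[OF g] by simp
      finally show "character g ^ 1 * (\<mu> * ?Q r) + c = character g ^ (if m then 2 else 1) * a r + 0" by simp
    qed simp
    also have "\<dots> = 3 * 0" by (rule sum_orbit_character) simp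
    finally show ?thesis by simp
  qed
  have "component \<alpha> \<beta> (x, k) = 0" if x: "x \<in> verts G" for x k
  proof (cases m)
    case True
    \<comment> \<open>A rotation changes by \<open>character \<gamma>\<close>, while equivariance
      demands \<open>character \<gamma> ^ 2\<close>.\<close>
    have "a (\<phi> \<gamma> r) = character \<gamma> * (\<mu> * ?Q r)" using av[OF phi_in[OF gen(1) r]] Qg[OF gen(1)] c0 by simp
    moreover have "a (\<phi> \<gamma> r) = character \<gamma> ^ 2 * (\<mu> * ?Q r)"
      using ea[OF gen(1) r] af(1)[OF gen(1)] av[OF r] c0 True by simp
    ultimately have "character \<gamma> * (\<mu> * ?Q r) * (character \<gamma> - 1) = 0"
      by (simp add: algebra_simps power2_eq_square)
    moreover have "character \<gamma> \<noteq> 0" "character \<gamma> \<noteq> 1" using character_gamma cis_cube(2) by simp_all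
    ultimately have mu: "\<mu> = 0" using Qr zx1 by simp
    have "b r = 0" using p0 True rep x1(1) by (simp add: component_def r_def)
    then have "d = 0" using bv[OF r] mu by simp
    then show ?thesis using rep x av[OF rep_in(2)[OF x]] bv[OF rep_in(2)[OF x]] mu c0
      by (simp add: component_def)
  next
    case False
    have "a r = 0" using p0 False rep x1(1) by (simp add: component_def r_def)
    then have mu: "\<mu> = 0" using av[OF r] c0 Qr zx1 by simp
    have "3 * d = (\<Sum>g\<in>carrier \<Gamma>. character g ^ 2 * b r + 0)"
    proof -
      have "(\<Sum>g\<in>carrier \<Gamma>. character g ^ 2 * b r + 0) = (\<Sum>g\<in>carrier \<Gamma>. d)"
      proof (rule sum.cong)
        fix g assume g: "g \<in> carrier \<Gamma>"
        have "character g ^ 2 * b r = b (\<phi> g r)" using eb[OF g r] af(2)[OF g] False by simp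
        then show "character g ^ 2 * b r + 0 = d" using bv[OF phi_in[OF g r]] mu by simp
      qed simp
      then show ?thesis using order3 by simp
    qed
    also have "\<dots> = 3 * 0" by (rule sum_orbit_character) simp
    finally have "d = 0" by simp
    then show ?thesis using rep x av[OF rep_in(2)[OF x]] bv[OF rep_in(2)[OF x]] mu c0
      by (simp add: component_def)
  qed
  then show ?thesis using p by (cases p) (auto simp: coords_def)
qed

end

section \<open>Generic configurations and symmetric frameworks\<close>

lemma finite_cube_roots: "finite {g :: complex. g ^ 3 = 1}"
proof -
  have "finite {g :: complex. poly (monom 1 3 - 1) g = 0}"
  proof (rule poly_roots_finite)
    have "coeff (monom 1 3 - 1 :: complex poly) 3 = 1" by (simp add: coeff_1)
    then show "(monom 1 3 - 1 :: complex poly) \<noteq> 0" by (metis coeff_0 zero_neq_one)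
  qed
  then show ?thesis by (simp add: poly_monom)
qed

text \<open>Separation is itself a finite list of generic conditions, one for each pair of vertices
  and each cube root of unity.\<close>

lemma separated_generic:
  assumes fin: "finite U" "finite \<Phi>" and \<Phi>: "\<And>f. f \<in> \<Phi> \<Longrightarrow> line_polynomial f"
    "\<And>f. f \<in> \<Phi> \<Longrightarrow> \<exists>z. z q0 = 0 \<and> f z \<noteq> 0"
  shows "\<exists>z. separated q0 U z \<and> (\<forall>f\<in>\<Phi>. f z \<noteq> 0)"
proof -
  let ?W = "insert q0 U"
  define S where "S = (\<lambda>(u, v, g) z. z u - g * z v) ` {(u, v, g). u \<in> ?W \<and> v \<in> ?W \<and> u \<noteq> v \<and> g ^ 3 = (1::complex)}"
  have "finite {(u, v, g). u \<in> ?W \<and> v \<in> ?W \<and> u \<noteq> v \<and> g ^ 3 = (1::complex)}"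
    by (rule finite_subset[of _ "?W \<times> ?W \<times> {g. g ^ 3 = 1}"]) (use fin finite_cube_roots in auto)
  then have "finite S" by (simp add: S_def)
  moreover have "line_polynomial f \<and> (\<exists>z. z q0 = 0 \<and> f z \<noteq> 0)" if fS: "f \<in> S" for f
  proof -
    obtain u v g where f: "f = (\<lambda>z. z u - g * z v)" "u \<noteq> v" "g ^ 3 = 1" using fS by (auto simp: S_def)
    have "g \<noteq> 0" using cube_root_facts(1)[OF f(3)] .
    have "\<exists>z. z q0 = 0 \<and> f z \<noteq> 0"
    proof (cases "u = q0")
      case True
      then show ?thesis using f \<open>g \<noteq> 0\<close> by (intro exI[of _ "\<lambda>w. of_bool (w = v) :: complex"]) auto
    next
      case False
      then show ?thesis using f by (intro exI[of _ "\<lambda>w. of_bool (w = u) :: complex"]) auto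
    qed
    moreover have "line_polynomial f"
      unfolding f by (intro line_polynomial_diff line_polynomial_mult line_polynomial_const line_polynomial_coord)
    ultimately show ?thesis by blast
  qed
  ultimately obtain z where z: "z q0 = 0" "\<forall>f\<in>\<Phi> \<union> S. f z \<noteq> 0"
    using line_polynomials_common_nonzero[of "\<Phi> \<union> S" q0] fin \<Phi> by blast
  have "separated q0 U z"
    unfolding separated_def
  proof (intro conjI z(1) ballI allI impI)
    fix u v and g :: complex assume "u \<in> ?W" "v \<in> ?W" "u \<noteq> v" "g ^ 3 = 1"
    then have "(\<lambda>z. z u - g * z v) \<in> S" by (force simp: S_def)
    then have "(\<lambda>z. z u - g * z v) \<in> \<Phi> \<union> S" by (rule UnI2)
    with z(2) have "(\<lambda>z. z u - g * z v) z \<noteq> 0" by (rule bspec)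
    then show "z u \<noteq> g * z v" by simp
  qed
  then show ?thesis using z by blast
qed

text \<open>Barycentric coordinates with respect to the vertices \<open>a, w a, w\<^sup>2 a\<close> of a regular triangle.\<close>

lemma affine_hull_triangle:
  assumes w: "w ^ 3 = 1" "w \<noteq> 1" and a: "a \<noteq> 0"
  shows "affine hull {of_complex a, of_complex (w * a), of_complex (w ^ 2 * a)} = UNIV"
proof -
  note W = cube_root_facts[OF w(1)]
  have "(w - 1) * (1 + w + w ^ 2) = 0"
    using w(1) by (simp add: algebra_simps power2_eq_square power3_eq_cube)
  then have s: "1 + w + w ^ 2 = 0" using w(2) by simp
  have "y \<in> affine hull {of_complex a, of_complex (w * a), of_complex (w ^ 2 * a)}" for y
  proof -
    define \<alpha> where "\<alpha> = to_complex y / a"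
    \<comment> \<open>Fourier inversion over the cube roots of unity: over \<open>1\<close>,
      \<open>w\<close>, \<open>w ^ 2\<close> the sum of \<open>u c\<close> is 1 and that of
      \<open>u c * c\<close> is \<open>\<alpha>\<close>.\<close>
    define u where "u = (\<lambda>c. (1 + 2 * Re (\<alpha> * cnj c)) / 3)"
    have uc: "complex_of_real (u c) = (1 + \<alpha> * cnj c + cnj \<alpha> * c) / 3" for c
      by (simp add: u_def complex_eq_iff)
    have c: "cnj w = w ^ 2" "cnj (w ^ 2) = w"
    proof -
      show "cnj w = w ^ 2" using W by simp
      then have "cnj (w ^ 2) = w ^ 3 * w" by (simp add: power2_eq_square power3_eq_cube)
      then show "cnj (w ^ 2) = w" using w(1) by simp
    qed
    have w2: "w ^ 2 = - 1 - w" using s by (simp add: eq_neg_iff_add_eq_0 algebra_simps)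
    have "complex_of_real (u 1 + u w + u (w ^ 2)) = (3 + (\<alpha> + cnj \<alpha>) * (1 + w + w ^ 2)) / 3"
      unfolding of_real_add uc c by (simp add: algebra_simps add_divide_distrib)
    then have "complex_of_real (u 1 + u w + u (w ^ 2)) = 1" unfolding s by simp
    then have sum: "u 1 + u w + u (w ^ 2) = 1" by (simp only: of_real_eq_1_iff)
    have "complex_of_real (u 1) * 1 + u w * w + u (w ^ 2) * w ^ 2 =
        ((1 + w + w ^ 2) + \<alpha> * (1 + w ^ 3 + w ^ 3) + cnj \<alpha> * (1 + w ^ 2 + w ^ 3 * w)) / 3"
      unfolding uc c by (simp add: algebra_simps add_divide_distrib power2_eq_square power3_eq_cube)
    also have "1 + w ^ 2 + w ^ 3 * w = 1 + w + w ^ 2" using w(1) by simp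
    finally have "complex_of_real (u 1) * 1 + u w * w + u (w ^ 2) * w ^ 2 = \<alpha>" unfolding s w(1) by simp
    then have "\<alpha> * a = (complex_of_real (u 1) * 1 + u w * w + u (w ^ 2) * w ^ 2) * a" by simp
    moreover have "\<alpha> * a = to_complex y" using a by (simp add: \<alpha>_def)
    ultimately have "to_complex y = to_complex (u 1 *\<^sub>R of_complex a + u w *\<^sub>R of_complex (w * a) + u (w ^ 2) *\<^sub>R of_complex (w ^ 2 * a))"
      by (simp add: algebra_simps)
    then have "y = u 1 *\<^sub>R of_complex a + u w *\<^sub>R of_complex (w * a) + u (w ^ 2) *\<^sub>R of_complex (w ^ 2 * a)"
      by (simp only: to_complex_inject)
    then show ?thesis unfolding affine_hull_3 using sum by blast
  qed
  then show ?thesis by blast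
qed

context c3_graph
begin

text \<open>Each orbit is placed at the rotated copies of its value of \<open>z\<close>. Separation
  makes this injective, and one free orbit is a regular triangle, which spans the plane.\<close>

lemma realize:
  assumes sep: "separated q0 (verts G) z" and x1: "x1 \<in> verts G" "x1 \<noteq> q0"
  shows "\<exists>q. C3_symmetric \<Gamma> \<tau> \<phi> V q \<and> framework V E q \<and> (\<forall>x\<in>insert q0 (verts G). position q x = z x)"
proof -
  have z0: "z q0 = 0" using sep by (simp add: separated_def)
  have ex: "\<exists>g. g \<in> carrier \<Gamma> \<and> v = \<phi> g (rep (orb v))" if "v \<in> V" for v using decompose[OF that] by blast
  define sel where "sel = (\<lambda>v. SOME g. g \<in> carrier \<Gamma> \<and> v = \<phi> g (rep (orb v)))"
  have sel: "sel v \<in> carrier \<Gamma>" "v = \<phi> (sel v) (rep (orb v))" if "v \<in> V" for v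
    using someI_ex[OF ex[OF that]] unfolding sel_def by blast+
  define q where "q = (\<lambda>v. of_complex (character (sel v) * z (orb v)))"
  have val: "to_complex (q (\<phi> g (rep x))) = character g * z x" if x: "x \<in> verts G" and g: "g \<in> carrier \<Gamma>" for x g
  proof -
    let ?v = "\<phi> g (rep x)"
    have rV: "rep x \<in> V" using rep_in(2)[OF x] .
    have vV: "?v \<in> V" using phi_in[OF g rV] .
    have ox: "orb ?v = x"
      using orb_eq(1)[OF rV, of ?v] rep_in(3)[OF x] g by (auto simp: Group_Action.orbit_def)
    have s: "sel ?v \<in> carrier \<Gamma>" "\<phi> (sel ?v) (rep x) = ?v" using sel[OF vV] ox by auto
    show ?thesis
    proof (cases "x = q0")
      case True
      then show ?thesis using z0 ox by (simp add: q_def)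
    next
      case False
      have "\<phi> (inv\<^bsub>\<Gamma>\<^esub> g \<otimes>\<^bsub>\<Gamma>\<^esub> sel ?v) (rep x) = rep x"
        using phi_mult[of "inv\<^bsub>\<Gamma>\<^esub> g" "sel ?v" "rep x"] s g rV phi_inv[OF g rV] by simp
      then have "inv\<^bsub>\<Gamma>\<^esub> g \<otimes>\<^bsub>\<Gamma>\<^esub> sel ?v = \<one>\<^bsub>\<Gamma>\<^esub>"
        using not_fixed[OF rV] fixed_iff_q0[OF x] False g s(1) by (metis inv_closed m_closed)
      then have "sel ?v = g" using g s(1) by (metis inv_closed inv_equality inv_inv)
      then show ?thesis using ox by (simp add: q_def)
    qed
  qed
  have sym: "C3_symmetric \<Gamma> \<tau> \<phi> V q"
    unfolding C3_symmetric_def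
  proof (intro ballI)
    fix g v assume g: "g \<in> carrier \<Gamma>" and v: "v \<in> V"
    have x: "orb v \<in> verts G" by (rule orb_vert[OF v])
    obtain h where h: "h \<in> carrier \<Gamma>" "v = \<phi> h (rep (orb v))" using ex[OF v] by blast
    have "\<phi> g v = \<phi> (g \<otimes>\<^bsub>\<Gamma>\<^esub> h) (rep (orb v))" using phi_mult[OF g h(1) rep_in(2)[OF x]] h(2) by simp
    then have "to_complex (q (\<phi> g v)) = character g * to_complex (q v)"
      using val[OF x, of "g \<otimes>\<^bsub>\<Gamma>\<^esub> h"] val[OF x h(1)] h g by (simp add: character_mult)
    then have "to_complex (\<tau> g *v q v) = to_complex (q (\<phi> g v))" using tau_character[OF g] by simp
    then show "\<tau> g *v q v = q (\<phi> g v)" by (simp only: to_complex_inject)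
  qed
  have pos: "\<forall>x\<in>insert q0 (verts G). position q x = z x"
  proof
    fix x assume "x \<in> insert q0 (verts G)"
    then consider "x = q0" | "x \<in> verts G" "x \<noteq> q0" by auto
    then show "position q x = z x"
    proof cases
      case 2
      then show ?thesis
        using val[OF 2(1) one_closed] phi_one[OF rep_in(2)[OF 2(1)]] character_one by (simp add: position_def)
    qed (simp add: position_def z0)
  qed
  have "inj_on q V"
  proof (rule inj_onI)
    fix v w assume v: "v \<in> V" and w: "w \<in> V" and eq: "q v = q w"
    obtain g where g: "g \<in> carrier \<Gamma>" "v = \<phi> g (rep (orb v))" using ex[OF v] by blast
    obtain h where h: "h \<in> carrier \<Gamma>" "w = \<phi> h (rep (orb w))" using ex[OF w] by blast
    have x: "orb v \<in> verts G" "orb w \<in> verts G" using orb_vert v w by auto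
    have e: "character g * z (orb v) = character h * z (orb w)"
      using val[OF x(1) g(1)] val[OF x(2) h(1)] g(2) h(2) eq by simp
    have "z (orb v) = (inverse (character g) * character h) * z (orb w)"
      using e character_nonzero[OF g(1)] by (simp add: field_simps)
    moreover have "(inverse (character g) * character h) ^ 3 = 1"
      using character_cube[OF g(1)] character_cube[OF h(1)] by (simp add: power_mult_distrib power_inverse)
    ultimately have same: "orb v = orb w" using sep x unfolding separated_def by (metis insertCI)
    show "v = w"
    proof (cases "orb v = q0")
      case True
      then have "fixed (rep (orb v))" using fixed_iff_q0[OF x(1)] by simp
      then show ?thesis using g h same by (simp add: fixed_def)
    next
      case False
      then have "z (orb v) \<noteq> 0" using separated_nonzero[OF sep x(1)] by blast
      then have "character g = character h" using e same by simp
      then have "g = h" using character_inj g(1) h(1) by (auto simp: inj_on_def)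
      then show ?thesis using g h same by simp
    qed
  qed
  moreover have "affine hull (q ` V) = UNIV"
  proof -
    have r: "rep x1 \<in> V" using rep_in(2)[OF x1(1)] .
    have zx: "z x1 \<noteq> 0" by (rule separated_nonzero[OF sep x1])
    have in_qV: "of_complex (character g * z x1) \<in> q ` V" if g: "g \<in> carrier \<Gamma>" for g
    proof -
      have "q (\<phi> g (rep x1)) = of_complex (character g * z x1)"
        using val[OF x1(1) g] by (metis to_of_complex(2))
      then show ?thesis using phi_in[OF g r] by (metis imageI)
    qed
    let ?w = "character \<gamma>"
    have "{of_complex (z x1), of_complex (?w * z x1), of_complex (?w ^ 2 * z x1)} \<subseteq> q ` V"
      using in_qV[OF one_closed] in_qV[OF gen(1)] in_qV[of "\<gamma> \<otimes>\<^bsub>\<Gamma>\<^esub> \<gamma>"] gen(1) character_one character_mult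
      by (simp add: power2_eq_square)
    then have "affine hull {of_complex (z x1), of_complex (?w * z x1), of_complex (?w ^ 2 * z x1)} \<subseteq> affine hull (q ` V)"
      by (rule hull_mono)
    then show ?thesis
      using affine_hull_triangle[of ?w "z x1"] zx character_cube[OF gen(1)] character_gamma cis_cube(2) by auto
  qed
  ultimately have "framework V E q" using simple by (simp add: framework_def)
  then show ?thesis using sym pos by blast
qed

text \<open>Symmetry puts the fixed vertex at the origin, and a single point does not span the
  plane.\<close>

lemma free_vertex:
  assumes "framework V E q" "C3_symmetric \<Gamma> \<tau> \<phi> V q"
  shows "\<exists>x\<in>verts G. x \<noteq> q0"
proof -
  obtain u v where uv: "u \<in> V" "v \<in> V" "q u \<noteq> q v" by (rule two_points[OF assms(1)])
  have "q v = 0" if v: "v \<in> V" and "orb v = q0" for v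
  proof -
    have x: "orb v \<in> verts G" by (rule orb_vert[OF v])
    have "fixed (rep (orb v))" using fixed_iff_q0[OF x] that by simp
    then have "v = rep (orb v)" using decompose[OF v] by (metis fixed_def)
    then have "to_complex (q v) = position q q0" using symmetric_position(2)[OF assms(2) x] that(2) by simp
    then have "to_complex (q v) = to_complex 0" by (simp add: position_def)
    then show ?thesis by (simp only: to_complex_inject)
  qed
  then have "orb u \<noteq> q0 \<or> orb v \<noteq> q0" using uv by metis
  then show ?thesis using orb_vert uv by blast
qed

text \<open>Needed because \<open>separated\<close> quantifies over all complex cube roots of unity:
  each of them is a rotation of the group.\<close>

lemma cube_root_character: "g ^ 3 = 1 \<Longrightarrow> \<exists>k\<in>carrier \<Gamma>. character k = g"
proof -
  assume g: "g ^ 3 = 1"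
  let ?w = "character \<gamma>"
  have w: "?w ^ 3 = 1" "?w \<noteq> 1" using character_cube[OF gen(1)] character_gamma cis_cube(2) by auto
  have "(?w - 1) * (1 + ?w + ?w ^ 2) = 0"
    using w(1) by (simp add: algebra_simps power2_eq_square power3_eq_cube)
  then have s: "1 + ?w + ?w ^ 2 = 0" using w(2) by simp
  have "(g - 1) * (g - ?w) * (g - ?w ^ 2) = g ^ 3 - g ^ 2 * (1 + ?w + ?w ^ 2) + g * (?w + ?w ^ 2 + ?w ^ 3) - ?w ^ 3"
    by (simp add: algebra_simps power2_eq_square power3_eq_cube)
  also have "?w + ?w ^ 2 + ?w ^ 3 = 0" using s w(1) by (simp add: algebra_simps)
  finally have "(g - 1) * (g - ?w) * (g - ?w ^ 2) = 0" using g w(1) s by simp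
  then have "g = 1 \<or> g = ?w \<or> g = ?w ^ 2" by auto
  moreover have "character (\<gamma> \<otimes>\<^bsub>\<Gamma>\<^esub> \<gamma>) = ?w ^ 2" using character_mult gen(1) by (simp add: power2_eq_square)
  ultimately show ?thesis using character_one gen(1) by (metis m_closed one_closed)
qed

text \<open>A free vertex at the origin would coincide with its images, and
  \<open>position q u = g * position q v\<close> would make vertices of different orbits
  coincide.\<close>

lemma separated_position:
  assumes fw: "framework V E q" and q: "C3_symmetric \<Gamma> \<tau> \<phi> V q"
  shows "separated q0 (verts G) (position q)"
proof -
  have inj: "u = v" if "u \<in> V" "v \<in> V" "to_complex (q u) = to_complex (q v)" for u v
    using fw that by (auto simp: framework_def inj_on_def)
  have nz: "position q x \<noteq> 0" if x: "x \<in> verts G" "x \<noteq> q0" for x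
  proof
    assume "position q x = 0"
    then have Q: "to_complex (q (rep x)) = 0" using symmetric_position(2)[OF q x(1)] by simp
    have r: "rep x \<in> V" using rep_in(2)[OF x(1)] .
    have "\<phi> g (rep x) = rep x" if g: "g \<in> carrier \<Gamma>" for g
      by (rule inj[OF phi_in[OF g r] r]) (use symmetric_position(1)[OF q g r] Q in simp)
    then have "fixed (rep x)" by (simp add: fixed_def)
    then show False using fixed_iff_q0[OF x(1)] x(2) by simp
  qed
  have z0: "position q q0 = 0" by (simp add: position_def)
  show ?thesis
    unfolding separated_def
  proof (intro conjI z0 ballI allI impI notI)
    fix u v and g :: complex
    assume uv: "u \<in> insert q0 (verts G)" "v \<in> insert q0 (verts G)" "u \<noteq> v" and g: "g ^ 3 = 1"
      and eq: "position q u = g * position q v"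
    have g0: "g \<noteq> 0" using cube_root_facts(1)[OF g] .
    show False
    proof (cases "u = q0 \<or> v = q0")
      case True
      then show False
      proof
        assume u: "u = q0"
        then have "v \<in> verts G" "v \<noteq> q0" using uv by simp_all
        then have "position q v \<noteq> 0" by (rule nz)
        then show False using eq z0 g0 u by simp
      next
        assume v: "v = q0"
        then have "u \<in> verts G" "u \<noteq> q0" using uv by simp_all
        then have "position q u \<noteq> 0" by (rule nz)
        then show False using eq z0 v by simp
      qed
    next
      case False
      then have V: "u \<in> verts G" "v \<in> verts G" using uv by auto
      obtain k where k: "k \<in> carrier \<Gamma>" "character k = g" using cube_root_character[OF g] by blast
      have r: "rep u \<in> V" "rep v \<in> V" using rep_in(2) V by auto
      have "rep u = \<phi> k (rep v)"
        by (rule inj[OF r(1) phi_in[OF k(1) r(2)]])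
          (use symmetric_position[OF q] k r V eq in simp)
      then have "rep u \<in> orb (rep v)" using k(1) by (auto simp: Group_Action.orbit_def)
      then have "orb (rep u) = orb (rep v)" using orb_eq(1)[OF r(2)] by blast
      then show False using rep_in(3) V uv(3) by metis
    qed
  qed
qed

text \<open>So tightness with \<open>l = 1\<close> means one edge less than there are
  columns.\<close>

lemma card_coords_verts: "card (coords m q0 (verts G)) = 2 * card (verts G \<inter> V1) + of_bool m * card (verts G \<inter> V0)"
proof -
  have "verts G \<inter> V1 = verts G - {q0}" "verts G \<inter> V0 = verts G \<inter> {q0}"
    by (auto simp: free_orbits_q0 fixed_orbits_q0)
  moreover have "of_bool m * card (verts G \<inter> {q0}) = of_bool (m \<and> q0 \<in> verts G)"
    by (auto simp: of_bool_def)
  ultimately show ?thesis using card_coords[OF finite_verts, of m q0] by simp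
qed

lemma tight_imp_independent:
  assumes H: "spanning H G" and tight: "gain_tight \<Gamma> V0 V1 (of_bool m) 1 H \<psi>"
  shows "\<exists>z. z q0 = 0 \<and> independent_rows m q0 z (gain_edge_of ` arcs H)"
    "card (coords m q0 (verts G)) \<le> card (gain_edge_of ` arcs H) + 1"
proof -
  have sub: "subgraph H G" and V: "verts H = verts G" using H by (auto simp: spanning_def)
  then have arcs: "arcs H \<subseteq> arcs G" by (auto simp: subgraph_def)
  have sparse: "gain_sparse \<Gamma> V0 V1 (of_bool m) 1 H \<psi>" using tight by (simp add: gain_tight_def)
  have fin: "finite (gain_edge_of ` arcs H)" using arcs finite_arcs finite_subset by blast
  show "\<exists>z. z q0 = 0 \<and> independent_rows m q0 z (gain_edge_of ` arcs H)"
  proof (cases m)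
    case True
    then show ?thesis
      using sparse_edges_independent[OF sparse_edges_of_gain_sparse[OF sub], of True] sparse by simp
  next
    case False
    then have sparse': "gain_sparse \<Gamma> V0 V1 (of_bool False) 1 H \<psi>" using sparse by simp
    have valid: "\<forall>e\<in>gain_edge_of ` arcs H. valid_edge q0 e" using arcs gain_edge_valid by auto
    have "\<exists>z. z q0 = 0 \<and> independent_rows False q0 z (gain_edge_of ` arcs H)"
    proof (rule sparse_edges_independent_False[OF fin valid])
      fix F \<theta> assume F: "F \<subseteq> gain_edge_of ` arcs H" "F \<noteq> {}"
      show "potential q0 \<theta> F \<Longrightarrow> 3 \<le> excess (verts_of F) F"
        by (rule sparse_counts(1)[OF sub sparse' F])
      show "int (card F) \<le> 2 * int (card (verts_of F - {q0})) - 1"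
        using sparse_counts(2)[OF sub sparse' F] by simp
    qed
    then show ?thesis using False by simp
  qed
  have "card (gain_edge_of ` arcs H) = card (arcs H)"
    using gain_edge_inj arcs by (metis card_image inj_on_subset)
  moreover have "int (card (arcs H)) = 2 * int (card (verts G \<inter> V1)) + of_bool m * int (card (verts G \<inter> V0)) - 1"
    using tight V by (simp add: gain_tight_def)
  moreover have "int (card (coords m q0 (verts G))) = 2 * int (card (verts G \<inter> V1)) + of_bool m * int (card (verts G \<inter> V0))"
    unfolding card_coords_verts by simp
  ultimately show "card (coords m q0 (verts G)) \<le> card (gain_edge_of ` arcs H) + 1" by linarith
qed

text \<open>At \<open>q\<close> both systems are independent, so \<open>q\<close> is rigid and has
  rank at least \<open>2 * card V - 3\<close>. Genericity of \<open>pt\<close> only says that its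
  rank is no smaller, and this is all that \<open>rigid_of_rank\<close> needs.\<close>

theorem rigid_of_tight:
  assumes generic: "C3_generic \<Gamma> \<tau> \<phi> V E pt"
    and H: "\<And>m. spanning (H m) G" "\<And>m. gain_tight \<Gamma> V0 V1 (of_bool m) 1 (H m) \<psi>"
  shows "infinitesimally_rigid V E pt"
proof -
  have fw: "framework V E pt" and sym: "C3_symmetric \<Gamma> \<tau> \<phi> V pt"
    and max: "\<And>q. framework V E q \<Longrightarrow> C3_symmetric \<Gamma> \<tau> \<phi> V q \<Longrightarrow>
      row_rank E (rigidity_matrix q) \<le> row_rank E (rigidity_matrix pt)"
    using generic by (auto simp: C3_generic_def)
  obtain x1 where x1: "x1 \<in> verts G" "x1 \<noteq> q0" using free_vertex[OF fw sym] by blast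
  define F where "F = (\<lambda>m. gain_edge_of ` arcs (H m))"
  have FG: "F m \<subseteq> gain_edge_of ` arcs G" for m using H(1)[of m] by (auto simp: F_def spanning_def subgraph_def)
  have finF: "finite (F m)" for m using FG finite_arcs finite_subset by blast
  have "\<exists>f. line_polynomial f \<and> (\<exists>z. z q0 = 0 \<and> f z \<noteq> 0) \<and> (\<forall>z. f z \<noteq> 0 \<longrightarrow> independent_rows m q0 z (F m))" for m
  proof -
    obtain z where z: "z q0 = 0" "independent_rows m q0 z (F m)"
      using tight_imp_independent(1)[OF H(1,2)] unfolding F_def by blast
    then show ?thesis using independent_rows_generic[OF finF z(2)] by blast
  qed
  then obtain f where f: "\<And>m. line_polynomial (f m)" "\<And>m. \<exists>z. z q0 = 0 \<and> f m z \<noteq> 0"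
    "\<And>m z. f m z \<noteq> 0 \<Longrightarrow> independent_rows m q0 z (F m)" by metis
  obtain z where z: "separated q0 (verts G) z" "\<forall>h\<in>{f True, f False}. h z \<noteq> 0"
    using separated_generic[OF finite_verts, of "{f True, f False}" q0] f(1,2) by auto
  then have zm: "f m z \<noteq> 0" for m by (cases m) auto
  obtain q where q: "C3_symmetric \<Gamma> \<tau> \<phi> V q" "framework V E q" "\<forall>x\<in>insert q0 (verts G). position q x = z x"
    using realize[OF z(1) x1] by blast
  have sepq: "separated q0 (verts G) (position q)"
    by (rule separated_position[OF q(2,1)])
  have "independent_rows m q0 (position q) (F m)" for m
  proof (rule independent_rows_cong[OF _ f(3)[OF zm]])
    fix w assume "w \<in> verts_of (F m)"
    then have "w \<in> verts G" using verts_of_mono[OF FG] verts_of_arcs[OF subset_refl] by blast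
    then show "z w = position q w" using q(3) by simp
  qed
  then have "infinitesimally_rigid V E q"
    using rigid_of_independent[OF q(1) sepq x1, of F] FG tight_imp_independent(2)[OF H(1,2)]
    unfolding F_def by blast
  then have "2 * card V \<le> row_rank E (rigidity_matrix q) + 3" by (rule rank_of_rigid[OF q(2)])
  then have "2 * card V \<le> row_rank E (rigidity_matrix pt) + 3" using max[OF q(2,1)] by simp
  then show ?thesis by (rule rigid_of_rank[OF fw])
qed

theorem tight_of_rigid:
  assumes fw: "framework V E q" and sym: "C3_symmetric \<Gamma> \<tau> \<phi> V q" and rigid: "infinitesimally_rigid V E q"
  shows "\<exists>H. spanning H G \<and> gain_tight \<Gamma> V0 V1 (of_bool m) 1 H \<psi>"
proof -
  obtain x1 where x1: "x1 \<in> verts G" "x1 \<noteq> q0" using free_vertex[OF fw sym] by blast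
  note sep = separated_position[OF fw sym]
  let ?T = "gain_edge_of ` arcs G"
  have fin: "finite ?T" using finite_arcs by simp
  have "\<exists>F\<subseteq>?T. independent_rows m q0 (position q) F \<and> card (coords m q0 (verts G)) \<le> card F + 1"
  proof (rule maximal_independent[OF finite_verts verts_of_arcs[OF subset_refl] fin, where ?p0.0 = "(x1, \<not> m)"])
    fix a b assume ab: "admissible m q0 a b" "\<forall>e\<in>?T. row m (position q) e a b = 0" "component a b (x1, \<not> m) = 0"
    then have "\<forall>e\<in>arcs G. row m (position q) (gain_edge_of e) a b = 0" by blast
    then show "\<forall>p\<in>coords m q0 (verts G). component a b p = 0"
      using kernel_of_rigid[OF sym rigid sep x1 ab(1) _ ab(3)] by blast
  qed
  then obtain F where F: "F \<subseteq> ?T" "independent_rows m q0 (position q) F"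
    "card (coords m q0 (verts G)) \<le> card F + 1" by blast
  define A where "A = {e\<in>arcs G. gain_edge_of e \<in> F}"
  have A: "A \<subseteq> arcs G" "F = gain_edge_of ` A" using F(1) by (auto simp: A_def)
  have cardA: "card A = card F" unfolding A(2) using gain_edge_inj A(1) by (metis card_image inj_on_subset)
  have finF: "finite F" using F(1) fin finite_subset by blast
  \<comment> \<open>The two columns at a free vertex force at least one row; the counts require a
    nonempty \<open>F\<close>.\<close>
  have "{(x1, True), (x1, False)} \<subseteq> coords m q0 (verts G)" using x1 by (auto simp: coords_def)
  then have "card {(x1, True), (x1, False)} \<le> card (coords m q0 (verts G))"
    by (rule card_mono[rotated]) (simp add: finite_verts)
  then have "F \<noteq> {}" using F(3) by auto
  have valid: "\<forall>e\<in>F. valid_edge q0 e" using F(1) gain_edge_valid by blast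
  have VF: "verts_of F \<subseteq> verts G" unfolding A(2) by (rule verts_of_arcs[OF A(1)])
  have le: "int (card F) \<le> 2 * int (card (verts G - {q0})) + of_bool (m \<and> q0 \<in> verts G) - 1"
    by (rule independent_rows_counts(1)[OF finite_verts VF \<open>F \<noteq> {}\<close> finF F(2) valid sep])
  have "int (card (coords m q0 (verts G))) = 2 * int (card (verts G - {q0})) + of_bool (m \<and> q0 \<in> verts G)"
    unfolding card_coords[OF finite_verts] by (simp only: of_nat_add of_nat_mult of_nat_numeral of_nat_of_bool)
  \<comment> \<open>Independence bounds the number of edges from above, corank one from
    below.\<close>
  then have "int (card A) = int (card (coords m q0 (verts G))) - 1" using le F(3) cardA by linarith
  then have "int (card A) = 2 * int (card (verts G \<inter> V1)) + of_bool m * int (card (verts G \<inter> V0)) - 1"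
    unfolding card_coords_verts by simp
  moreover have "gain_sparse \<Gamma> V0 V1 (of_bool m) 1 (with_arcs G A) \<psi>"
    using gain_sparse_of_independent[OF A(1) _ sep] F(2) A(2) by simp
  ultimately have "gain_tight \<Gamma> V0 V1 (of_bool m) 1 (with_arcs G A) \<psi>" by (simp add: gain_tight_def)
  then show ?thesis using spanning_with_arcs[OF A(1)] by blast
qed

end

theorem theorem7p13:
  fixes \<Gamma> :: "'g monoid" and \<gamma> :: 'g
    and V :: "'v set" and E :: "'v set set" and pt :: "'v \<Rightarrow> real^2"
    and \<phi> :: "'g \<Rightarrow> 'v \<Rightarrow> 'v" and \<tau> :: "'g \<Rightarrow> real^2^2"
    and rep :: "'v set \<Rightarrow> 'v"
    and G :: "('v set, 'v set set) pre_digraph" and \<psi> :: "'v set set \<Rightarrow> 'g"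
    and p :: "'v set \<Rightarrow> real^2"
  assumes "group \<Gamma>" and "\<gamma> \<in> carrier \<Gamma>" and "carrier \<Gamma> = generate \<Gamma> {\<gamma>}" and "card (carrier \<Gamma>) = 3"
    and "graph_action \<Gamma> \<phi> V E"
    and "C3_representation \<Gamma> \<gamma> \<tau>"
    and "C3_generic \<Gamma> \<tau> \<phi> V E pt"
    and "gain_framework \<Gamma> \<phi> V E pt rep G \<psi> p"
    and "card (fixed_orbits \<Gamma> \<phi> V) \<le> 1"
  shows "infinitesimally_rigid V E pt \<longleftrightarrow>
    (\<exists>H. spanning H G \<and>
       gain_tight \<Gamma> (fixed_orbits \<Gamma> \<phi> V) (free_orbits \<Gamma> \<phi> V) 0 1 H \<psi>) \<and>
    (\<exists>H. spanning H G \<and>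
       gain_tight \<Gamma> (fixed_orbits \<Gamma> \<phi> V) (free_orbits \<Gamma> \<phi> V) 1 1 H \<psi>)"
proof -
  have fw: "framework V E pt" and sym: "C3_symmetric \<Gamma> \<tau> \<phi> V pt"
    using assms(7) by (auto simp: C3_generic_def)
  interpret c3_graph \<Gamma> \<gamma> V E \<phi> \<tau> rep G \<psi>
    by (rule c3_graph.intro)
      (use assms(1-6,8,9) fw in \<open>simp_all only: framework_def gain_framework_def\<close>)
  show ?thesis
  proof (intro iffI conjI)
    assume rigid: "infinitesimally_rigid V E pt"
    show "\<exists>H. spanning H G \<and> gain_tight \<Gamma> V0 V1 0 1 H \<psi>"
      using tight_of_rigid[OF fw sym rigid, of False] by simp
    show "\<exists>H. spanning H G \<and> gain_tight \<Gamma> V0 V1 1 1 H \<psi>"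
      using tight_of_rigid[OF fw sym rigid, of True] by simp
  next
    assume "(\<exists>H. spanning H G \<and> gain_tight \<Gamma> V0 V1 0 1 H \<psi>) \<and> (\<exists>H. spanning H G \<and> gain_tight \<Gamma> V0 V1 1 1 H \<psi>)"
    then obtain H0 H1 where "spanning H0 G" "gain_tight \<Gamma> V0 V1 0 1 H0 \<psi>"
      "spanning H1 G" "gain_tight \<Gamma> V0 V1 1 1 H1 \<psi>" by blast
    then show "infinitesimally_rigid V E pt"
      by (intro rigid_of_tight[OF assms(7), of "\<lambda>m. if m then H1 else H0"]) auto
  qed
qed

end
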